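(* Let $f:(0,\infty)\to(0,\infty)$ be a matrix concave function with $f(1)=1$, and let $A,B\in\mathcal{M}_n$ be two accretive matrices with $W(A),W(B)\subset S_\alpha$ for some $0\le\alpha<\pi/2$. Then $$\mathfrak{R}\left(\frac{f(A)+f(B)}{2}\right)\le\sec^2(\alpha)\int_0^1\mathfrak{R}f\big((1-t)A+tB\big)\,dt\le\sec^4(\alpha)\,\mathfrak{R}f\left(\frac{A+B}{2}\right).$$
   Context: $\mathcal{M}_n$ is the algebra of complex $n\times n$ matrices; $\mathfrak{R}A=\frac{A+A^*}{2}$; $A$ is accretive if $\mathfrak{R}A>0$ (positive definite). Inequalities between Hermitian matrices are in the Loewner (positive semidefinite) order. $W(A)=\{\langle Ax,x\rangle:\|x\|=1\}$ is the numerical range, and $S_\alpha=\{z\in\mathbb{C}:\Re z>0,\ |\Im z|\le\tan(\alpha)\,\Re z\}$. Matrix concave means $f((1-\lambda)X+\lambda Y)\ge(1-\lambda)f(X)+\lambda f(Y)$ for all positive definite $X,Y$ of every size and $\lambda\in[0,1]$; such a positive $f$ on $(0,\infty)$ is matrix monotone and extends analytically to $\mathbb{C}\setminus(-\infty,0]$. For a matrix $X$ with no eigenvalue in $(-\infty,0]$ (in particular $X$ accretive), $f(X)=\frac{1}{2\pi i}\int_\Gamma f(z)(zI-X)^{-1}dz$, where $\Gamma$ is a simple closed curve in the domain of analyticity surrounding the eigenvalues of $X$. *)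

theory Defs
  imports
    "HOL-Complex_Analysis.Complex_Analysis"
    "Jordan_Normal_Form.Gauss_Jordan_Elimination"
    "Jordan_Normal_Form.Schur_Decomposition"
    "Jordan_Normal_Form.Spectral_Radius"
begin

text \<open>
  Matrices are those of \<^theory>\<open>Jordan_Normal_Form.Matrix\<close>, whose size is a number and not a
  type, because matrix concavity quantifies over matrices of every size. Since
  \<^term>\<open>v \<bullet>c w\<close> conjugates \<^term>\<open>w\<close>, the inner product of \<open>A x\<close> and \<open>x\<close> is
  \<^term>\<open>(A *\<^sub>v x) \<bullet>c x\<close>.
\<close>

definition hermitian_mat :: "complex mat \<Rightarrow> bool" where
  "hermitian_mat A \<longleftrightarrow> mat_adjoint A = A"

definition pos_def_mat :: "nat \<Rightarrow> complex mat \<Rightarrow> bool" where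
  "pos_def_mat n A \<longleftrightarrow> A \<in> carrier_mat n n \<and> hermitian_mat A \<and>
     (\<forall>x\<in>carrier_vec n. x \<noteq> 0\<^sub>v n \<longrightarrow> Re ((A *\<^sub>v x) \<bullet>c x) > 0)"

definition pos_semidef_mat :: "nat \<Rightarrow> complex mat \<Rightarrow> bool" where
  "pos_semidef_mat n A \<longleftrightarrow> A \<in> carrier_mat n n \<and> hermitian_mat A \<and>
     (\<forall>x\<in>carrier_vec n. Re ((A *\<^sub>v x) \<bullet>c x) \<ge> 0)"

text \<open>The order \<open>\<le>\<close> that the matrix library puts on \<open>mat\<close> is entrywise, so it is not used here.\<close>

definition loewner_le :: "nat \<Rightarrow> complex mat \<Rightarrow> complex mat \<Rightarrow> bool" where
  "loewner_le n A B \<longleftrightarrow>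
     A \<in> carrier_mat n n \<and> B \<in> carrier_mat n n \<and> hermitian_mat A \<and> hermitian_mat B \<and>
     pos_semidef_mat n (B - A)"

definition re_mat :: "complex mat \<Rightarrow> complex mat" where
  "re_mat A = (1/2) \<cdot>\<^sub>m (A + mat_adjoint A)"

definition accretive_mat :: "nat \<Rightarrow> complex mat \<Rightarrow> bool" where
  "accretive_mat n A \<longleftrightarrow> A \<in> carrier_mat n n \<and> pos_def_mat n (re_mat A)"

definition numerical_range :: "nat \<Rightarrow> complex mat \<Rightarrow> complex set" where
  "numerical_range n A = {(A *\<^sub>v x) \<bullet>c x | x. x \<in> carrier_vec n \<and> sqrt (Re (x \<bullet>c x)) = 1}"

definition sector :: "real \<Rightarrow> complex set" where
  "sector \<alpha> = {z. Re z > 0 \<and> \<bar>Im z\<bar> \<le> tan \<alpha> * Re z}"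

text \<open>
  Functional calculus of a real function at a Hermitian matrix \<open>X = U D U\<^sup>*\<close> with \<open>U\<close> unitary and
  \<open>D\<close> real diagonal; the value \<open>U f(D) U\<^sup>*\<close> does not depend on the decomposition. Matrix concavity
  has to be stated with this calculus: the contour integral below needs the analytic extension,
  which exists only because \<open>f\<close> is positive and matrix concave.
\<close>

definition spectral_fun :: "(real \<Rightarrow> real) \<Rightarrow> complex mat \<Rightarrow> complex mat" where
  "spectral_fun f X = (let n = dim_row X in
     SOME Y. \<exists>U d. U \<in> carrier_mat n n \<and> U * mat_adjoint U = 1\<^sub>m n \<and> mat_adjoint U * U = 1\<^sub>m n \<and>
       X = U * mat_diag n (\<lambda>i. complex_of_real (d i)) * mat_adjoint U \<and>
       Y = U * mat_diag n (\<lambda>i. complex_of_real (f (d i))) * mat_adjoint U)"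

definition matrix_concave :: "(real \<Rightarrow> real) \<Rightarrow> bool" where
  "matrix_concave f \<longleftrightarrow>
     (\<forall>n X Y (s::real). pos_def_mat n X \<longrightarrow> pos_def_mat n Y \<longrightarrow> 0 \<le> s \<longrightarrow> s \<le> 1 \<longrightarrow>
        loewner_le n
          (complex_of_real (1 - s) \<cdot>\<^sub>m spectral_fun f X + complex_of_real s \<cdot>\<^sub>m spectral_fun f Y)
          (spectral_fun f (complex_of_real (1 - s) \<cdot>\<^sub>m X + complex_of_real s \<cdot>\<^sub>m Y)))"

text \<open>
  The analytic extension of \<open>f\<close> from \<open>(0,\<infinity>)\<close> to the slit plane. On the slit plane it is unique by
  the identity theorem; it exists when \<open>f\<close> is positive and matrix concave (Loewner's theorem).
\<close>

definition analytic_extension :: "(real \<Rightarrow> real) \<Rightarrow> complex \<Rightarrow> complex" where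
  "analytic_extension f = (SOME F. F holomorphic_on (- \<real>\<^sub>\<le>\<^sub>0) \<and>
     (\<forall>x>0. F (complex_of_real x) = complex_of_real (f x)))"

text \<open>
  A positively oriented simple closed curve in the slit plane around all eigenvalues of \<open>X\<close>. Its
  inside lies in the slit plane automatically, since the slit plane is simply connected.
\<close>

definition surrounding_contour :: "complex mat \<Rightarrow> (real \<Rightarrow> complex) \<Rightarrow> bool" where
  "surrounding_contour X \<gamma> \<longleftrightarrow> valid_path \<gamma> \<and> simple_path \<gamma> \<and> pathfinish \<gamma> = pathstart \<gamma> \<and>
     path_image \<gamma> \<subseteq> - \<real>\<^sub>\<le>\<^sub>0 - spectrum X \<and> (\<forall>w\<in>spectrum X. winding_number \<gamma> w = 1)"

definition resolvent_mat :: "complex mat \<Rightarrow> complex \<Rightarrow> complex mat" where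
  "resolvent_mat X z = the (mat_inverse (z \<cdot>\<^sub>m 1\<^sub>m (dim_row X) - X))"

text \<open>
  Entrywise contour integral. By Cauchy's theorem the value is the same for every surrounding
  contour, so it does not matter which one is chosen.
\<close>

definition matrix_fun :: "(real \<Rightarrow> real) \<Rightarrow> complex mat \<Rightarrow> complex mat" where
  "matrix_fun f X = (let n = dim_row X; \<gamma> = (SOME \<gamma>. surrounding_contour X \<gamma>) in
     Matrix.mat n n (\<lambda>(i,j). 1 / (2 * complex_of_real pi * \<i>) *
       contour_integral \<gamma> (\<lambda>z. analytic_extension f z * resolvent_mat X z $$ (i,j))))"

definition mat_integral :: "nat \<Rightarrow> real set \<Rightarrow> (real \<Rightarrow> complex mat) \<Rightarrow> complex mat" where
  "mat_integral n S G = Matrix.mat n n (\<lambda>(i,j). integral S (\<lambda>t. G t $$ (i,j)))"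

end

theory Submission
  imports Defs
begin

text \<open>
  Let \<open>f\<^sub>s(z) = z / ((1 - s) z + s)\<close> for \<open>0 \<le> s \<le> 1\<close>. Matrix concavity makes two Loewner kernels on
  the grid points of \<open>(0,\<infinity>)\<close> positive semidefinite. Writing both as Gram matrices in a common
  orthonormal basis interpolates \<open>f\<close> on the grid by a convex combination of the \<open>f\<^sub>s\<close>. By
  Montel's theorem these combinations converge on the slit plane to the analytic extension of \<open>f\<close>,
  so inequalities valid for every \<open>f\<^sub>s\<close> pass to \<open>f\<close>.

  If \<open>A\<close> is accretive with numerical range in \<open>S\<^sub>\<alpha>\<close> and \<open>H\<close> is its real part, a variational
  description of \<open>f\<^sub>s(H)\<close> gives \<open>f\<^sub>s(H) \<le> Re f\<^sub>s(A) \<le> sec\<^sup>2(\<alpha>) f\<^sub>s(H)\<close>, and therefore the same for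
  \<open>f\<close>. The function \<open>t \<mapsto> \<langle>f((1 - t) Re A + t Re B) x, x\<rangle>\<close> is concave, and the Hermite-Hadamard
  inequality for it yields both claims, with one factor \<open>sec\<^sup>2(\<alpha>)\<close> for each.
\<close>

section \<open>Adjoints, inner products and the spectral theorem\<close>

text \<open>\<open>f_s\<close> is the harmonic mean of 1 and \<open>z\<close> with weights
  \<open>1 - s\<close> and \<open>s\<close>. It is 1 at \<open>z = 1\<close>, so the weights of an
  interpolating combination add up to \<open>f(1) = 1\<close>. For \<open>f = f_s\<close> and
  \<open>D(x) = (1 - s) x + s\<close> the two Loewner kernels are \<open>s / (D(x) D(y))\<close> and
  \<open>(1 - s) x y / (D(x) D(y))\<close>. Both have rank one with the same factor
  \<open>1 / D\<close>, and comparing them reveals \<open>s\<close>. The interpolation undoes this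
  for a sum of such terms, hence two kernels and one common basis.

  Concavity is a statement about the spectral calculus of Hermitian matrices, whereas the conclusion
  is about contour integrals of an extension picked by \<open>SOME\<close>. The limit of the
  interpolants bridges the two: it provides the extension together with its approximation, and no
  integral representation of \<open>f\<close> is presupposed.

  Along the segment, concavity is available only for the real parts, so \<open>Re f(A)\<close> must
  be compared with \<open>f(Re A)\<close>. Only the upper comparison costs a factor; it comes from
  \<open>A^* H^-1 A <= (1 + tan(\<alpha>)^2) H\<close>, where \<open>H = Re A\<close>.\<close>

lemma cscalar_prod_sum:
  fixes x y :: "complex vec"
  assumes "y \<in> carrier_vec n"
  shows "x \<bullet>c y = (\<Sum>i<n. x $ i * cnj (y $ i))"
  using assms by (auto simp: scalar_prod_def atLeast0LessThan)

lemma mat_mult_vec_index_sum: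
  fixes A :: "'a :: comm_semiring_0 mat"
  assumes "A \<in> carrier_mat n m" "x \<in> carrier_vec m" "i < n"
  shows "(A *\<^sub>v x) $ i = (\<Sum>j<m. A $$ (i,j) * x $ j)"
  using assms by (auto simp: scalar_prod_def atLeast0LessThan)

lemma dim_mat_adjoint [simp]:
  "dim_row (mat_adjoint A) = dim_col A" "dim_col (mat_adjoint A) = dim_row A"
  by (auto simp: mat_adjoint_def)

lemma mat_adjoint_carrier [simp]:
  "mat_adjoint A \<in> carrier_mat m n \<longleftrightarrow> A \<in> carrier_mat n m"
  by (metis carrier_matD carrier_matI dim_mat_adjoint)

lemma mat_adjoint_index [simp]:
  fixes A :: "complex mat"
  assumes "i < dim_col A" "j < dim_row A"
  shows "mat_adjoint A $$ (i,j) = cnj (A $$ (j,i))"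
  using assms by (auto simp: mat_adjoint_def mat_of_rows_def)

lemma mat_adjoint_adjoint [simp]: "mat_adjoint (mat_adjoint A) = (A :: complex mat)"
  by (rule eq_matI) auto

lemma mat_adjoint_mult:
  fixes A B :: "complex mat"
  assumes "A \<in> carrier_mat n m" "B \<in> carrier_mat m k"
  shows "mat_adjoint (A * B) = mat_adjoint B * mat_adjoint A"
  using assms by (intro eq_matI) (auto simp: scalar_prod_def intro!: sum.cong)

lemma mat_adjoint_add:
  fixes A B :: "complex mat"
  assumes "A \<in> carrier_mat n m" "B \<in> carrier_mat n m"
  shows "mat_adjoint (A + B) = mat_adjoint A + mat_adjoint B"
  using assms by (intro eq_matI) auto

lemma mat_adjoint_minus:
  fixes A B :: "complex mat"
  assumes "A \<in> carrier_mat n m" "B \<in> carrier_mat n m"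
  shows "mat_adjoint (A - B) = mat_adjoint A - mat_adjoint B"
  using assms by (intro eq_matI) auto

lemma mat_adjoint_smult: "mat_adjoint (c \<cdot>\<^sub>m A) = cnj c \<cdot>\<^sub>m mat_adjoint (A :: complex mat)"
  by (intro eq_matI) auto

lemma mat_adjoint_one [simp]: "mat_adjoint (1\<^sub>m n) = (1\<^sub>m n :: complex mat)"
  by (intro eq_matI) auto

lemma dim_mat_diag [simp]: "dim_row (mat_diag n d) = n" "dim_col (mat_diag n d) = n"
  by (simp_all add: mat_diag_def)

lemma mat_adjoint_mat_diag: "mat_adjoint (mat_diag n d) = mat_diag n (\<lambda>i. cnj (d i))"
  by (intro eq_matI) (auto simp: mat_diag_def)

lemma cscalar_prod_adjoint:
  fixes A :: "complex mat"
  assumes A: "A \<in> carrier_mat n m" and x: "x \<in> carrier_vec m" and y: "y \<in> carrier_vec n"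
  shows "(A *\<^sub>v x) \<bullet>c y = x \<bullet>c (mat_adjoint A *\<^sub>v y)"
proof -
  have A': "mat_adjoint A \<in> carrier_mat m n" using A by simp
  have "x \<bullet>c (mat_adjoint A *\<^sub>v y) = (\<Sum>j<m. x $ j * cnj ((mat_adjoint A *\<^sub>v y) $ j))"
    by (rule cscalar_prod_sum) (rule mult_mat_vec_carrier[OF A' y])
  also have "\<dots> = (\<Sum>j<m. x $ j * cnj (\<Sum>i<n. cnj (A $$ (i,j)) * y $ i))"
  proof (rule sum.cong[OF refl])
    fix j assume j: "j \<in> {..<m}"
    hence "(mat_adjoint A *\<^sub>v y) $ j = (\<Sum>i<n. mat_adjoint A $$ (j,i) * y $ i)"
      using mat_mult_vec_index_sum[OF A' y] by simp
    also have "\<dots> = (\<Sum>i<n. cnj (A $$ (i,j)) * y $ i)"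
      using A j by (intro sum.cong) auto
    finally show "x $ j * cnj ((mat_adjoint A *\<^sub>v y) $ j) =
      x $ j * cnj (\<Sum>i<n. cnj (A $$ (i,j)) * y $ i)" by simp
  qed
  also have "\<dots> = (\<Sum>j<m. \<Sum>i<n. A $$ (i,j) * x $ j * cnj (y $ i))"
    by (simp add: sum_distrib_left mult_ac)
  also have "\<dots> = (\<Sum>i<n. (\<Sum>j<m. A $$ (i,j) * x $ j) * cnj (y $ i))"
    by (subst sum.swap) (simp add: sum_distrib_right)
  also have "\<dots> = (\<Sum>i<n. (A *\<^sub>v x) $ i * cnj (y $ i))"
    by (intro sum.cong refl) (simp only: mat_mult_vec_index_sum[OF A x] lessThan_iff)
  also have "\<dots> = (A *\<^sub>v x) \<bullet>c y"
    by (rule cscalar_prod_sum[OF y, symmetric])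
  finally show ?thesis by (rule sym)
qed

lemma cscalar_prod_commute:
  fixes x y :: "complex vec"
  assumes "x \<in> carrier_vec n" "y \<in> carrier_vec n"
  shows "y \<bullet>c x = cnj (x \<bullet>c y)"
  using assms by (simp add: cscalar_prod_sum[where n=n] mult_ac)

lemma cscalar_prod_self:
  fixes x :: "complex vec"
  assumes "x \<in> carrier_vec n"
  shows "x \<bullet>c x = of_real (\<Sum>i<n. (cmod (x $ i))\<^sup>2)"
  using assms by (simp add: cscalar_prod_sum[where n=n] complex_norm_square[symmetric] of_real_sum[symmetric] del: of_real_sum of_real_power)

lemma cscalar_prod_self_nonneg:
  fixes x :: "complex vec"
  assumes "x \<in> carrier_vec n"
  shows "Re (x \<bullet>c x) \<ge> 0" "Im (x \<bullet>c x) = 0"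
  using assms by (simp_all add: cscalar_prod_self sum_nonneg)

lemma cscalar_prod_self_pos:
  fixes x :: "complex vec"
  assumes x: "x \<in> carrier_vec n" "x \<noteq> 0\<^sub>v n"
  shows "Re (x \<bullet>c x) > 0"
proof -
  obtain i where i: "i < n" "x $ i \<noteq> 0"
    using x by (metis carrier_vecD eq_vecI index_zero_vec)
  have "0 < (\<Sum>i<n. (cmod (x $ i))\<^sup>2)"
    by (rule sum_pos2[of _ i]) (use i in auto)
  thus ?thesis using x by (simp add: cscalar_prod_self)
qed

lemma cscalar_prod_right_add:
  fixes x y z :: "complex vec"
  assumes "x \<in> carrier_vec n" "y \<in> carrier_vec n" "z \<in> carrier_vec n"
  shows "x \<bullet>c (y + z) = x \<bullet>c y + x \<bullet>c z"
  using assms by (simp add: cscalar_prod_sum[where n=n] ring_distribs sum.distrib)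

lemma cscalar_prod_left_add:
  fixes x y z :: "complex vec"
  assumes "x \<in> carrier_vec n" "y \<in> carrier_vec n" "z \<in> carrier_vec n"
  shows "(x + y) \<bullet>c z = x \<bullet>c z + y \<bullet>c z"
  using assms by (simp add: cscalar_prod_sum[where n=n] ring_distribs sum.distrib)

lemma cscalar_prod_right_minus:
  fixes x y z :: "complex vec"
  assumes "x \<in> carrier_vec n" "y \<in> carrier_vec n" "z \<in> carrier_vec n"
  shows "x \<bullet>c (y - z) = x \<bullet>c y - x \<bullet>c z"
  using assms by (simp add: cscalar_prod_sum[where n=n] ring_distribs sum_subtractf)

lemma cscalar_prod_left_minus:
  fixes x y z :: "complex vec"
  assumes "x \<in> carrier_vec n" "y \<in> carrier_vec n" "z \<in> carrier_vec n"
  shows "(x - y) \<bullet>c z = x \<bullet>c z - y \<bullet>c z"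
  using assms by (simp add: cscalar_prod_sum[where n=n] ring_distribs sum_subtractf)

lemma cscalar_prod_left_smult:
  fixes x y :: "complex vec"
  assumes "x \<in> carrier_vec n" "y \<in> carrier_vec n"
  shows "(c \<cdot>\<^sub>v x) \<bullet>c y = c * (x \<bullet>c y)"
  using assms by (simp add: cscalar_prod_sum[where n=n] sum_distrib_left mult_ac)

lemma cscalar_prod_right_smult:
  fixes x y :: "complex vec"
  assumes "x \<in> carrier_vec n" "y \<in> carrier_vec n"
  shows "x \<bullet>c (c \<cdot>\<^sub>v y) = cnj c * (x \<bullet>c y)"
  using assms by (simp add: cscalar_prod_sum[where n=n] sum_distrib_left mult_ac)

lemmas cscalar_prod_algebra =
  cscalar_prod_left_add cscalar_prod_right_add cscalar_prod_left_minus cscalar_prod_right_minus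
  cscalar_prod_left_smult cscalar_prod_right_smult

lemma mat_diag_mult_vec_index [simp]:
  fixes d :: "nat \<Rightarrow> 'a :: comm_semiring_0"
  assumes "x \<in> carrier_vec n" "i < n"
  shows "(mat_diag n d *\<^sub>v x) $ i = d i * x $ i"
proof -
  have "(mat_diag n d *\<^sub>v x) $ i = (\<Sum>j<n. mat_diag n d $$ (i,j) * x $ j)"
    using assms by (intro mat_mult_vec_index_sum) auto
  also have "\<dots> = (\<Sum>j<n. if i = j then d j * x $ j else 0)"
    using assms by (intro sum.cong) (auto simp: mat_diag_def)
  finally show ?thesis using assms by simp
qed

lemma mat_mult_unit_vec:
  fixes A :: "'a :: comm_semiring_1 mat"
  assumes "A \<in> carrier_mat n m" "j < m"
  shows "A *\<^sub>v unit_vec m j = col A j"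
  using assms by (intro eq_vecI) (auto simp: scalar_prod_right_unit)

lemma cscalar_prod_unit_vec:
  fixes x :: "complex vec"
  assumes "x \<in> carrier_vec n" "i < n"
  shows "x \<bullet>c unit_vec n i = x $ i"
proof -
  have "x \<bullet>c unit_vec n i = (\<Sum>j<n. x $ j * cnj (unit_vec n i $ j))"
    by (rule cscalar_prod_sum) simp
  also have "\<dots> = (\<Sum>j<n. if j = i then x $ j else 0)"
    using assms by (intro sum.cong) auto
  finally show ?thesis using assms by simp
qed

lemma assoc_mult_square_mat:
  fixes A B C :: "'a :: semiring_0 mat"
  assumes "A \<in> carrier_mat n n" "B \<in> carrier_mat n n" "C \<in> carrier_mat n n"
  shows "A * B * C = A * (B * C)"
  using assms by (rule assoc_mult_mat)

lemma mult_square_mat_carrier: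
  "A \<in> carrier_mat n n \<Longrightarrow> B \<in> carrier_mat n n \<Longrightarrow> A * B \<in> carrier_mat n n"
  by (rule mult_carrier_mat)

section \<open>Unitary matrices and diagonalization of Hermitian matrices\<close>

lemma unitary_mat_cols:
  fixes W :: "complex mat"
  assumes W: "W \<in> carrier_mat n n"
    and orth: "\<And>i j. i < n \<Longrightarrow> j < n \<Longrightarrow> col W i \<bullet>c col W j = (if i = j then 1 else 0)"
  shows "mat_adjoint W * W = 1\<^sub>m n" "W * mat_adjoint W = 1\<^sub>m n"
proof -
  have "(mat_adjoint W * W) $$ (i,j) = col W j \<bullet>c col W i" if "i < n" "j < n" for i j
    using W that by (auto simp: scalar_prod_def mult_ac)
  thus *: "mat_adjoint W * W = 1\<^sub>m n"
    using W orth by (intro eq_matI) auto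
  show "W * mat_adjoint W = 1\<^sub>m n"
    by (rule mat_mult_left_right_inverse[OF _ W *]) (use W in auto)
qed

text \<open>Gram-Schmidt applied to a basis that starts with \<open>v\<close> leaves
  \<open>v\<close> in first place. Its output is orthogonal but not normalized, so every column is
  divided by its norm; this is the origin of the factor \<open>c\<close>.\<close>

lemma unitary_completion:
  fixes v :: "complex vec"
  assumes v: "v \<in> carrier_vec n" and v0: "v \<noteq> 0\<^sub>v n"
  obtains W c where "W \<in> carrier_mat n n" "mat_adjoint W * W = 1\<^sub>m n" "W * mat_adjoint W = 1\<^sub>m n"
    "col W 0 = c \<cdot>\<^sub>v v"
proof -
  interpret cof_vec_space n "TYPE(complex)" .
  define ws where "ws = gram_schmidt n (basis_completion v)"
  note bc = basis_completion[OF v v0]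
  have n: "0 < n" using v v0 by (cases n) auto
  have gs: "set ws \<subseteq> carrier_vec n" "corthogonal ws" "length ws = n"
    using gram_schmidt_result[OF _ _ _ ws_def] bc by auto
  have hd: "ws ! 0 = v"
  proof -
    obtain vs where "basis_completion v = v # vs"
      using bc n by (cases "basis_completion v") auto
    hence "hd ws = v" using gram_schmidt_hd[OF v, of vs] by (simp add: ws_def)
    thus ?thesis using gs n by (cases ws) auto
  qed
  define r where "r j = Re (ws ! j \<bullet>c ws ! j)" for j
  have wsc: "ws ! j \<in> carrier_vec n" if "j < n" for j using gs that by auto
  have orth: "ws ! i \<bullet>c ws ! j = 0" if "i < n" "j < n" "i \<noteq> j" for i j
    using corthogonalD[OF gs(2), of i j] gs(3) that by auto
  have self: "ws ! j \<bullet>c ws ! j = of_real (r j)" "r j > 0" if "j < n" for j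
  proof -
    show *: "ws ! j \<bullet>c ws ! j = of_real (r j)"
      using cscalar_prod_self_nonneg(2)[OF wsc[OF that]] by (simp add: r_def complex_eq_iff)
    have "r j \<noteq> 0" using corthogonalD[OF gs(2), of j j] gs(3) that * by auto
    thus "r j > 0" using cscalar_prod_self_nonneg(1)[OF wsc[OF that]] by (simp add: r_def)
  qed
  define s where "s j = complex_of_real (1 / sqrt (r j))" for j
  define W where "W = mat_of_cols n (map (\<lambda>j. s j \<cdot>\<^sub>v ws ! j) [0..<n])"
  have W: "W \<in> carrier_mat n n" unfolding W_def by (rule carrier_matI) simp_all
  have col: "col W j = s j \<cdot>\<^sub>v ws ! j" if "j < n" for j
    unfolding W_def using that wsc[OF that] by (subst col_mat_of_cols) simp_all
  have "col W i \<bullet>c col W j = (if i = j then 1 else 0)" if "i < n" "j < n" for i j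
  proof -
    have "col W i \<bullet>c col W j = s i * s j * (ws ! i \<bullet>c ws ! j)"
      unfolding col[OF that(1)] col[OF that(2)]
      using wsc[OF that(1)] wsc[OF that(2)]
      by (subst cscalar_prod_left_smult[where n=n], simp, simp,
          subst cscalar_prod_right_smult[where n=n]) (simp_all add: s_def)
    also have "\<dots> = (if i = j then 1 else 0)"
    proof (cases "i = j")
      case True
      have "s i * s i * of_real (r i) = of_real ((1 / sqrt (r i)) * (1 / sqrt (r i)) * r i)"
        by (simp only: s_def of_real_mult)
      also have "(1 / sqrt (r i)) * (1 / sqrt (r i)) * r i = 1"
        using self(2)[OF that(1)] by simp
      finally show ?thesis using True self(1)[OF that(1)] by simp
    next
      case False
      thus ?thesis using orth[OF that False] by simp
    qed
    finally show ?thesis .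
  qed
  from unitary_mat_cols[OF W this] W col[OF n] hd show thesis
    using that[of W "s 0"] by simp
qed

lemma mat_adjoint_four_block:
  fixes A B C D :: "complex mat"
  assumes "A \<in> carrier_mat nr1 nc1" "B \<in> carrier_mat nr1 nc2"
    "C \<in> carrier_mat nr2 nc1" "D \<in> carrier_mat nr2 nc2"
  shows "mat_adjoint (four_block_mat A B C D) =
    four_block_mat (mat_adjoint A) (mat_adjoint C) (mat_adjoint B) (mat_adjoint D)"
  using assms by (intro eq_matI) (auto)

lemma mult_block_diag_mat:
  fixes A B C D :: "'a :: comm_ring_1 mat"
  assumes "A \<in> carrier_mat n n" "B \<in> carrier_mat m m" "C \<in> carrier_mat n n" "D \<in> carrier_mat m m"
  shows "four_block_mat A (0\<^sub>m n m) (0\<^sub>m m n) B * four_block_mat C (0\<^sub>m n m) (0\<^sub>m m n) D =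
    four_block_mat (A * C) (0\<^sub>m n m) (0\<^sub>m m n) (B * D)"
  using assms by (subst mult_four_block_mat[of _ n n _ m _ m _ _ n _ m]) auto

lemma hermitian_mat_index:
  assumes "hermitian_mat A" "A \<in> carrier_mat n n" "i < n" "j < n"
  shows "A $$ (j,i) = cnj (A $$ (i,j))"
  by (metis assms carrier_matD hermitian_mat_def mat_adjoint_index)

text \<open>Induction on the size. An eigenvector is completed to a unitary \<open>W\<close>, so the
  first column of \<open>W^* A W\<close> is the eigenvalue times the first unit vector. Hermitian
  symmetry clears the first row as well, and the induction hypothesis applies to the remaining block
  \<open>B3\<close>.\<close>

theorem hermitian_diagonalization:
  assumes "A \<in> carrier_mat n n" "hermitian_mat A"
  shows "\<exists>U d. U \<in> carrier_mat n n \<and> U * mat_adjoint U = 1\<^sub>m n \<and> mat_adjoint U * U = 1\<^sub>m n \<and>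
    A = U * mat_diag n (\<lambda>i. complex_of_real (d i)) * mat_adjoint U"
  using assms
proof (induction n arbitrary: A)
  case 0
  thus ?case by (intro exI[of _ A] exI[of _ "\<lambda>_. 0"]) auto
next
  case (Suc n A)
  obtain e where "e \<in> spectrum A" using spectrum_non_empty[OF Suc.prems(1)] by auto
  then obtain v where v: "v \<in> carrier_vec (Suc n)" "v \<noteq> 0\<^sub>v (Suc n)" "A *\<^sub>v v = e \<cdot>\<^sub>v v"
    using Suc.prems(1) by (auto simp: spectrum_def eigenvalue_def eigenvector_def)
  obtain W c where W: "W \<in> carrier_mat (Suc n) (Suc n)" "mat_adjoint W * W = 1\<^sub>m (Suc n)"
    "W * mat_adjoint W = 1\<^sub>m (Suc n)" and W0: "col W 0 = c \<cdot>\<^sub>v v"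
    using unitary_completion[OF v(1,2)] by blast
  define W' where "W' = mat_adjoint W"
  have W': "W' \<in> carrier_mat (Suc n) (Suc n)" using W by (simp add: W'_def)
  define B where "B = W' * A * W"
  note A = Suc.prems(1)
  have B: "B \<in> carrier_mat (Suc n) (Suc n)" using W W' A by (simp add: B_def)
  have hB: "mat_adjoint B = B"
  proof -
    have "mat_adjoint B = mat_adjoint W * mat_adjoint (W' * A)"
      unfolding B_def by (rule mat_adjoint_mult) (use W W' A in auto)
    also have "mat_adjoint (W' * A) = mat_adjoint A * mat_adjoint W'"
      by (rule mat_adjoint_mult) (use W W' A in auto)
    finally show ?thesis
      using Suc.prems W W' by (simp add: W'_def B_def hermitian_mat_def assoc_mult_mat[of _ "Suc n" "Suc n" _ "Suc n"])
  qed
  have B0: "B $$ (i,0) = (if i = 0 then e else 0)" if i: "i < Suc n" for i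
  proof -
    have "col B 0 = B *\<^sub>v unit_vec (Suc n) 0" using B by (simp add: mat_mult_unit_vec)
    also have "\<dots> = W' *\<^sub>v (A *\<^sub>v (W *\<^sub>v unit_vec (Suc n) 0))"
      unfolding B_def using W W' A by (simp add: assoc_mult_mat_vec[of _ "Suc n" "Suc n" _ "Suc n"])
    also have "W *\<^sub>v unit_vec (Suc n) 0 = c \<cdot>\<^sub>v v" using W W0 by (simp add: mat_mult_unit_vec)
    also have "A *\<^sub>v (c \<cdot>\<^sub>v v) = e \<cdot>\<^sub>v (c \<cdot>\<^sub>v v)"
      using A v by (simp add: mult_mat_vec smult_smult_assoc mult.commute)
    also have "c \<cdot>\<^sub>v v = W *\<^sub>v unit_vec (Suc n) 0" using W W0 by (simp add: mat_mult_unit_vec)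
    also have "W' *\<^sub>v (e \<cdot>\<^sub>v (W *\<^sub>v unit_vec (Suc n) 0)) = e \<cdot>\<^sub>v (W' * W *\<^sub>v unit_vec (Suc n) 0)"
      using W W' by (simp add: mult_mat_vec assoc_mult_mat_vec[of _ "Suc n" "Suc n" _ "Suc n"])
    also have "\<dots> = e \<cdot>\<^sub>v unit_vec (Suc n) 0" using W by (simp add: W'_def)
    finally have "col B 0 $ i = (e \<cdot>\<^sub>v unit_vec (Suc n) 0) $ i" by simp
    thus ?thesis using B i by (auto simp: unit_vec_def)
  qed
  have hB': "B $$ (j,i) = cnj (B $$ (i,j))" if "i < Suc n" "j < Suc n" for i j
    using hermitian_mat_index[of B "Suc n" i j] hB B that by (auto simp: hermitian_mat_def)
  define B3 where "B3 = mat n n (\<lambda>(i,j). B $$ (Suc i, Suc j))"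
  have B3: "B3 \<in> carrier_mat n n" by (simp add: B3_def)
  have "hermitian_mat B3"
    unfolding hermitian_mat_def
    by (intro eq_matI) (simp_all add: B3_def hB'[symmetric])
  from Suc.IH[OF B3 this] obtain U d where U: "U \<in> carrier_mat n n"
    "U * mat_adjoint U = 1\<^sub>m n" "mat_adjoint U * U = 1\<^sub>m n"
    and B3U: "B3 = U * mat_diag n (\<lambda>i. complex_of_real (d i)) * mat_adjoint U" by blast
  define er where "er = Re e"
  \<comment> \<open>The corner entry of a Hermitian matrix is its own conjugate, so the eigenvalue
    is real.\<close>
  have e: "e = of_real er"
    using arg_cong[OF hB'[of 0 0], of Im] B0[of 0] by (simp add: er_def complex_eq_iff)
  have B0': "B $$ (0,j) = (if j = 0 then e else 0)" if "j < Suc n" for j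
    using hB'[of j 0] B0[of j] that e by auto
  define U' where "U' = mat_adjoint U"
  have U'c: "U' \<in> carrier_mat n n" using U by (simp add: U'_def)
  define V where "V = four_block_mat (1\<^sub>m 1) (0\<^sub>m 1 n) (0\<^sub>m n 1) U"
  define V' where "V' = four_block_mat (1\<^sub>m 1) (0\<^sub>m 1 n) (0\<^sub>m n 1) U'"
  have V'eq: "V' = mat_adjoint V"
  proof -
    have "mat_adjoint (0\<^sub>m k l) = (0\<^sub>m l k :: complex mat)" for k l by (rule eq_matI) auto
    thus ?thesis unfolding V_def V'_def U'_def
      using U by (subst mat_adjoint_four_block[of _ 1 1 _ n _ n]) auto
  qed
  have V: "V \<in> carrier_mat (Suc n) (Suc n)" "V' \<in> carrier_mat (Suc n) (Suc n)"
    using U U'c by (auto simp: V_def V'_def)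
  have one: "four_block_mat (1\<^sub>m 1) (0\<^sub>m 1 n) (0\<^sub>m n 1) (1\<^sub>m n) = (1\<^sub>m (Suc n) :: complex mat)"
    by (rule eq_matI) auto
  have VV: "V * V' = 1\<^sub>m (Suc n)" "V' * V = 1\<^sub>m (Suc n)"
    unfolding V_def V'_def
    using U U'c by (simp_all add: mult_four_block_mat[where ?nr1.0=1 and ?n1.0=1 and ?n2.0=n and ?nr2.0=n and ?nc1.0=1 and ?nc2.0=n] one U'_def)
  define D where "D = mat_diag n (\<lambda>i. complex_of_real (d i))"
  define d' where "d' = case_nat er d"
  have D': "mat_diag (Suc n) (\<lambda>i. complex_of_real (d' i)) =
      four_block_mat (mat 1 1 (\<lambda>_. e)) (0\<^sub>m 1 n) (0\<^sub>m n 1) D" (is "?D' = _")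
    by (rule eq_matI) (auto simp: D_def d'_def e mat_diag_def split: nat.splits)
  have Bblock: "B = four_block_mat (mat 1 1 (\<lambda>_. e)) (0\<^sub>m 1 n) (0\<^sub>m n 1) B3"
  proof (rule eq_matI)
    fix i j
    assume "i < dim_row (four_block_mat (mat 1 1 (\<lambda>_. e)) (0\<^sub>m 1 n) (0\<^sub>m n 1) B3)"
      "j < dim_col (four_block_mat (mat 1 1 (\<lambda>_. e)) (0\<^sub>m 1 n) (0\<^sub>m n 1) B3)"
    hence ij: "i < Suc n" "j < Suc n" by (auto simp: B3_def)
    show "B $$ (i,j) = four_block_mat (mat 1 1 (\<lambda>_. e)) (0\<^sub>m 1 n) (0\<^sub>m n 1) B3 $$ (i,j)"
      using ij B0[of i] B0'[of j] B
      by (cases i; cases j) (auto simp: B3_def)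
  qed (use B in \<open>auto simp: B3_def\<close>)
  have D: "D \<in> carrier_mat n n" by (simp add: D_def)
  have mc: "mat 1 1 (\<lambda>_. e) \<in> carrier_mat 1 1" by simp
  have "V * ?D' = four_block_mat (1\<^sub>m 1 * mat 1 1 (\<lambda>_. e)) (0\<^sub>m 1 n) (0\<^sub>m n 1) (U * D)"
    unfolding V_def D' by (rule mult_block_diag_mat) (use U D in auto)
  also have "\<dots> * V' = four_block_mat (1\<^sub>m 1 * mat 1 1 (\<lambda>_. e) * 1\<^sub>m 1) (0\<^sub>m 1 n) (0\<^sub>m n 1) (U * D * U')"
    unfolding V'_def by (rule mult_block_diag_mat) (use U U'c D in auto)
  also have "1\<^sub>m 1 * mat 1 1 (\<lambda>_. e) * 1\<^sub>m 1 = mat 1 1 (\<lambda>_. e)"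
    using mc by simp
  also have "U * D * U' = B3" by (simp only: B3U D_def U'_def)
  also note Bblock[symmetric]
  finally have "V * ?D' * V' = B" .
  moreover have "A = W * B * W'"
  proof -
    have "W * B * W' = (W * W') * A * (W * W')"
      unfolding B_def using W W' A by (simp add: assoc_mult_mat[of _ "Suc n" "Suc n" _ "Suc n" _ "Suc n"])
    thus ?thesis using W A by (simp add: W'_def)
  qed
  ultimately have "A = W * (V * ?D' * V') * W'" by simp
  also have "\<dots> = (W * V) * ?D' * (V' * W')"
    using W(1) W' V
    by (simp add: assoc_mult_square_mat[where n="Suc n"] mult_square_mat_carrier[where n="Suc n"])
  finally have AWV: "A = (W * V) * ?D' * (V' * W')" .
  have adj: "V' * W' = mat_adjoint (W * V)"
    using W V mat_adjoint_mult[OF W(1) V(1)] by (simp add: V'eq W'_def)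
  have "(W * V) * (V' * W') = W * (V * V') * W'"
    using W(1) W' V
    by (simp add: assoc_mult_square_mat[where n="Suc n"] mult_square_mat_carrier[where n="Suc n"])
  also have "\<dots> = 1\<^sub>m (Suc n)" using W V VV by (simp add: W'_def)
  finally have 1: "(W * V) * (V' * W') = 1\<^sub>m (Suc n)" .
  have "(V' * W') * (W * V) = V' * (W' * W) * V"
    using W(1) W' V
    by (simp add: assoc_mult_square_mat[where n="Suc n"] mult_square_mat_carrier[where n="Suc n"])
  also have "\<dots> = 1\<^sub>m (Suc n)" using W V VV by (simp add: W'_def)
  finally have 2: "(V' * W') * (W * V) = 1\<^sub>m (Suc n)" .
  have 3: "W * V \<in> carrier_mat (Suc n) (Suc n)"
    using W V by (simp add: mult_square_mat_carrier)
  show ?case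
    using 3 1 2 AWV unfolding adj by (intro exI[of _ "W * V"] exI[of _ d'] conjI)
qed

text \<open>
  Side conditions on dimensions rather than carriers, so that the simplifier can discharge
  them for compound matrices.
\<close>

lemma mult_mat_assoc_dim:
  fixes A B C :: "'a :: semiring_0 mat"
  assumes "dim_col A = dim_row B" "dim_col B = dim_row C"
  shows "A * B * C = A * (B * C)"
  by (rule assoc_mult_mat[of A "dim_row A" "dim_row B" B "dim_row C" C "dim_col C"])
    (use assms in auto)

lemma mult_mat_vec_assoc_dim:
  fixes A B :: "'a :: semiring_0 mat"
  assumes "dim_col A = dim_row B" "dim_col B = dim_vec x"
  shows "A * B *\<^sub>v x = A *\<^sub>v (B *\<^sub>v x)"
  by (rule assoc_mult_mat_vec[of A "dim_row A" "dim_row B" B "dim_vec x" x])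
    (use assms in auto)

lemma mult_add_mat_dim:
  fixes A B C :: "'a :: semiring_0 mat"
  assumes "dim_col A = dim_row B" "dim_row C = dim_row B" "dim_col C = dim_col B"
  shows "A * (B + C) = A * B + A * C"
  by (rule mult_add_distrib_mat[of A "dim_row A" "dim_row B" B "dim_col B" C])
    (use assms in auto)

lemma add_mult_mat_dim:
  fixes A B C :: "'a :: semiring_0 mat"
  assumes "dim_row A = dim_row B" "dim_col A = dim_col B" "dim_col B = dim_row C"
  shows "(A + B) * C = A * C + B * C"
  by (rule add_mult_distrib_mat[of A "dim_row A" "dim_row C" B C "dim_col C"])
    (use assms in auto)

lemma mult_minus_mat_dim:
  fixes A B C :: "'a :: ring mat"
  assumes "dim_col A = dim_row B" "dim_row C = dim_row B" "dim_col C = dim_col B"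
  shows "A * (B - C) = A * B - A * C"
  by (rule mult_minus_distrib_mat[of A "dim_row A" "dim_row B" B "dim_col B" C])
    (use assms in auto)

lemma minus_mult_mat_dim:
  fixes A B C :: "'a :: ring mat"
  assumes "dim_row A = dim_row B" "dim_col A = dim_col B" "dim_col B = dim_row C"
  shows "(A - B) * C = A * C - B * C"
  by (rule minus_mult_distrib_mat[of A "dim_row A" "dim_row C" B C "dim_col C"])
    (use assms in auto)

lemma mult_smult_mat_dim:
  fixes A B :: "'a :: comm_semiring_0 mat"
  assumes "dim_col A = dim_row B"
  shows "A * (c \<cdot>\<^sub>m B) = c \<cdot>\<^sub>m (A * B)"
  by (rule mult_smult_distrib[of A "dim_row A" "dim_row B" B "dim_col B"])
    (use assms in auto)

lemma smult_mult_mat_dim: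
  fixes A B :: "'a :: comm_semiring_0 mat"
  assumes "dim_col A = dim_row B"
  shows "(c \<cdot>\<^sub>m A) * B = c \<cdot>\<^sub>m (A * B)"
  by (rule mult_smult_assoc_mat[of A "dim_row A" "dim_row B" B "dim_col B"])
    (use assms in auto)

lemmas mat_algebra_dim = mult_mat_assoc_dim mult_mat_vec_assoc_dim mult_add_mat_dim
  add_mult_mat_dim mult_minus_mat_dim minus_mult_mat_dim mult_smult_mat_dim smult_mult_mat_dim

lemma mat_adjoint_mult_dim:
  fixes A B :: "complex mat"
  assumes "dim_col A = dim_row B"
  shows "mat_adjoint (A * B) = mat_adjoint B * mat_adjoint A"
  by (rule mat_adjoint_mult[of A "dim_row A" "dim_row B" B "dim_col B"]) (use assms in auto)

text \<open>\<open>mat_algebra_dim\<close> nests all products to the right. This is the shape in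
  which a matrix then meets its inverse, where the plain equation \<open>A * B = 1\<close> no longer
  matches.\<close>

lemma mult_left_inverse_cancel:
  fixes A B C :: "'a :: semiring_1 mat"
  assumes "A * B = 1\<^sub>m n" "dim_col A = dim_row B" "dim_row C = n" "dim_col B = n"
  shows "A * (B * C) = C"
proof -
  have "A * (B * C) = A * B * C"
    by (rule mult_mat_assoc_dim[symmetric]) (use assms in auto)
  also have "\<dots> = C"
    unfolding assms(1) by (rule left_mult_one_mat[OF carrier_matI[OF assms(3) refl]])
  finally show ?thesis .
qed

lemma mult_left_inverse_cancel_vec:
  fixes A B :: "'a :: semiring_1 mat"
  assumes "A * B = 1\<^sub>m n" "dim_col A = dim_row B" "dim_vec x = n" "dim_col B = n"
  shows "A *\<^sub>v (B *\<^sub>v x) = x"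
proof -
  have "A *\<^sub>v (B *\<^sub>v x) = A * B *\<^sub>v x"
    by (rule mult_mat_vec_assoc_dim[symmetric]) (use assms in auto)
  also have "\<dots> = x"
    unfolding assms(1) by (rule one_mult_mat_vec[OF carrier_vecI[OF assms(3)]])
  finally show ?thesis .
qed

section \<open>Functional calculus of Hermitian matrices\<close>

lemma mult_mat_zero_vec:
  "A \<in> carrier_mat n m \<Longrightarrow> A *\<^sub>v 0\<^sub>v m = (0\<^sub>v n :: 'a :: semiring_0 vec)"
  by (intro eq_vecI) auto

lemma mat_diag_cong: "(\<And>i. i < n \<Longrightarrow> d i = e i) \<Longrightarrow> mat_diag n d = mat_diag n e"
  by (intro eq_matI) (auto simp: mat_diag_def)

lemma quadratic_form_diagonalized:
  assumes U: "U \<in> carrier_mat n n" and v: "v \<in> carrier_vec n"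
  shows "((U * mat_diag n d * mat_adjoint U) *\<^sub>v v) \<bullet>c v =
    (\<Sum>i<n. d i * of_real ((cmod ((mat_adjoint U *\<^sub>v v) $ i))\<^sup>2))"
proof -
  define y where "y = mat_adjoint U *\<^sub>v v"
  have y: "y \<in> carrier_vec n" using U v by (simp add: y_def mult_mat_vec_carrier)
  have Dy: "mat_diag n d *\<^sub>v y \<in> carrier_vec n"
    by (rule mult_mat_vec_carrier[OF mat_diag_dim y])
  have "((U * mat_diag n d * mat_adjoint U) *\<^sub>v v) \<bullet>c v = (U *\<^sub>v (mat_diag n d *\<^sub>v y)) \<bullet>c v"
    unfolding y_def using U v by (simp add: mat_algebra_dim)
  also have "\<dots> = (mat_diag n d *\<^sub>v y) \<bullet>c y"
    unfolding y_def using cscalar_prod_adjoint[OF U Dy v] by (simp add: y_def)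
  also have "\<dots> = (\<Sum>i<n. (mat_diag n d *\<^sub>v y) $ i * cnj (y $ i))"
    by (rule cscalar_prod_sum[OF y])
  also have "\<dots> = (\<Sum>i<n. d i * of_real ((cmod (y $ i))\<^sup>2))"
    using y by (intro sum.cong) (simp_all only: mat_diag_mult_vec_index lessThan_iff complex_norm_square mult.assoc)
  finally show ?thesis by (simp only: y_def)
qed

text \<open>For \<open>M = U^* J V\<close> the assumption reads \<open>(a i - b j) M_ij = 0\<close>.
  Wherever \<open>M_ij\<close> is nonzero, \<open>a i = b j\<close> and so
  \<open>f (a i) = f (b j)\<close>, whatever \<open>f\<close> is. The case \<open>J = 1\<close> says
  that the functional calculus does not depend on the diagonalization.\<close>

lemma diagonalization_intertwine:
  fixes f :: "real \<Rightarrow> real"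
  assumes U: "U \<in> carrier_mat n n" "U * mat_adjoint U = 1\<^sub>m n" "mat_adjoint U * U = 1\<^sub>m n"
    and V: "V \<in> carrier_mat m m" "V * mat_adjoint V = 1\<^sub>m m" "mat_adjoint V * V = 1\<^sub>m m"
    and J: "J \<in> carrier_mat n m"
    and eq: "(U * mat_diag n (\<lambda>i. complex_of_real (a i)) * mat_adjoint U) * J =
      J * (V * mat_diag m (\<lambda>i. complex_of_real (b i)) * mat_adjoint V)"
  shows "(U * mat_diag n (\<lambda>i. complex_of_real (f (a i))) * mat_adjoint U) * J =
      J * (V * mat_diag m (\<lambda>i. complex_of_real (f (b i))) * mat_adjoint V)"
proof -
  define M where "M = mat_adjoint U * (J * V)"
  have M: "M \<in> carrier_mat n m" using U V J unfolding M_def by (intro carrier_matI) auto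
  define Da Db Fa Fb where "Da = mat_diag n (\<lambda>i. complex_of_real (a i))"
    and "Db = mat_diag m (\<lambda>i. complex_of_real (b i))"
    and "Fa = mat_diag n (\<lambda>i. complex_of_real (f (a i)))"
    and "Fb = mat_diag m (\<lambda>i. complex_of_real (f (b i)))"
  have D: "Da \<in> carrier_mat n n" "Db \<in> carrier_mat m m" "Fa \<in> carrier_mat n n" "Fb \<in> carrier_mat m m"
    by (simp_all add: Da_def Db_def Fa_def Fb_def)
  note dims = carrier_matD[OF U(1)] carrier_matD[OF V(1)] carrier_matD[OF J] carrier_matD[OF M]
    carrier_matD[OF D(1)] carrier_matD[OF D(2)] carrier_matD[OF D(3)] carrier_matD[OF D(4)]
  have UM: "U * M = J * V" and MV: "M * mat_adjoint V = mat_adjoint U * J"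
    unfolding M_def using U V J dims
    by (simp_all add: mat_algebra_dim mult_left_inverse_cancel[OF U(2)] V(2)
        right_mult_one_mat[OF J])
  have "Da * M = mat_adjoint U * ((U * Da * mat_adjoint U) * J) * V"
    unfolding M_def using dims by (simp add: mat_algebra_dim mult_left_inverse_cancel[OF U(3)])
  also have "\<dots> = mat_adjoint U * (J * (V * Db * mat_adjoint V)) * V"
    using eq by (simp only: Da_def Db_def)
  also have "\<dots> = M * Db"
    unfolding M_def using dims V(3) D by (simp add: mat_algebra_dim)
  finally have DM: "Da * M = M * Db" .
  have entry: "complex_of_real (f (a i)) * M $$ (i,j) = M $$ (i,j) * of_real (f (b j))"
    if ij: "i < n" "j < m" for i j
  proof -
    have "(Da * M) $$ (i,j) = (M * Db) $$ (i,j)" using DM by simp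
    hence "of_real (a i) * M $$ (i,j) = M $$ (i,j) * of_real (b j)"
      using ij M by (simp add: Da_def Db_def mat_diag_mult_left[OF M] mat_diag_mult_right[OF M])
    hence "M $$ (i,j) = 0 \<or> a i = b j" by auto
    thus ?thesis by auto
  qed
  have FM: "Fa * M = M * Fb"
    unfolding Fa_def Fb_def mat_diag_mult_left[OF M] mat_diag_mult_right[OF M]
    by (rule eq_matI) (use entry in auto)
  have "(U * Fa * mat_adjoint U) * J = U * (Fa * (M * mat_adjoint V))"
    unfolding MV using dims by (simp add: mat_algebra_dim)
  also have "\<dots> = U * ((Fa * M) * mat_adjoint V)"
    using dims by (simp add: mat_algebra_dim)
  also have "\<dots> = (U * M) * Fb * mat_adjoint V"
    unfolding FM using dims by (simp add: mat_algebra_dim)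
  also have "\<dots> = J * (V * Fb * mat_adjoint V)"
    unfolding UM using dims by (simp add: mat_algebra_dim)
  finally show ?thesis by (simp only: Fa_def Fb_def)
qed

text \<open>The diagonalization behind the \<open>SOME\<close> value may vary with \<open>f\<close>.
  It is compared with a fixed one by intertwining with the identity, so that a single
  \<open>U\<close> and \<open>d\<close> serve all functions at once.\<close>

lemma spectral_fun_decomp:
  assumes X: "X \<in> carrier_mat n n" "hermitian_mat X"
  obtains U d where "U \<in> carrier_mat n n" "U * mat_adjoint U = 1\<^sub>m n" "mat_adjoint U * U = 1\<^sub>m n"
    "X = U * mat_diag n (\<lambda>i. complex_of_real (d i)) * mat_adjoint U"
    "\<And>f. spectral_fun f X = U * mat_diag n (\<lambda>i. complex_of_real (f (d i))) * mat_adjoint U"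
proof -
  obtain U d where U: "U \<in> carrier_mat n n" "U * mat_adjoint U = 1\<^sub>m n" "mat_adjoint U * U = 1\<^sub>m n"
    "X = U * mat_diag n (\<lambda>i. complex_of_real (d i)) * mat_adjoint U"
    using hermitian_diagonalization[OF X] by blast
  have "spectral_fun f X = U * mat_diag n (\<lambda>i. complex_of_real (f (d i))) * mat_adjoint U" for f
  proof -
    define P where "P Y \<longleftrightarrow> (\<exists>U d. U \<in> carrier_mat n n \<and> U * mat_adjoint U = 1\<^sub>m n \<and> mat_adjoint U * U = 1\<^sub>m n \<and>
       X = U * mat_diag n (\<lambda>i. complex_of_real (d i)) * mat_adjoint U \<and>
       Y = U * mat_diag n (\<lambda>i. complex_of_real (f (d i))) * mat_adjoint U)" for Y
    have sf: "spectral_fun f X = (SOME Y. P Y)"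
      using X by (simp add: spectral_fun_def P_def)
    have "P (spectral_fun f X)"
      unfolding sf by (rule someI[of P]) (use U in \<open>auto simp: P_def\<close>)
    then obtain V e where V: "V \<in> carrier_mat n n" "V * mat_adjoint V = 1\<^sub>m n" "mat_adjoint V * V = 1\<^sub>m n"
      "X = V * mat_diag n (\<lambda>i. complex_of_real (e i)) * mat_adjoint V"
      "spectral_fun f X = V * mat_diag n (\<lambda>i. complex_of_real (f (e i))) * mat_adjoint V"
      unfolding P_def by blast
    have c: "W * mat_diag n h * mat_adjoint W \<in> carrier_mat n n" if "W \<in> carrier_mat n n" for W h
      using that mat_diag_dim[of n h] by auto
    have "(V * mat_diag n (\<lambda>i. complex_of_real (f (e i))) * mat_adjoint V) * 1\<^sub>m n =
       1\<^sub>m n * (U * mat_diag n (\<lambda>i. complex_of_real (f (d i))) * mat_adjoint U)"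
    proof (rule diagonalization_intertwine[where f = f, OF V(1-3) U(1-3)])
      show "V * mat_diag n (\<lambda>i. complex_of_real (e i)) * mat_adjoint V * 1\<^sub>m n =
          1\<^sub>m n * (U * mat_diag n (\<lambda>i. complex_of_real (d i)) * mat_adjoint U)"
        unfolding V(4)[symmetric] U(4)[symmetric] using X(1) by simp
    qed simp
    thus ?thesis
      using V(5) by (simp add: left_mult_one_mat[OF c[OF U(1)]] right_mult_one_mat[OF c[OF V(1)]])
  qed
  with U that show thesis by blast
qed

lemma spectral_fun_carrier:
  assumes X: "X \<in> carrier_mat n n" "hermitian_mat X"
  shows "spectral_fun f X \<in> carrier_mat n n"
proof -
  obtain U d where U: "U \<in> carrier_mat n n"
    "\<And>f. spectral_fun f X = U * mat_diag n (\<lambda>i. complex_of_real (f (d i))) * mat_adjoint U"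
    using spectral_fun_decomp[OF X] by metis
  show ?thesis unfolding U(2) using U(1) by (intro carrier_matI) auto
qed

text \<open>\<open>J\<close> may be rectangular. The cases of interest are the embedding of an
  invariant subspace, where the calculus restricts to that subspace, and a conjugation by a
  unitary.\<close>

lemma spectral_fun_intertwine:
  assumes X: "X \<in> carrier_mat n n" "hermitian_mat X" and Z: "Z \<in> carrier_mat m m" "hermitian_mat Z"
    and J: "J \<in> carrier_mat n m" and eq: "X * J = J * Z"
  shows "spectral_fun f X * J = J * spectral_fun f Z"
proof -
  obtain U d where U: "U \<in> carrier_mat n n" "U * mat_adjoint U = 1\<^sub>m n" "mat_adjoint U * U = 1\<^sub>m n"
    "X = U * mat_diag n (\<lambda>i. complex_of_real (d i)) * mat_adjoint U"
    "\<And>f. spectral_fun f X = U * mat_diag n (\<lambda>i. complex_of_real (f (d i))) * mat_adjoint U"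
    using spectral_fun_decomp[OF X] by blast
  obtain V e where V: "V \<in> carrier_mat m m" "V * mat_adjoint V = 1\<^sub>m m" "mat_adjoint V * V = 1\<^sub>m m"
    "Z = V * mat_diag m (\<lambda>i. complex_of_real (e i)) * mat_adjoint V"
    "\<And>f. spectral_fun f Z = V * mat_diag m (\<lambda>i. complex_of_real (f (e i))) * mat_adjoint V"
    using spectral_fun_decomp[OF Z] by blast
  show ?thesis unfolding U(5) V(5)
    by (rule diagonalization_intertwine[OF U(1-3) V(1-3) J]) (use eq U(4) V(4) in simp)
qed

lemma spectral_fun_diag:
  "spectral_fun f (mat_diag n (\<lambda>i. complex_of_real (d i))) = mat_diag n (\<lambda>i. complex_of_real (f (d i)))"
proof -
  define X where "X = mat_diag n (\<lambda>i. complex_of_real (d i))"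
  define F where "F = mat_diag n (\<lambda>i. complex_of_real (f (d i)))"
  have X: "X \<in> carrier_mat n n" and F: "F \<in> carrier_mat n n" by (simp_all add: X_def F_def)
  have h: "hermitian_mat X" by (simp add: X_def hermitian_mat_def mat_adjoint_mat_diag)
  obtain V e where V: "V \<in> carrier_mat n n" "V * mat_adjoint V = 1\<^sub>m n" "mat_adjoint V * V = 1\<^sub>m n"
    "X = V * mat_diag n (\<lambda>i. complex_of_real (e i)) * mat_adjoint V"
    "\<And>f. spectral_fun f X = V * mat_diag n (\<lambda>i. complex_of_real (f (e i))) * mat_adjoint V"
    using spectral_fun_decomp[OF X h] by blast
  have 1: "(1\<^sub>m n * G * mat_adjoint (1\<^sub>m n)) * 1\<^sub>m n = (G :: complex mat)" if "G \<in> carrier_mat n n" for G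
    using that by simp
  have "(1\<^sub>m n * mat_diag n (\<lambda>i. complex_of_real (f (d i))) * mat_adjoint (1\<^sub>m n)) * 1\<^sub>m n =
     1\<^sub>m n * (V * mat_diag n (\<lambda>i. complex_of_real (f (e i))) * mat_adjoint V)"
  proof (rule diagonalization_intertwine[where f = f and a = d, OF _ _ _ V(1-3)])
    show "1\<^sub>m n * mat_diag n (\<lambda>i. complex_of_real (d i)) * mat_adjoint (1\<^sub>m n) * 1\<^sub>m n =
        1\<^sub>m n * (V * mat_diag n (\<lambda>i. complex_of_real (e i)) * mat_adjoint V)"
      unfolding V(4)[symmetric] using X by (simp add: X_def 1)
  qed simp_all
  also have "\<dots> = 1\<^sub>m n * spectral_fun f X" by (simp only: V(5))
  also have "\<dots> = spectral_fun f X" by (rule left_mult_one_mat[OF spectral_fun_carrier[OF X h]])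
  finally show ?thesis using F by (simp add: 1 F_def X_def)
qed

lemma pos_def_matD:
  assumes "pos_def_mat n X"
  shows "X \<in> carrier_mat n n" "hermitian_mat X"
    "\<And>x. x \<in> carrier_vec n \<Longrightarrow> x \<noteq> 0\<^sub>v n \<Longrightarrow> Re ((X *\<^sub>v x) \<bullet>c x) > 0"
  using assms by (auto simp: pos_def_mat_def)

text \<open>The witness is column \<open>i\<close> of \<open>U\<close>. It is the same for every
  \<open>d\<close>, so a diagonal entry can be read off as the value of a form.\<close>

lemma diagonalization_unit_eigenvector:
  assumes U: "U \<in> carrier_mat n n" "mat_adjoint U * U = 1\<^sub>m n" and i: "i < n"
  obtains u where "u \<in> carrier_vec n" "Re (u \<bullet>c u) = 1"
    "\<And>d. ((U * mat_diag n d * mat_adjoint U) *\<^sub>v u) \<bullet>c u = d i"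
proof -
  define u where "u = U *\<^sub>v unit_vec n i"
  have u: "u \<in> carrier_vec n" using U by (simp add: u_def mult_mat_vec_carrier)
  have Uu: "mat_adjoint U *\<^sub>v u = unit_vec n i"
    unfolding u_def using U by (simp add: mult_left_inverse_cancel_vec)
  have "u \<bullet>c u = unit_vec n i \<bullet>c (mat_adjoint U *\<^sub>v u)"
    using cscalar_prod_adjoint[OF U(1) unit_vec_carrier u, of i] by (simp add: u_def)
  hence 1: "Re (u \<bullet>c u) = 1" using i by (simp add: Uu cscalar_prod_unit_vec)
  have "((U * mat_diag n d * mat_adjoint U) *\<^sub>v u) \<bullet>c u = d i" for d
  proof -
    have "((U * mat_diag n d * mat_adjoint U) *\<^sub>v u) \<bullet>c u = (\<Sum>j<n. d j * of_real ((cmod (unit_vec n i $ j))\<^sup>2))"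
      by (subst quadratic_form_diagonalized[OF U(1) u]) (simp only: Uu)
    also have "\<dots> = (\<Sum>j<n. if j = i then d j else 0)"
      using i by (intro sum.cong) (auto simp: unit_vec_def)
    finally show ?thesis using i by simp
  qed
  with u 1 that show thesis by blast
qed

lemma pos_def_mat_eigenvalues:
  assumes X: "pos_def_mat n X" and U: "U \<in> carrier_mat n n" "mat_adjoint U * U = 1\<^sub>m n"
    and XU: "X = U * mat_diag n (\<lambda>i. complex_of_real (d i)) * mat_adjoint U" and i: "i < n"
  shows "d i > 0"
proof -
  show ?thesis
  proof (rule diagonalization_unit_eigenvector[OF U i])
    fix u :: "complex vec"
    assume u: "u \<in> carrier_vec n" "Re (u \<bullet>c u) = 1"
      and form: "\<And>d. ((U * mat_diag n d * mat_adjoint U) *\<^sub>v u) \<bullet>c u = d i"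
    have "u \<noteq> 0\<^sub>v n" using u by auto
    from pos_def_matD(3)[OF X u(1) this] show ?thesis by (simp add: XU form)
  qed
qed

lemma spectral_fun_pos_def:
  assumes X: "pos_def_mat n X"
  obtains U d where "U \<in> carrier_mat n n" "U * mat_adjoint U = 1\<^sub>m n" "mat_adjoint U * U = 1\<^sub>m n"
    "X = U * mat_diag n (\<lambda>i. complex_of_real (d i)) * mat_adjoint U"
    "\<And>f. spectral_fun f X = U * mat_diag n (\<lambda>i. complex_of_real (f (d i))) * mat_adjoint U"
    "\<And>i. i < n \<Longrightarrow> d i > 0"
proof -
  obtain U d where U: "U \<in> carrier_mat n n" "U * mat_adjoint U = 1\<^sub>m n" "mat_adjoint U * U = 1\<^sub>m n"
    "X = U * mat_diag n (\<lambda>i. complex_of_real (d i)) * mat_adjoint U"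
    "\<And>f. spectral_fun f X = U * mat_diag n (\<lambda>i. complex_of_real (f (d i))) * mat_adjoint U"
    using spectral_fun_decomp[OF pos_def_matD(1,2)[OF X]] by blast
  from that[OF this] pos_def_mat_eigenvalues[OF X U(1,3,4)] show thesis by blast
qed

text \<open>The points \<open>d\<close> and weights \<open>w\<close> are the spectral measure of
  \<open>X\<close> at \<open>v\<close>: eigenvalues, and squared moduli of the coordinates of
  \<open>v\<close> in the eigenbasis. They are chosen before \<open>f\<close>, which reduces
  statements about forms to scalar ones.\<close>

lemma spectral_fun_quadratic_form:
  assumes X: "pos_def_mat n X" and v: "v \<in> carrier_vec n"
  obtains d w where "\<And>i. i < n \<Longrightarrow> d i > (0 :: real)" "\<And>i. i < n \<Longrightarrow> w i \<ge> (0 :: real)"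
    "\<And>f. Re ((spectral_fun f X *\<^sub>v v) \<bullet>c v) = (\<Sum>i<n. f (d i) * w i)"
proof -
  obtain U d where U: "U \<in> carrier_mat n n"
    "\<And>f. spectral_fun f X = U * mat_diag n (\<lambda>i. complex_of_real (f (d i))) * mat_adjoint U"
    "\<And>i. i < n \<Longrightarrow> d i > 0"
    using spectral_fun_pos_def[OF X] by metis
  show thesis
    by (rule that[of d "\<lambda>i. (cmod ((mat_adjoint U *\<^sub>v v) $ i))\<^sup>2"])
      (simp_all add: U(2,3) quadratic_form_diagonalized[OF U(1) v])
qed

section \<open>Compressions\<close>

lemma loewner_leD:
  assumes "loewner_le n A B" "x \<in> carrier_vec n"
  shows "Re ((A *\<^sub>v x) \<bullet>c x) \<le> Re ((B *\<^sub>v x) \<bullet>c x)"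
proof -
  have AB: "A \<in> carrier_mat n n" "B \<in> carrier_mat n n" and "Re (((B - A) *\<^sub>v x) \<bullet>c x) \<ge> 0"
    using assms by (auto simp: loewner_le_def pos_semidef_mat_def)
  moreover have "(B - A) *\<^sub>v x = B *\<^sub>v x - A *\<^sub>v x"
    by (rule minus_mult_distrib_mat_vec[OF AB(2,1) assms(2)])
  ultimately show ?thesis
    using cscalar_prod_left_minus[of "B *\<^sub>v x" n "A *\<^sub>v x" x] assms(2) by simp
qed

text \<open>
  With \<open>U = 2 J J\<^sup>* - 1\<close>, the mean of \<open>T\<close> and \<open>U T U\<close> is the block-diagonal part of \<open>T\<close>
  with respect to the range of \<open>J\<close>.
\<close>

lemma matrix_concave_isometry:
  assumes conc: "matrix_concave f"
    and T: "pos_def_mat n T" and J: "J \<in> carrier_mat n m" "mat_adjoint J * J = 1\<^sub>m m"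
    and X: "X = mat_adjoint J * T * J" and v: "v \<in> carrier_vec m"
  shows "Re ((spectral_fun f T *\<^sub>v (J *\<^sub>v v)) \<bullet>c (J *\<^sub>v v)) \<le> Re ((spectral_fun f X *\<^sub>v v) \<bullet>c v)"
proof -
  note Tc = pos_def_matD(1)[OF T] and Th = pos_def_matD(2)[OF T]
  define U where "U = 2 \<cdot>\<^sub>m (J * mat_adjoint J) - 1\<^sub>m n"
  have Uc: "U \<in> carrier_mat n n" unfolding U_def using J by (intro carrier_matI) auto
  note dims = carrier_matD[OF Uc] carrier_matD[OF Tc] carrier_matD[OF J(1)]
  have Ua: "mat_adjoint U = U"
  proof -
    have "mat_adjoint U = mat_adjoint (2 \<cdot>\<^sub>m (J * mat_adjoint J)) - mat_adjoint (1\<^sub>m n)"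
      unfolding U_def by (rule mat_adjoint_minus[of _ n n]) (use J in auto)
    thus ?thesis using dims by (simp add: U_def mat_adjoint_smult mat_adjoint_mult_dim)
  qed
  have UJ: "U * J = J"
  proof -
    have "U * J = 2 \<cdot>\<^sub>m (J * (mat_adjoint J * J)) - 1\<^sub>m n * J"
      unfolding U_def using dims by (simp add: mat_algebra_dim)
    also have "\<dots> = 2 \<cdot>\<^sub>m J - J" using J by (simp add: right_mult_one_mat[OF J(1)] left_mult_one_mat[OF J(1)])
    also have "\<dots> = J" using J by (intro eq_matI) auto
    finally show ?thesis .
  qed
  have UU: "U * U = 1\<^sub>m n"
  proof -
    have "U * U = 2 \<cdot>\<^sub>m (U * J * mat_adjoint J) - U * 1\<^sub>m n"
      by (subst (2) U_def) (use dims in \<open>simp add: mat_algebra_dim\<close>)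
    also have "\<dots> = 2 \<cdot>\<^sub>m (J * mat_adjoint J) - U" using Uc by (simp add: UJ right_mult_one_mat[OF Uc])
    also have "\<dots> = 1\<^sub>m n" unfolding U_def using J by (intro eq_matI) auto
    finally show ?thesis .
  qed
  define S where "S = U * T * U"
  have Sc: "S \<in> carrier_mat n n" unfolding S_def using dims by (intro carrier_matI) auto
  have Sa: "mat_adjoint S = S"
    using dims Th by (simp add: S_def mat_adjoint_mult_dim Ua hermitian_mat_def mat_algebra_dim)
  have S: "pos_def_mat n S"
    unfolding pos_def_mat_def
  proof (intro conjI ballI impI)
    show "hermitian_mat S" using Sa by (simp add: hermitian_mat_def)
    fix x :: "complex vec" assume x: "x \<in> carrier_vec n" "x \<noteq> 0\<^sub>v n"
    have Ux: "U *\<^sub>v x \<in> carrier_vec n" by (rule mult_mat_vec_carrier[OF Uc x(1)])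
    have "U *\<^sub>v (U *\<^sub>v x) = x"
      using dims x by (intro mult_left_inverse_cancel_vec[OF UU]) auto
    hence "U *\<^sub>v x \<noteq> 0\<^sub>v n" using x(2) mult_mat_zero_vec[OF Uc] by metis
    from pos_def_matD(3)[OF T Ux this]
    have "0 < Re ((T *\<^sub>v (U *\<^sub>v x)) \<bullet>c (U *\<^sub>v x))" .
    also have "(T *\<^sub>v (U *\<^sub>v x)) \<bullet>c (U *\<^sub>v x) = (U *\<^sub>v (T *\<^sub>v (U *\<^sub>v x))) \<bullet>c x"
      using cscalar_prod_adjoint[OF Uc _ x(1), of "T *\<^sub>v (U *\<^sub>v x)"] mult_mat_vec_carrier[OF Tc Ux] Ua by simp
    also have "U *\<^sub>v (T *\<^sub>v (U *\<^sub>v x)) = S *\<^sub>v x"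
      unfolding S_def using dims x by (simp add: mat_algebra_dim)
    finally show "Re ((S *\<^sub>v x) \<bullet>c x) > 0" .
  qed (rule Sc)
  define R where "R = complex_of_real (1 - 1/2) \<cdot>\<^sub>m T + complex_of_real (1/2) \<cdot>\<^sub>m S"
  have Rc: "R \<in> carrier_mat n n" unfolding R_def using Tc Sc by auto
  have Rh: "hermitian_mat R"
    using Th Sa mat_adjoint_add[of "complex_of_real (1 - 1/2) \<cdot>\<^sub>m T" n n "complex_of_real (1/2) \<cdot>\<^sub>m S"] Tc Sc
    by (simp add: hermitian_mat_def R_def mat_adjoint_smult)
  have Xc: "X \<in> carrier_mat m m" unfolding X using dims by (intro carrier_matI) auto
  have Xh: "hermitian_mat X"
    using dims Th by (simp add: X hermitian_mat_def mat_adjoint_mult_dim mat_algebra_dim)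
  \<comment> \<open>\<open>R\<close> leaves the range of \<open>J\<close> invariant and acts there
    as \<open>X\<close>; hence \<open>f(R) J = J f(X)\<close>.\<close>
  have RJ: "R * J = J * X"
  proof -
    have "S * J = U * (T * J)" unfolding S_def using dims by (simp add: mat_algebra_dim UJ)
    hence "R * J = (1/2) \<cdot>\<^sub>m (T * J) + (1/2) \<cdot>\<^sub>m (U * (T * J))"
      unfolding R_def using dims carrier_matD[OF Sc] by (simp add: mat_algebra_dim)
    also have "U * (T * J) = 2 \<cdot>\<^sub>m (J * X) - T * J"
      unfolding U_def X using dims
      by (simp add: mat_algebra_dim left_mult_one_mat[OF mult_carrier_mat[OF Tc J(1)]])
    also have "(1/2) \<cdot>\<^sub>m (T * J) + (1/2) \<cdot>\<^sub>m (2 \<cdot>\<^sub>m (J * X) - T * J) = J * X"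
      using dims carrier_matD[OF Xc] by (intro eq_matI) (auto simp: algebra_simps)
    finally show ?thesis .
  qed
  have le: "loewner_le n (complex_of_real (1 - 1/2) \<cdot>\<^sub>m spectral_fun f T + complex_of_real (1/2) \<cdot>\<^sub>m spectral_fun f S)
      (spectral_fun f R)"
    unfolding R_def using conc[unfolded matrix_concave_def, rule_format, OF T S, of "1/2"] by simp
  have fT: "spectral_fun f T \<in> carrier_mat n n" and fS: "spectral_fun f S \<in> carrier_mat n n"
    and fR: "spectral_fun f R \<in> carrier_mat n n" and fX: "spectral_fun f X \<in> carrier_mat m m"
    using spectral_fun_carrier[OF Tc Th] spectral_fun_carrier[OF Sc] Sa
      spectral_fun_carrier[OF Rc Rh] spectral_fun_carrier[OF Xc Xh] by (auto simp: hermitian_mat_def)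
  define w where "w = J *\<^sub>v v"
  have w: "w \<in> carrier_vec n" unfolding w_def by (rule mult_mat_vec_carrier[OF J(1) v])
  have Uw: "U *\<^sub>v w = w"
    unfolding w_def using dims v by (simp add: mult_mat_vec_assoc_dim[symmetric] UJ)
  have fSU: "spectral_fun f S * U = U * spectral_fun f T"
  proof (rule spectral_fun_intertwine[OF Sc _ Tc Th Uc])
    show "hermitian_mat S" using Sa by (simp add: hermitian_mat_def)
    show "S * U = U * T" unfolding S_def using dims
      by (simp add: mat_algebra_dim UU right_mult_one_mat[OF mult_carrier_mat[OF Uc Tc]] right_mult_one_mat[OF Tc])
  qed
  \<comment> \<open>\<open>f(S) = U f(T) U\<close> and \<open>U\<close> fixes \<open>w\<close>, so
    both terms of the mean have the same form at \<open>w\<close>.\<close>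
  have q1: "(spectral_fun f S *\<^sub>v w) \<bullet>c w = (spectral_fun f T *\<^sub>v w) \<bullet>c w"
  proof -
    have "spectral_fun f S *\<^sub>v w = spectral_fun f S * U *\<^sub>v w"
      using dims w carrier_matD[OF fS] by (simp add: mult_mat_vec_assoc_dim Uw)
    also have "\<dots> = U *\<^sub>v (spectral_fun f T *\<^sub>v w)"
      unfolding fSU using dims w carrier_matD[OF fT] by (simp add: mult_mat_vec_assoc_dim)
    finally have "(spectral_fun f S *\<^sub>v w) \<bullet>c w = (U *\<^sub>v (spectral_fun f T *\<^sub>v w)) \<bullet>c w" by simp
    also have "\<dots> = (spectral_fun f T *\<^sub>v w) \<bullet>c (U *\<^sub>v w)"
      using cscalar_prod_adjoint[OF Uc mult_mat_vec_carrier[OF fT w] w] Ua by simp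
    finally show ?thesis by (simp only: Uw)
  qed
  have q2: "(spectral_fun f R *\<^sub>v w) \<bullet>c w = (spectral_fun f X *\<^sub>v v) \<bullet>c v"
  proof -
    have "spectral_fun f R *\<^sub>v w = spectral_fun f R * J *\<^sub>v v"
      unfolding w_def using dims v carrier_matD[OF fR] by (simp add: mult_mat_vec_assoc_dim)
    also have "spectral_fun f R * J = J * spectral_fun f X"
      by (rule spectral_fun_intertwine[OF Rc Rh Xc Xh J(1) RJ])
    also have "J * spectral_fun f X *\<^sub>v v = J *\<^sub>v (spectral_fun f X *\<^sub>v v)"
      using dims v carrier_matD[OF fX] by (simp add: mult_mat_vec_assoc_dim)
    finally have "(spectral_fun f R *\<^sub>v w) \<bullet>c w = (J *\<^sub>v (spectral_fun f X *\<^sub>v v)) \<bullet>c w" by simp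
    also have "\<dots> = (spectral_fun f X *\<^sub>v v) \<bullet>c (mat_adjoint J *\<^sub>v w)"
      by (rule cscalar_prod_adjoint[OF J(1) mult_mat_vec_carrier[OF fX v] w])
    also have "mat_adjoint J *\<^sub>v w = v"
      unfolding w_def using dims v by (intro mult_left_inverse_cancel_vec[OF J(2)]) auto
    finally show ?thesis .
  qed
  have "Re (((complex_of_real (1 - 1/2) \<cdot>\<^sub>m spectral_fun f T + complex_of_real (1/2) \<cdot>\<^sub>m spectral_fun f S) *\<^sub>v w) \<bullet>c w)
      \<le> Re ((spectral_fun f R *\<^sub>v w) \<bullet>c w)"
    by (rule loewner_leD[OF le w])
  also have "(complex_of_real (1 - 1/2) \<cdot>\<^sub>m spectral_fun f T + complex_of_real (1/2) \<cdot>\<^sub>m spectral_fun f S) *\<^sub>v w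
      = (1/2) \<cdot>\<^sub>v (spectral_fun f T *\<^sub>v w) + (1/2) \<cdot>\<^sub>v (spectral_fun f S *\<^sub>v w)"
    using fT fS w by (subst add_mult_distrib_mat_vec[of _ n n]) auto
  also have "\<dots> \<bullet>c w = (1/2) * ((spectral_fun f T *\<^sub>v w) \<bullet>c w) + (1/2) * ((spectral_fun f S *\<^sub>v w) \<bullet>c w)"
    using mult_mat_vec_carrier[OF fT w] mult_mat_vec_carrier[OF fS w] w
    by (simp add: cscalar_prod_left_add[where n=n] cscalar_prod_left_smult[where n=n])
  finally show ?thesis unfolding q1 q2 by (simp add: w_def)
qed

text \<open>\<open>Z\<close> is the square root of the diagonal factor times \<open>U^*\<close>: a
  factor of \<open>W\<close> in the sense of \<open>Z^* Z = W\<close>, with an explicit inverse, and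
  in general not Hermitian.\<close>

lemma pos_def_mat_sqrt:
  assumes "pos_def_mat n W"
  obtains Z Zi where "Z \<in> carrier_mat n n" "Zi \<in> carrier_mat n n" "mat_adjoint Z * Z = W"
    "Z * Zi = 1\<^sub>m n" "Zi * Z = 1\<^sub>m n"
proof -
  obtain U d where U: "U \<in> carrier_mat n n" "U * mat_adjoint U = 1\<^sub>m n" "mat_adjoint U * U = 1\<^sub>m n"
    "W = U * mat_diag n (\<lambda>i. complex_of_real (d i)) * mat_adjoint U" "\<And>i. i < n \<Longrightarrow> d i > 0"
    using spectral_fun_pos_def[OF assms] by metis
  define D where "D = mat_diag n (\<lambda>i. complex_of_real (sqrt (d i)))"
  define E where "E = mat_diag n (\<lambda>i. complex_of_real (1 / sqrt (d i)))"
  have DE: "D * E = 1\<^sub>m n" "E * D = 1\<^sub>m n"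
    and DD: "mat_adjoint D * D = mat_diag n (\<lambda>i. complex_of_real (d i))"
    unfolding D_def E_def mat_adjoint_mat_diag mat_diag_diag mat_diag_one[symmetric]
    by (intro conjI mat_diag_cong; use U(5) in \<open>force simp flip: of_real_mult\<close>)+
  have dims: "dim_row D = n" "dim_col D = n" "dim_row E = n" "dim_col E = n"
    by (auto simp: D_def E_def)
  show thesis
  proof (rule that[of "D * mat_adjoint U" "U * E"])
    show "D * mat_adjoint U \<in> carrier_mat n n" "U * E \<in> carrier_mat n n"
      using U(1) dims by (auto intro!: carrier_matI)
    have "mat_adjoint (D * mat_adjoint U) * (D * mat_adjoint U) = U * (mat_adjoint D * D) * mat_adjoint U"
      using dims carrier_matD[OF U(1)] by (simp add: mat_adjoint_mult_dim mat_algebra_dim)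
    thus "mat_adjoint (D * mat_adjoint U) * (D * mat_adjoint U) = W" by (simp only: DD U(4))
    show "D * mat_adjoint U * (U * E) = 1\<^sub>m n"
      using dims carrier_matD[OF U(1)] DE
      by (simp add: mat_algebra_dim mult_left_inverse_cancel[OF U(3)])
    show "U * E * (D * mat_adjoint U) = 1\<^sub>m n"
      using dims carrier_matD[OF U(1)] U(2)
      by (simp add: mat_algebra_dim mult_left_inverse_cancel[OF DE(2)])
  qed
qed

lemma mat_adjoint_mult_index:
  fixes A B :: "complex mat"
  assumes "A \<in> carrier_mat n m" "B \<in> carrier_mat n k" "i < m" "j < k"
  shows "(mat_adjoint A * B) $$ (i,j) = (\<Sum>l<n. cnj (A $$ (l,i)) * B $$ (l,j))"
  using assms by (auto simp: scalar_prod_def atLeast0LessThan intro!: sum.cong)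

text \<open>Dilation to the doubled space. With \<open>Z^* Z = 1 - V^* V\<close> the block column
  \<open>J\<close> of \<open>V\<close> and \<open>Z\<close> is an isometry, and \<open>T\<close> is
  chosen such that compressing the direct sum of \<open>Y\<close> and \<open>T\<close> by
  \<open>J\<close> gives \<open>X = V^* Y V + Z^* T Z\<close>. The two strict inequalities make
  \<open>Z\<close> invertible and \<open>T\<close> positive definite. The inequality for isometries
  then bounds the sum of the forms of \<open>f(Y)\<close> at \<open>V v\<close> and
  \<open>f(T)\<close> at \<open>Z v\<close>; the second one is nonnegative because \<open>f\<close>
  is.\<close>

lemma matrix_concave_compression:
  assumes f: "\<And>x. x > 0 \<Longrightarrow> f x \<ge> 0" and conc: "matrix_concave f"
    and Y: "pos_def_mat m Y" and X: "pos_def_mat m X" and V: "V \<in> carrier_mat m m"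
    and contr: "\<And>v. v \<in> carrier_vec m \<Longrightarrow> v \<noteq> 0\<^sub>v m \<Longrightarrow> Re ((V *\<^sub>v v) \<bullet>c (V *\<^sub>v v)) < Re (v \<bullet>c v)"
    and dom: "\<And>v. v \<in> carrier_vec m \<Longrightarrow> v \<noteq> 0\<^sub>v m \<Longrightarrow>
      Re ((Y *\<^sub>v (V *\<^sub>v v)) \<bullet>c (V *\<^sub>v v)) < Re ((X *\<^sub>v v) \<bullet>c v)"
    and v: "v \<in> carrier_vec m"
  shows "Re ((spectral_fun f Y *\<^sub>v (V *\<^sub>v v)) \<bullet>c (V *\<^sub>v v)) \<le> Re ((spectral_fun f X *\<^sub>v v) \<bullet>c v)"
proof -
  note Xc = pos_def_matD(1)[OF X] and Xh = pos_def_matD(2)[OF X]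
    and Yc = pos_def_matD(1)[OF Y] and Yh = pos_def_matD(2)[OF Y]
  note dimsXYV = carrier_matD[OF Xc] carrier_matD[OF Yc] carrier_matD[OF V]
  define W where "W = 1\<^sub>m m - mat_adjoint V * V"
  define Q where "Q = X - mat_adjoint V * Y * V"
  have VVc: "mat_adjoint V * V \<in> carrier_mat m m" and VYVc: "mat_adjoint V * Y * V \<in> carrier_mat m m"
    using dimsXYV by (auto intro!: carrier_matI)
  have Wc: "W \<in> carrier_mat m m" unfolding W_def by (rule minus_carrier_mat[OF VVc])
  have Qc: "Q \<in> carrier_mat m m" unfolding Q_def by (rule minus_carrier_mat[OF VYVc])
  have Wh: "hermitian_mat W"
    using dimsXYV mat_adjoint_minus[OF one_carrier_mat VVc]
    by (simp add: hermitian_mat_def W_def mat_adjoint_mult_dim)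
  have Qh: "hermitian_mat Q"
    using dimsXYV mat_adjoint_minus[OF Xc VYVc] Xh Yh
    by (simp add: hermitian_mat_def Q_def mat_adjoint_mult_dim mult_mat_assoc_dim)
  have W: "pos_def_mat m W"
    unfolding pos_def_mat_def
  proof (intro conjI ballI impI)
    fix x :: "complex vec" assume x: "x \<in> carrier_vec m" "x \<noteq> 0\<^sub>v m"
    have Vx: "V *\<^sub>v x \<in> carrier_vec m" by (rule mult_mat_vec_carrier[OF V x(1)])
    have "W *\<^sub>v x = x - mat_adjoint V *\<^sub>v (V *\<^sub>v x)"
      unfolding W_def using x V dimsXYV
      by (simp add: minus_mult_distrib_mat_vec[OF one_carrier_mat VVc x(1)] mult_mat_vec_assoc_dim)
    hence "(W *\<^sub>v x) \<bullet>c x = x \<bullet>c x - (mat_adjoint V *\<^sub>v (V *\<^sub>v x)) \<bullet>c x"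
      using x V Vx by (simp add: cscalar_prod_left_minus[where n=m] mult_mat_vec_carrier)
    also have "(mat_adjoint V *\<^sub>v (V *\<^sub>v x)) \<bullet>c x = (V *\<^sub>v x) \<bullet>c (V *\<^sub>v x)"
      using cscalar_prod_adjoint[of "mat_adjoint V" m m "V *\<^sub>v x" x] V Vx x by simp
    finally show "Re ((W *\<^sub>v x) \<bullet>c x) > 0" using contr[OF x] by simp
  qed (fact Wc Wh)+
  have Q: "pos_def_mat m Q"
    unfolding pos_def_mat_def
  proof (intro conjI ballI impI)
    fix x :: "complex vec" assume x: "x \<in> carrier_vec m" "x \<noteq> 0\<^sub>v m"
    have Vx: "V *\<^sub>v x \<in> carrier_vec m" by (rule mult_mat_vec_carrier[OF V x(1)])
    have YVx: "Y *\<^sub>v (V *\<^sub>v x) \<in> carrier_vec m" by (rule mult_mat_vec_carrier[OF Yc Vx])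
    have "Q *\<^sub>v x = X *\<^sub>v x - mat_adjoint V *\<^sub>v (Y *\<^sub>v (V *\<^sub>v x))"
      unfolding Q_def using x V dimsXYV
      by (simp add: minus_mult_distrib_mat_vec[OF Xc VYVc x(1)] mult_mat_vec_assoc_dim)
    hence "(Q *\<^sub>v x) \<bullet>c x = (X *\<^sub>v x) \<bullet>c x - (mat_adjoint V *\<^sub>v (Y *\<^sub>v (V *\<^sub>v x))) \<bullet>c x"
      using x V YVx Xc by (simp add: cscalar_prod_left_minus[where n=m] mult_mat_vec_carrier)
    also have "(mat_adjoint V *\<^sub>v (Y *\<^sub>v (V *\<^sub>v x))) \<bullet>c x = (Y *\<^sub>v (V *\<^sub>v x)) \<bullet>c (V *\<^sub>v x)"
      using cscalar_prod_adjoint[of "mat_adjoint V" m m "Y *\<^sub>v (V *\<^sub>v x)" x] V YVx x by simp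
    finally show "Re ((Q *\<^sub>v x) \<bullet>c x) > 0" using dom[OF x] by simp
  qed (fact Qc Qh)+
  obtain Z Zi where Z: "Z \<in> carrier_mat m m" "Zi \<in> carrier_mat m m" "mat_adjoint Z * Z = W"
    "Z * Zi = 1\<^sub>m m" "Zi * Z = 1\<^sub>m m"
    using pos_def_mat_sqrt[OF W] by blast
  note dimsZ = carrier_matD[OF Z(1)] carrier_matD[OF Z(2)] carrier_matD[OF Qc]
  \<comment> \<open>The solution of \<open>Z^* T Z = X - V^* Y V\<close>.\<close>
  define T where "T = mat_adjoint Zi * Q * Zi"
  have Tc: "T \<in> carrier_mat m m" unfolding T_def using dimsZ by (intro carrier_matI) auto
  have Th: "hermitian_mat T"
    using dimsZ Qh by (simp add: T_def hermitian_mat_def mat_adjoint_mult_dim mult_mat_assoc_dim)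
  have T: "pos_def_mat m T"
    unfolding pos_def_mat_def
  proof (intro conjI ballI impI)
    fix x :: "complex vec" assume x: "x \<in> carrier_vec m" "x \<noteq> 0\<^sub>v m"
    have Zx: "Zi *\<^sub>v x \<in> carrier_vec m" by (rule mult_mat_vec_carrier[OF Z(2) x(1)])
    have QZx: "Q *\<^sub>v (Zi *\<^sub>v x) \<in> carrier_vec m" by (rule mult_mat_vec_carrier[OF Qc Zx])
    have "Z *\<^sub>v (Zi *\<^sub>v x) = x"
      using dimsZ x by (intro mult_left_inverse_cancel_vec[OF Z(4)]) auto
    hence "Zi *\<^sub>v x \<noteq> 0\<^sub>v m" using x(2) mult_mat_zero_vec[OF Z(1)] by metis
    from pos_def_matD(3)[OF Q Zx this]
    have "0 < Re ((Q *\<^sub>v (Zi *\<^sub>v x)) \<bullet>c (Zi *\<^sub>v x))" .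
    also have "(Q *\<^sub>v (Zi *\<^sub>v x)) \<bullet>c (Zi *\<^sub>v x) = (mat_adjoint Zi *\<^sub>v (Q *\<^sub>v (Zi *\<^sub>v x))) \<bullet>c x"
      using cscalar_prod_adjoint[of "mat_adjoint Zi" m m "Q *\<^sub>v (Zi *\<^sub>v x)" x] Z QZx x by simp
    also have "mat_adjoint Zi *\<^sub>v (Q *\<^sub>v (Zi *\<^sub>v x)) = T *\<^sub>v x"
      unfolding T_def using dimsZ x by (simp add: mult_mat_vec_assoc_dim)
    finally show "Re ((T *\<^sub>v x) \<bullet>c x) > 0" .
  qed (fact Tc Th)+
  have ZZ: "mat_adjoint Z * mat_adjoint Zi = 1\<^sub>m m"
    using arg_cong[OF Z(5), of mat_adjoint] dimsZ by (simp add: mat_adjoint_mult_dim)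
  have ZTZ: "mat_adjoint Z * (T * Z) = Q"
    unfolding T_def using dimsZ Z(5)
    by (simp add: mult_mat_assoc_dim mult_left_inverse_cancel[OF ZZ] right_mult_one_mat[OF Qc])
  define E1 where "E1 = mat (m + m) m (\<lambda>(i,j). if i = j then 1 else 0 :: complex)"
  define E2 where "E2 = mat (m + m) m (\<lambda>(i,j). if i = m + j then 1 else 0 :: complex)"
  have E: "E1 \<in> carrier_mat (m + m) m" "E2 \<in> carrier_mat (m + m) m" by (simp_all add: E1_def E2_def)
  have EE: "mat_adjoint E1 * E1 = 1\<^sub>m m" "mat_adjoint E2 * E2 = 1\<^sub>m m"
    "mat_adjoint E1 * E2 = 0\<^sub>m m m" "mat_adjoint E2 * E1 = 0\<^sub>m m m"
  proof -
    have s: "(\<Sum>l<m + m. cnj (if l = a then 1 else 0) * (if l = b then 1 else 0)) = (if a = b then 1 else 0 :: complex)"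
      if "a < m + m" for a b
    proof -
      have "(\<Sum>l<m + m. cnj (if l = a then 1 else 0) * (if l = b then 1 else 0)) =
          (\<Sum>l<m + m. if l = a then (if a = b then 1 else 0) else 0 :: complex)"
        by (intro sum.cong) auto
      thus ?thesis using that by simp
    qed
    \<comment> \<open>One family of shifted embeddings covers \<open>E1\<close> at shift 0 and
      \<open>E2\<close> at shift \<open>m\<close>, and so all four products.\<close>
    define E where "E k = mat (m + m) m (\<lambda>(i,j). if i = k + j then 1 else 0 :: complex)" for k
    have Ec: "E k \<in> carrier_mat (m + m) m" for k by (simp add: E_def)
    have "(mat_adjoint (E k) * E k') $$ (i,j) = (if k + i = k' + j then 1 else 0)"
      if "i < m" "j < m" "k \<le> m" for k k' i j
    proof -
      have "(mat_adjoint (E k) * E k') $$ (i,j) =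
          (\<Sum>l<m + m. cnj (if l = k + i then 1 else 0) * (if l = k' + j then 1 else 0))"
        unfolding mat_adjoint_mult_index[OF Ec Ec that(1,2)]
        by (intro sum.cong) (use that in \<open>auto simp: E_def\<close>)
      thus ?thesis using s[of "k + i" "k' + j"] that by simp
    qed
    moreover have "E1 = E 0" "E2 = E m" by (simp_all add: E1_def E2_def E_def)
    ultimately show "mat_adjoint E1 * E1 = 1\<^sub>m m" "mat_adjoint E2 * E2 = 1\<^sub>m m"
      "mat_adjoint E1 * E2 = 0\<^sub>m m m" "mat_adjoint E2 * E1 = 0\<^sub>m m m"
      using carrier_matD[OF Ec] by (auto intro!: eq_matI simp del: index_mult_mat(1))
  qed
  have E1x: "(mat_adjoint E1 *\<^sub>v x) $ i = x $ i" and E2x: "(mat_adjoint E2 *\<^sub>v x) $ i = x $ (m + i)"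
    if x: "x \<in> carrier_vec (m + m)" and i: "i < m" for x i
  proof -
    have "(mat_adjoint E1 *\<^sub>v x) $ i = (\<Sum>j<m + m. mat_adjoint E1 $$ (i,j) * x $ j)"
      by (rule mat_mult_vec_index_sum) (use E x i in auto)
    also have "\<dots> = (\<Sum>j<m + m. if j = i then x $ j else 0)"
      using i by (intro sum.cong) (auto simp: E1_def)
    finally show "(mat_adjoint E1 *\<^sub>v x) $ i = x $ i" using i by simp
    have "(mat_adjoint E2 *\<^sub>v x) $ i = (\<Sum>j<m + m. mat_adjoint E2 $$ (i,j) * x $ j)"
      by (rule mat_mult_vec_index_sum) (use E x i in auto)
    also have "\<dots> = (\<Sum>j<m + m. if j = m + i then x $ j else 0)"
      using i by (intro sum.cong) (auto simp: E2_def)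
    finally show "(mat_adjoint E2 *\<^sub>v x) $ i = x $ (m + i)" using i by simp
  qed
  note dims = dimsXYV dimsZ carrier_matD[OF E(1)] carrier_matD[OF E(2)] carrier_matD[OF Tc]
  note EE' = mult_left_inverse_cancel[OF EE(1)] mult_left_inverse_cancel[OF EE(2)]
  \<comment> \<open>The direct sum of \<open>Y\<close> and \<open>T\<close>, written with the
    embeddings of the summands: \<open>E1\<close> and \<open>E2\<close> intertwine it with
    \<open>Y\<close> and \<open>T\<close>, so \<open>f(B)\<close> splits in the same way.\<close>
  define B where "B = E1 * Y * mat_adjoint E1 + E2 * T * mat_adjoint E2"
  have Bc: "B \<in> carrier_mat (m + m) (m + m)" unfolding B_def using dims by (intro carrier_matI) auto
  have Bh: "hermitian_mat B"
  proof -
    have "E1 * Y * mat_adjoint E1 \<in> carrier_mat (m + m) (m + m)"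
      "E2 * T * mat_adjoint E2 \<in> carrier_mat (m + m) (m + m)"
      using dims by (auto intro!: carrier_matI)
    from mat_adjoint_add[OF this] show ?thesis
      using dims Yh Th by (simp add: hermitian_mat_def B_def mat_adjoint_mult_dim mult_mat_assoc_dim)
  qed
  have B: "pos_def_mat (m + m) B"
    unfolding pos_def_mat_def
  proof (intro conjI ballI impI)
    fix x :: "complex vec" assume x: "x \<in> carrier_vec (m + m)" "x \<noteq> 0\<^sub>v (m + m)"
    define a b where "a = mat_adjoint E1 *\<^sub>v x" and "b = mat_adjoint E2 *\<^sub>v x"
    have ab: "a \<in> carrier_vec m" "b \<in> carrier_vec m"
      using E x by (auto simp: a_def b_def intro!: mult_mat_vec_carrier)
    have Ya: "Y *\<^sub>v a \<in> carrier_vec m" and Tb: "T *\<^sub>v b \<in> carrier_vec m"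
      using ab Yc Tc by (auto intro!: mult_mat_vec_carrier)
    have "B *\<^sub>v x = E1 *\<^sub>v (Y *\<^sub>v a) + E2 *\<^sub>v (T *\<^sub>v b)"
      unfolding B_def a_def b_def using dims x
      by (subst add_mult_distrib_mat_vec[of _ "m + m" "m + m"]) (auto simp: mult_mat_vec_assoc_dim intro!: carrier_matI)
    hence "(B *\<^sub>v x) \<bullet>c x = (E1 *\<^sub>v (Y *\<^sub>v a)) \<bullet>c x + (E2 *\<^sub>v (T *\<^sub>v b)) \<bullet>c x"
      using mult_mat_vec_carrier[OF E(1) Ya] mult_mat_vec_carrier[OF E(2) Tb] x
      by (simp add: cscalar_prod_left_add[where n="m + m"])
    also have "\<dots> = (Y *\<^sub>v a) \<bullet>c a + (T *\<^sub>v b) \<bullet>c b"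
      unfolding cscalar_prod_adjoint[OF E(1) Ya x(1)] cscalar_prod_adjoint[OF E(2) Tb x(1)]
      by (simp only: a_def b_def)
    finally have eq: "Re ((B *\<^sub>v x) \<bullet>c x) = Re ((Y *\<^sub>v a) \<bullet>c a) + Re ((T *\<^sub>v b) \<bullet>c b)" by simp
    have nn: "Re ((Y *\<^sub>v a) \<bullet>c a) \<ge> 0" "Re ((T *\<^sub>v b) \<bullet>c b) \<ge> 0"
      using pos_def_matD(3)[OF Y ab(1)] pos_def_matD(3)[OF T ab(2)] mult_mat_zero_vec[OF Yc] mult_mat_zero_vec[OF Tc]
      by (cases "a = 0\<^sub>v m"; cases "b = 0\<^sub>v m"; simp)+
    have "a \<noteq> 0\<^sub>v m \<or> b \<noteq> 0\<^sub>v m"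
    proof (rule ccontr)
      assume *: "\<not> (a \<noteq> 0\<^sub>v m \<or> b \<noteq> 0\<^sub>v m)"
      have "x $ i = 0" if "i < m + m" for i
      proof (cases "i < m")
        case True
        have "a $ i = 0" using * True by simp
        thus ?thesis using E1x[OF x(1) True] by (simp add: a_def)
      next
        case False
        hence im: "i - m < m" "m + (i - m) = i" using that by auto
        have "b $ (i - m) = 0" using * im by simp
        thus ?thesis using E2x[OF x(1) im(1)] im by (simp add: b_def)
      qed
      hence "x = 0\<^sub>v (m + m)" using x(1) by (intro eq_vecI) auto
      thus False using x(2) by simp
    qed
    thus "Re ((B *\<^sub>v x) \<bullet>c x) > 0"
      using eq nn pos_def_matD(3)[OF Y ab(1)] pos_def_matD(3)[OF T ab(2)] by fastforce
  qed (fact Bc Bh)+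
  define J where "J = E1 * V + E2 * Z"
  have Jc: "J \<in> carrier_mat (m + m) m" unfolding J_def using dims by (intro carrier_matI) auto
  have Ja: "mat_adjoint J = mat_adjoint V * mat_adjoint E1 + mat_adjoint Z * mat_adjoint E2"
    unfolding J_def mat_adjoint_add[OF mult_carrier_mat[OF E(1) V] mult_carrier_mat[OF E(2) Z(1)]]
    using dims by (simp add: mat_adjoint_mult_dim)
  have zero: "0\<^sub>m m m * A = 0\<^sub>m m m" if "A \<in> carrier_mat m m" for A :: "complex mat"
    using that by simp
  have EJ: "mat_adjoint E1 * J = V" "mat_adjoint E2 * J = Z"
  proof -
    have "mat_adjoint E1 * J = V + 0\<^sub>m m m * Z" "mat_adjoint E2 * J = 0\<^sub>m m m * V + Z"
      unfolding J_def using dims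
      by (simp_all add: mult_add_mat_dim mult_mat_assoc_dim[symmetric] EE
          left_mult_one_mat[OF V] left_mult_one_mat[OF Z(1)])
    thus "mat_adjoint E1 * J = V" "mat_adjoint E2 * J = Z"
      using V Z(1) zero[OF V] zero[OF Z(1)] by simp_all
  qed
  have JJ: "mat_adjoint J * J = 1\<^sub>m m"
  proof -
    have "mat_adjoint J * J = mat_adjoint V * V + W"
      unfolding Ja Z(3)[symmetric] using dims carrier_matD[OF Jc]
      by (simp add: add_mult_mat_dim mult_mat_assoc_dim EJ)
    also have "\<dots> = 1\<^sub>m m" unfolding W_def using VVc by (intro eq_matI) auto
    finally show ?thesis .
  qed
  have JBJ: "X = mat_adjoint J * B * J"
  proof -
    have BJ: "B * J = E1 * (Y * V) + E2 * (T * Z)"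
      unfolding B_def using dims carrier_matD[OF Jc] by (simp add: add_mult_mat_dim mult_mat_assoc_dim EJ)
    have "mat_adjoint E1 * (B * J) = Y * V + 0\<^sub>m m m * (T * Z)"
      "mat_adjoint E2 * (B * J) = 0\<^sub>m m m * (Y * V) + T * Z"
      unfolding BJ using dims
      by (simp_all add: mult_add_mat_dim mult_mat_assoc_dim[symmetric] EE
          left_mult_one_mat[OF Yc] left_mult_one_mat[OF Tc])
    hence EBJ: "mat_adjoint E1 * (B * J) = Y * V" "mat_adjoint E2 * (B * J) = T * Z"
      using zero[OF mult_carrier_mat[OF Yc V]] zero[OF mult_carrier_mat[OF Tc Z(1)]]
        right_add_zero_mat[OF mult_carrier_mat[OF Yc V]] left_add_zero_mat[OF mult_carrier_mat[OF Tc Z(1)]] by simp_all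
    have "mat_adjoint J * B * J = mat_adjoint V * (Y * V) + Q"
      unfolding Ja ZTZ[symmetric] using dims carrier_matD[OF Jc] carrier_matD[OF Bc]
      by (simp add: add_mult_mat_dim mult_mat_assoc_dim EBJ)
    also have "\<dots> = X" unfolding Q_def using dims VYVc Xc by (intro eq_matI) (auto simp: mult_mat_assoc_dim)
    finally show ?thesis by simp
  qed
  define a b where "a = V *\<^sub>v v" and "b = Z *\<^sub>v v"
  have ab: "a \<in> carrier_vec m" "b \<in> carrier_vec m"
    using V Z v by (auto simp: a_def b_def intro!: mult_mat_vec_carrier)
  have Jv: "J *\<^sub>v v = E1 *\<^sub>v a + E2 *\<^sub>v b"
    unfolding J_def a_def b_def using dims v
    by (subst add_mult_distrib_mat_vec[of _ "m + m" m]) (auto simp: mult_mat_vec_assoc_dim intro!: carrier_matI)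
  have fY: "spectral_fun f Y \<in> carrier_mat m m" and fT: "spectral_fun f T \<in> carrier_mat m m"
    and fB: "spectral_fun f B \<in> carrier_mat (m + m) (m + m)"
    using spectral_fun_carrier[OF Yc Yh] spectral_fun_carrier[OF Tc Th] spectral_fun_carrier[OF Bc Bh] by auto
  have "B * E1 = E1 * Y + E2 * (T * 0\<^sub>m m m)" "B * E2 = E1 * (Y * 0\<^sub>m m m) + E2 * T"
    unfolding B_def using dims
    by (simp_all add: add_mult_mat_dim mult_mat_assoc_dim EE right_mult_one_mat[OF Yc] right_mult_one_mat[OF Tc])
  hence BE: "B * E1 = E1 * Y" "B * E2 = E2 * T"
    using E Yc Tc right_mult_zero_mat[OF E(1)] right_mult_zero_mat[OF E(2)] right_mult_zero_mat[OF Yc] right_mult_zero_mat[OF Tc]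
      right_add_zero_mat[OF mult_carrier_mat[OF E(1) Yc]] left_add_zero_mat[OF mult_carrier_mat[OF E(2) Tc]] by simp_all
  have fBE: "spectral_fun f B * E1 = E1 * spectral_fun f Y" "spectral_fun f B * E2 = E2 * spectral_fun f T"
    by (rule spectral_fun_intertwine[OF Bc Bh Yc Yh E(1) BE(1)], rule spectral_fun_intertwine[OF Bc Bh Tc Th E(2) BE(2)])
  have fBv: "spectral_fun f B *\<^sub>v (J *\<^sub>v v) = E1 *\<^sub>v (spectral_fun f Y *\<^sub>v a) + E2 *\<^sub>v (spectral_fun f T *\<^sub>v b)"
    unfolding Jv using mult_add_distrib_mat_vec[OF fB mult_mat_vec_carrier[OF E(1) ab(1)] mult_mat_vec_carrier[OF E(2) ab(2)]]
      dims carrier_matD[OF fB] carrier_matD[OF fY] carrier_matD[OF fT] ab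
    by (simp add: mult_mat_vec_assoc_dim[symmetric] fBE)
  have Jvc: "J *\<^sub>v v \<in> carrier_vec (m + m)" by (rule mult_mat_vec_carrier[OF Jc v])
  have EJv: "mat_adjoint E1 *\<^sub>v (J *\<^sub>v v) = a" "mat_adjoint E2 *\<^sub>v (J *\<^sub>v v) = b"
    using dims carrier_matD[OF Jc] v by (simp_all add: mult_mat_vec_assoc_dim[symmetric] EJ a_def b_def)
  have fYa: "spectral_fun f Y *\<^sub>v a \<in> carrier_vec m" and fTb: "spectral_fun f T *\<^sub>v b \<in> carrier_vec m"
    using mult_mat_vec_carrier[OF fY ab(1)] mult_mat_vec_carrier[OF fT ab(2)] by auto
  have "(spectral_fun f B *\<^sub>v (J *\<^sub>v v)) \<bullet>c (J *\<^sub>v v) = (spectral_fun f Y *\<^sub>v a) \<bullet>c a + (spectral_fun f T *\<^sub>v b) \<bullet>c b"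
    unfolding fBv cscalar_prod_left_add[OF mult_mat_vec_carrier[OF E(1) fYa] mult_mat_vec_carrier[OF E(2) fTb] Jvc]
      cscalar_prod_adjoint[OF E(1) fYa Jvc] cscalar_prod_adjoint[OF E(2) fTb Jvc] EJv ..
  moreover have "Re ((spectral_fun f B *\<^sub>v (J *\<^sub>v v)) \<bullet>c (J *\<^sub>v v)) \<le> Re ((spectral_fun f X *\<^sub>v v) \<bullet>c v)"
    by (rule matrix_concave_isometry[OF conc B Jc JJ JBJ v])
  \<comment> \<open>The contribution of the auxiliary summand may be dropped, as \<open>f\<close> is
    nonnegative on the eigenvalues of \<open>T\<close>.\<close>
  moreover have "Re ((spectral_fun f T *\<^sub>v b) \<bullet>c b) \<ge> 0"
  proof -
    obtain d w where dw: "\<And>i. i < m \<Longrightarrow> d i > 0" "\<And>i. i < m \<Longrightarrow> w i \<ge> 0"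
      "\<And>f. Re ((spectral_fun f T *\<^sub>v b) \<bullet>c b) = (\<Sum>i<m. f (d i) * w i)"
      using spectral_fun_quadratic_form[OF T ab(2)] by metis
    show ?thesis unfolding dw(3) using dw(1,2) f by (intro sum_nonneg) auto
  qed
  ultimately show ?thesis by (simp add: a_def)
qed

section \<open>Positivity of the Loewner kernels\<close>

lemma mat_diag_quadratic_form:
  assumes w: "w \<in> carrier_vec m"
  shows "Re ((mat_diag m (\<lambda>i. complex_of_real (t i)) *\<^sub>v w) \<bullet>c w) = (\<Sum>i<m. t i * (cmod (w $ i))\<^sup>2)"
proof -
  have "(mat_diag m (\<lambda>i. complex_of_real (t i)) *\<^sub>v w) \<bullet>c w = (\<Sum>i<m. of_real (t i) * w $ i * cnj (w $ i))"
    unfolding cscalar_prod_sum[OF w] using w by (intro sum.cong) (auto simp del: index_mult_mat_vec)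
  also have "\<dots> = of_real (\<Sum>i<m. t i * (cmod (w $ i))\<^sup>2)"
    by (simp add: complex_norm_square mult.assoc del: of_real_power)
  finally show ?thesis by simp
qed

lemma pos_def_mat_diag:
  assumes t: "\<And>i. i < m \<Longrightarrow> t i > 0"
  shows "pos_def_mat m (mat_diag m (\<lambda>i. complex_of_real (t i)))"
  unfolding pos_def_mat_def
proof (intro conjI ballI impI)
  fix w :: "complex vec" assume w: "w \<in> carrier_vec m" "w \<noteq> 0\<^sub>v m"
  obtain k where k: "k < m" "w $ k \<noteq> 0"
    using w by (metis carrier_vecD eq_vecI index_zero_vec)
  show "Re ((mat_diag m (\<lambda>i. complex_of_real (t i)) *\<^sub>v w) \<bullet>c w) > 0"
    unfolding mat_diag_quadratic_form[OF w(1)]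
    by (rule sum_pos2[of _ k]) (use k t in \<open>simp_all add: less_imp_le\<close>)
qed (auto simp: hermitian_mat_def mat_adjoint_mat_diag)

section \<open>Scalar concavity and right derivatives\<close>

lemma matrix_concave_imp_concave_on:
  assumes "matrix_concave f"
  shows "concave_on {0<..} f"
  unfolding concave_on_iff
proof (intro conjI ballI allI impI)
  show "convex {0::real<..}" by simp
next
  fix x y u v :: real
  assume xy: "x \<in> {0<..}" "y \<in> {0<..}" and uv: "0 \<le> u" "0 \<le> v" "u + v = 1"
  let ?D = "\<lambda>x. mat_diag 1 (\<lambda>_. complex_of_real x)"
  have pd: "pos_def_mat 1 (?D x)" if "x > 0" for x
    using that by (intro pos_def_mat_diag)
  have comb: "complex_of_real (1 - v) \<cdot>\<^sub>m ?D a + complex_of_real v \<cdot>\<^sub>m ?D b = ?D (u * a + v * b)" for a b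
  proof -
    have u: "u = 1 - v" using uv by simp
    show ?thesis unfolding u
      by (intro eq_matI) (auto simp: mat_diag_def)
  qed
  have "loewner_le 1 (complex_of_real (1 - v) \<cdot>\<^sub>m spectral_fun f (?D x) + complex_of_real v \<cdot>\<^sub>m spectral_fun f (?D y))
      (spectral_fun f (complex_of_real (1 - v) \<cdot>\<^sub>m ?D x + complex_of_real v \<cdot>\<^sub>m ?D y))"
    using assms[unfolded matrix_concave_def, rule_format, OF pd pd, of x y v] xy uv by simp
  hence "loewner_le 1 (?D (u * f x + v * f y)) (?D (f (u * x + v * y)))"
    unfolding comb spectral_fun_diag[of f 1 "\<lambda>_. _"] .
  from loewner_leD[OF this unit_vec_carrier[of 1 0], unfolded mat_diag_quadratic_form[OF unit_vec_carrier]]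
  show "u * f x + v * f y \<le> f (u *\<^sub>R x + v *\<^sub>R y)"
    by simp
qed

text \<open>The negated difference quotient \<open>g\<close> increases with \<open>h\<close> and is
  bounded below by the negated slope over \<open>[x/2, x]\<close>, so it converges at 0 from the
  right. One side suffices because the perturbations below only increase the points
  \<open>x i\<close>.\<close>

lemma concave_on_right_derivative:
  fixes f :: "real \<Rightarrow> real"
  assumes f: "concave_on {0<..} f" and x: "x > 0"
  obtains d where "((\<lambda>h. (f (x + h) - f x) / h) \<longlongrightarrow> d) (at_right 0)"
proof -
  define g where "g h = - ((f (x + h) - f x) / h)" for h
  have ineq: "f (u * a + v * b) \<ge> u * f a + v * f b"
    if "a > 0" "b > 0" "u \<ge> 0" "v \<ge> 0" "u + v = 1" for u v a b
    using f that by (auto simp: concave_on_iff)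
  have "(g \<longlongrightarrow> Inf (g ` ({0<..} \<inter> UNIV))) (at 0 within ({0<..} \<inter> UNIV))"
  proof (rule Lim_right_bound)
    fix a b :: real assume ab: "0 < a" "a \<le> b"
    have "((b - a) / b) * f x + (a / b) * f (x + b) \<le> f (((b - a) / b) * x + (a / b) * (x + b))"
      by (rule ineq) (use ab x in \<open>auto simp: field_simps\<close>)
    also have "((b - a) / b) * x + (a / b) * (x + b) = x + a"
      using ab by (simp add: divide_simps) (simp add: algebra_simps)
    finally have "(a / b) * (f (x + b) - f x) \<le> f (x + a) - f x" using ab by (simp add: field_simps)
    thus "g a \<le> g b" using ab by (simp add: g_def field_simps)
  next
    fix a :: real assume a: "0 < a"
    define p where "p = a + x / 2"
    have p: "p > 0" using a x by (simp add: p_def)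
    \<comment> \<open>The point \<open>x\<close> is the convex combination of \<open>x/2\<close> and
      \<open>x + a\<close> with these weights.\<close>
    have "(a / p) * f (x/2) + ((x/2) / p) * f (x + a) \<le> f ((a / p) * (x/2) + ((x/2) / p) * (x + a))"
    proof (rule ineq)
      show "a / p + (x/2) / p = 1" using p by (simp only: add_divide_distrib[symmetric] p_def) simp
    qed (use a x p in auto)
    also have "(a / p) * (x/2) + ((x/2) / p) * (x + a) = (a * (x/2) + (x/2) * (x + a)) / p"
      by (simp add: add_divide_distrib)
    also have "a * (x/2) + (x/2) * (x + a) = x * p" by (simp add: p_def field_simps)
    also have "x * p / p = x" using p by simp
    finally have "(a * f (x/2) + (x/2) * f (x + a)) / p \<le> f x" by (simp add: add_divide_distrib)
    hence "a * f (x/2) + (x/2) * f (x + a) \<le> f x * (a + x/2)"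
      using p by (simp add: pos_divide_le_eq p_def)
    thus "- ((f x - f (x/2)) / (x/2)) \<le> g a" using a x by (simp add: g_def field_simps)
  qed
  hence "((\<lambda>h. - g h) \<longlongrightarrow> - Inf (g ` {0<..})) (at_right 0)"
    by (intro tendsto_minus) simp
  thus thesis using that by (simp add: g_def)
qed

section \<open>First-order expansion of the compression inequality\<close>

lemma sum_sum_symmetrize:
  fixes K :: "nat \<Rightarrow> nat \<Rightarrow> real"
  assumes "\<And>i j. g i j = g j i"
  shows "2 * (\<Sum>i<m. \<Sum>j<m. K i j * g i j) = (\<Sum>i<m. \<Sum>j<m. (K i j + K j i) * g i j)"
proof -
  have "(\<Sum>i<m. \<Sum>j<m. K i j * g i j) = (\<Sum>i<m. \<Sum>j<m. K j i * g i j)"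
    by (subst sum.swap) (simp add: assms)
  thus ?thesis by (simp add: ring_distribs sum.distrib)
qed

lemma cmod_add_of_real_mult_square:
  "(cmod (v + of_real e * w))\<^sup>2 = (cmod v)\<^sup>2 + 2 * e * Re (w * cnj v) + e\<^sup>2 * (cmod w)\<^sup>2"
  unfolding cmod_power2 by (simp add: power2_eq_square algebra_simps)

lemma Re_mult_cnj_le: "2 * Re (w * cnj v) \<le> (cmod w)\<^sup>2 + (cmod v)\<^sup>2"
proof -
  have "0 \<le> (cmod (v + of_real (-1) * w))\<^sup>2" by simp
  thus ?thesis unfolding cmod_add_of_real_mult_square by simp
qed

text \<open>
  The compression inequality for \<open>1 + e L\<close>, \<open>diag (x + e b)\<close> and \<open>diag (x + e a)\<close>, expanded to
  first order in \<open>e\<close>. The two assumptions on \<open>L\<close> are the first-order versions of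
  \<open>V\<^sup>* V < 1\<close> and \<open>V\<^sup>* Y V < X\<close>.
\<close>

lemma matrix_concave_first_order:
  fixes x a b d :: "nat \<Rightarrow> real" and L :: "nat \<Rightarrow> nat \<Rightarrow> real"
  assumes f: "\<And>x. x > 0 \<Longrightarrow> f x \<ge> 0" and conc: "matrix_concave f"
    and x: "\<And>i. i < m \<Longrightarrow> x i > 0" and a: "\<And>i. i < m \<Longrightarrow> a i \<ge> 0" and b: "\<And>i. i < m \<Longrightarrow> b i \<ge> 0"
    and d: "\<And>i. i < m \<Longrightarrow> ((\<lambda>h. (f (x i + h) - f (x i)) / h) \<longlongrightarrow> d i) (at_right 0)"
    and c: "c > 0"
    and H1: "\<And>v :: nat \<Rightarrow> complex. (\<Sum>i<m. \<Sum>j<m. (L i j + L j i) * Re (v j * cnj (v i)))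
      \<le> - c * (\<Sum>i<m. (cmod (v i))\<^sup>2)"
    and H2: "\<And>v :: nat \<Rightarrow> complex. (\<Sum>i<m. (b i - a i) * (cmod (v i))\<^sup>2) +
      (\<Sum>i<m. \<Sum>j<m. (x i * L i j + x j * L j i) * Re (v j * cnj (v i))) \<le> - c * (\<Sum>i<m. (cmod (v i))\<^sup>2)"
  shows "0 \<le> (\<Sum>i<m. d i * (a i - b i) * (v i)\<^sup>2) - (\<Sum>i<m. \<Sum>j<m. (f (x i) * L i j + f (x j) * L j i) * (v i * v j))"
proof -
  \<comment> \<open>Squared Hilbert-Schmidt norm of \<open>L\<close>; it bounds the square of the
    operator norm.\<close>
  define C where "C = (\<Sum>i<m. \<Sum>j<m. (L i j)\<^sup>2)"
  define K where "K = 1 + (\<Sum>i<m. x i + 2 * b i)"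
  \<comment> \<open>Below \<open>e0\<close> the second-order terms, at most
    \<open>e^2 K (C + 1) N\<close>, stay below the first-order gain \<open>e c N\<close>, where
    \<open>N\<close> is the squared norm of the test vector.\<close>
  define e0 where "e0 = min 1 (c / (2 * K * (C + 1)))"
  have C: "C \<ge> 0" by (auto simp: C_def intro!: sum_nonneg)
  have K: "K \<ge> 1"
  proof -
    have "0 \<le> (\<Sum>i<m. x i + 2 * b i)"
      using x b by (intro sum_nonneg add_nonneg_nonneg) (auto intro: less_imp_le)
    thus ?thesis by (simp add: K_def)
  qed
  have Ki: "x i + 2 * b i \<le> K" if "i < m" for i
  proof -
    have "x i + 2 * b i \<le> (\<Sum>i<m. x i + 2 * b i)"
      by (rule member_le_sum) (use that x b in \<open>auto intro!: add_nonneg_nonneg simp: less_imp_le\<close>)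
    thus ?thesis by (simp add: K_def)
  qed
  have e0: "e0 > 0" using c K C by (auto simp: e0_def)
  have main: "(\<Sum>i<m. f (x i + e * b i) * (v i + e * (\<Sum>j<m. L i j * v j))\<^sup>2) \<le> (\<Sum>i<m. f (x i + e * a i) * (v i)\<^sup>2)"
    if e: "0 < e" "e < e0" for e
  proof -
    define Y where "Y = mat_diag m (\<lambda>i. complex_of_real (x i + e * b i))"
    define X where "X = mat_diag m (\<lambda>i. complex_of_real (x i + e * a i))"
    define V where "V = mat m m (\<lambda>(i,j). complex_of_real ((if i = j then 1 else 0) + e * L i j))"
    have V: "V \<in> carrier_mat m m" by (simp add: V_def)
    have Ypd: "pos_def_mat m Y" and Xpd: "pos_def_mat m X"
      unfolding Y_def X_def by (rule pos_def_mat_diag; use x a b e in \<open>auto intro!: add_pos_nonneg\<close>)+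
    have Vw: "(V *\<^sub>v w) $ i = w $ i + of_real e * (\<Sum>j<m. of_real (L i j) * w $ j)"
      if "w \<in> carrier_vec m" "i < m" for w i
    proof -
      have "(V *\<^sub>v w) $ i = (\<Sum>j<m. V $$ (i,j) * w $ j)"
        by (rule mat_mult_vec_index_sum[OF V that])
      also have "\<dots> = (\<Sum>j<m. (if j = i then w $ j else 0) + of_real e * (of_real (L i j) * w $ j))"
        using that by (intro sum.cong) (auto simp: V_def algebra_simps)
      finally show ?thesis using that by (simp add: sum.distrib sum_distrib_left)
    qed
    \<comment> \<open>The two strict hypotheses of the compression inequality,
      \<open>V^* V < 1\<close> and \<open>V^* Y V < X\<close>, tested at a nonzero vector.\<close>
    have key: "(\<Sum>i<m. 1 * (cmod ((V *\<^sub>v w) $ i))\<^sup>2) < (\<Sum>i<m. (cmod (w $ i))\<^sup>2) \<and>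
        (\<Sum>i<m. (x i + e * b i) * (cmod ((V *\<^sub>v w) $ i))\<^sup>2) < (\<Sum>i<m. (x i + e * a i) * (cmod (w $ i))\<^sup>2)"
      if w: "w \<in> carrier_vec m" "w \<noteq> 0\<^sub>v m" for w
    proof -
      define u where "u i = (\<Sum>j<m. of_real (L i j) * w $ j)" for i
      define N where "N = (\<Sum>i<m. (cmod (w $ i))\<^sup>2)"
      have N: "N > 0" using cscalar_prod_self_pos[OF w] unfolding cscalar_prod_self[OF w(1)] N_def by simp
      have u: "(\<Sum>i<m. (cmod (u i))\<^sup>2) \<le> C * N"
        unfolding C_def sum_distrib_right
      proof (rule sum_mono)
        fix i
        have "cmod (u i) \<le> (\<Sum>j<m. \<bar>L i j\<bar> * cmod (w $ j))"
          unfolding u_def by (rule order_trans[OF norm_sum]) (simp add: norm_mult)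
        hence "(cmod (u i))\<^sup>2 \<le> (\<Sum>j<m. \<bar>L i j\<bar> * cmod (w $ j))\<^sup>2" by (rule power_mono) simp
        also have "\<dots> \<le> (\<Sum>j<m. \<bar>L i j\<bar>\<^sup>2) * (\<Sum>j<m. (cmod (w $ j))\<^sup>2)"
          by (rule Cauchy_Schwarz_ineq_sum)
        finally show "(cmod (u i))\<^sup>2 \<le> (\<Sum>j<m. (L i j)\<^sup>2 * N)" by (simp add: N_def sum_distrib_right)
      qed
      \<comment> \<open>Only the symmetric part of a real matrix contributes to the real part of its
        form; this gives the sums the shape of \<open>H1\<close> and \<open>H2\<close>.\<close>
      have Lsum: "2 * (\<Sum>i<m. t i * Re (u i * cnj (w $ i))) =
          (\<Sum>i<m. \<Sum>j<m. (t i * L i j + t j * L j i) * Re (w $ j * cnj (w $ i)))" for t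
      proof -
        have "(\<Sum>i<m. t i * Re (u i * cnj (w $ i))) = (\<Sum>i<m. \<Sum>j<m. (t i * L i j) * Re (w $ j * cnj (w $ i)))"
          by (simp add: u_def sum_distrib_right sum_distrib_left mult.assoc)
        moreover have "2 * (\<Sum>i<m. \<Sum>j<m. (t i * L i j) * Re (w $ j * cnj (w $ i))) =
            (\<Sum>i<m. \<Sum>j<m. (t i * L i j + t j * L j i) * Re (w $ j * cnj (w $ i)))"
          by (rule sum_sum_symmetrize) (simp add: algebra_simps)
        ultimately show ?thesis by simp
      qed
      have Vsq: "(cmod ((V *\<^sub>v w) $ i))\<^sup>2 = (cmod (w $ i))\<^sup>2 + 2 * e * Re (u i * cnj (w $ i)) + e\<^sup>2 * (cmod (u i))\<^sup>2"
        if "i < m" for i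
        unfolding Vw[OF w(1) that] u_def[symmetric] by (rule cmod_add_of_real_mult_square)
      have expand: "(\<Sum>i<m. t i * (cmod ((V *\<^sub>v w) $ i))\<^sup>2) = (\<Sum>i<m. t i * (cmod (w $ i))\<^sup>2) +
          e * (2 * (\<Sum>i<m. t i * Re (u i * cnj (w $ i)))) + e\<^sup>2 * (\<Sum>i<m. t i * (cmod (u i))\<^sup>2)" for t
        by (simp add: Vsq ring_distribs sum.distrib sum_distrib_left mult_ac)
      have small: "e * (K * (C + 1) * N) < c * N"
      proof -
        have "e < c / (2 * K * (C + 1))" using e by (simp add: e0_def)
        hence "e * (2 * K * (C + 1)) < c" using K C by (simp add: pos_less_divide_eq)
        moreover have "e * (K * (C + 1)) \<ge> 0" using e K C by simp
        hence "e * (K * (C + 1)) \<le> e * (2 * K * (C + 1))" by linarith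
        ultimately have "e * (K * (C + 1)) < c" by (rule le_less_trans[rotated])
        thus ?thesis using N by (metis mult.assoc mult_strict_right_mono)
      qed
      have "(\<Sum>i<m. 1 * (cmod ((V *\<^sub>v w) $ i))\<^sup>2) \<le> N + e * (- c * N) + e * (e * (C * N))"
      proof -
        have "2 * (\<Sum>i<m. 1 * Re (u i * cnj (w $ i))) \<le> - c * N"
          unfolding Lsum using H1[of "\<lambda>i. w $ i"] by (simp add: N_def)
        hence "e * (2 * (\<Sum>i<m. 1 * Re (u i * cnj (w $ i)))) \<le> e * (- c * N)"
          using e by (intro mult_left_mono) auto
        moreover have "e\<^sup>2 * (\<Sum>i<m. 1 * (cmod (u i))\<^sup>2) \<le> e\<^sup>2 * (C * N)"
          using u by (intro mult_left_mono) auto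
        ultimately show ?thesis unfolding expand by (simp add: N_def power2_eq_square mult.assoc)
      qed
      also have "e * (C * N) < c * N"
      proof -
        have "C * N \<le> K * (C + 1) * N"
          using K C N by (intro mult_right_mono) (auto intro!: mult_mono[of 1 K C "C + 1", simplified])
        hence "e * (C * N) \<le> e * (K * (C + 1) * N)" using e by (intro mult_left_mono) auto
        thus ?thesis using small by simp
      qed
      hence "e * (e * (C * N)) < e * (c * N)" using e by (intro mult_strict_left_mono) auto
      hence "N + e * (- c * N) + e * (e * (C * N)) < N" by simp
      finally have 1: "(\<Sum>i<m. 1 * (cmod ((V *\<^sub>v w) $ i))\<^sup>2) < N" .
      have e1: "e \<le> 1" using e by (simp add: e0_def)
      define P where "P = (\<Sum>i<m. x i * (cmod (w $ i))\<^sup>2)"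
      define Q where "Q = (\<Sum>i<m. b i * (cmod (w $ i))\<^sup>2)"
      define R where "R = (\<Sum>i<m. a i * (cmod (w $ i))\<^sup>2)"
      \<comment> \<open>Everything of second order in \<open>e\<close>, after division by
        \<open>e^2\<close>.\<close>
      define S where "S = (\<Sum>i<m. b i * (2 * Re (u i * cnj (w $ i))) + (x i + e * b i) * (cmod (u i))\<^sup>2)"
      define T where "T = 2 * (\<Sum>i<m. x i * Re (u i * cnj (w $ i)))"
      have total: "(\<Sum>i<m. (x i + e * b i) * (cmod ((V *\<^sub>v w) $ i))\<^sup>2) = P + e * Q + e * T + e * (e * S)"
        unfolding expand P_def Q_def S_def T_def
        by (simp add: ring_distribs sum.distrib sum_distrib_left power2_eq_square mult_ac)
      have "S \<le> (\<Sum>i<m. K * ((cmod (u i))\<^sup>2 + (cmod (w $ i))\<^sup>2))"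
        unfolding S_def
      proof (rule sum_mono)
        fix i assume i: "i \<in> {..<m}"
        have "b i * (2 * Re (u i * cnj (w $ i))) \<le> b i * ((cmod (u i))\<^sup>2 + (cmod (w $ i))\<^sup>2)"
          using b i Re_mult_cnj_le by (intro mult_left_mono) auto
        moreover have "e * b i \<le> b i" using e1 e b[of i] i by (simp add: mult_left_le_one_le)
        hence "(x i + e * b i) * (cmod (u i))\<^sup>2 \<le> (x i + b i) * (cmod (u i))\<^sup>2"
          by (intro mult_right_mono) auto
        moreover have "b i * ((cmod (u i))\<^sup>2 + (cmod (w $ i))\<^sup>2) + (x i + b i) * (cmod (u i))\<^sup>2 \<le>
           (x i + 2 * b i) * ((cmod (u i))\<^sup>2 + (cmod (w $ i))\<^sup>2)"
          using b[of i] x[of i] i by (simp add: algebra_simps)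
        moreover have "\<dots> \<le> K * ((cmod (u i))\<^sup>2 + (cmod (w $ i))\<^sup>2)"
          using Ki i by (intro mult_right_mono) auto
        ultimately show "b i * (2 * Re (u i * cnj (w $ i))) + (x i + e * b i) * (cmod (u i))\<^sup>2 \<le>
          K * ((cmod (u i))\<^sup>2 + (cmod (w $ i))\<^sup>2)" by linarith
      qed
      also have "\<dots> = K * ((\<Sum>i<m. (cmod (u i))\<^sup>2) + N)"
        by (simp add: N_def sum_distrib_left[symmetric] sum.distrib)
      also have "\<dots> \<le> K * (C * N + N)" using u K by (intro mult_left_mono) auto
      also have "K * (C * N + N) = K * (C + 1) * N" by (simp add: algebra_simps)
      finally have "e * (e * S) \<le> e * (e * (K * (C + 1) * N))"
        using e by (intro mult_left_mono) auto
      moreover have "e * T \<le> e * (R - Q - c * N)"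
        unfolding T_def Lsum using e H2[of "\<lambda>i. w $ i"]
        by (intro mult_left_mono) (simp_all add: N_def R_def Q_def algebra_simps sum_subtractf)
      moreover have "e * (e * (K * (C + 1) * N)) < e * (c * N)"
        using small e by (intro mult_strict_left_mono) auto
      moreover have "P + e * Q + e * (R - Q - c * N) + e * (c * N) = P + e * R" by (simp add: algebra_simps)
      moreover have "\<dots> = (\<Sum>i<m. (x i + e * a i) * (cmod (w $ i))\<^sup>2)"
        by (simp add: P_def R_def sum.distrib sum_distrib_left ring_distribs mult_ac)
      ultimately show ?thesis unfolding total using 1 unfolding N_def by linarith
    qed
    define w where "w = vec m (\<lambda>i. complex_of_real (v i))"
    have w: "w \<in> carrier_vec m" by (simp add: w_def)
    have Vc: "V *\<^sub>v w \<in> carrier_vec m" for w using V by (auto simp: mult_mat_vec_def)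
    have "Re ((spectral_fun f Y *\<^sub>v (V *\<^sub>v w)) \<bullet>c (V *\<^sub>v w)) \<le> Re ((spectral_fun f X *\<^sub>v w) \<bullet>c w)"
    proof (rule matrix_concave_compression[OF f conc Ypd Xpd V _ _ w])
      fix w :: "complex vec" assume w: "w \<in> carrier_vec m" "w \<noteq> 0\<^sub>v m"
      show "Re ((V *\<^sub>v w) \<bullet>c (V *\<^sub>v w)) < Re (w \<bullet>c w)"
        using key[OF w] by (simp add: cscalar_prod_self[OF Vc] cscalar_prod_self[OF w(1)] del: index_mult_mat_vec)
      show "Re ((Y *\<^sub>v (V *\<^sub>v w)) \<bullet>c (V *\<^sub>v w)) < Re ((X *\<^sub>v w) \<bullet>c w)"
        using key[OF w] unfolding X_def Y_def mat_diag_quadratic_form[OF w(1)] mat_diag_quadratic_form[OF Vc] by blast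
    qed auto
    hence "(\<Sum>i<m. f (x i + e * b i) * (cmod ((V *\<^sub>v w) $ i))\<^sup>2) \<le> (\<Sum>i<m. f (x i + e * a i) * (cmod (w $ i))\<^sup>2)"
      unfolding X_def Y_def spectral_fun_diag mat_diag_quadratic_form[OF Vc] mat_diag_quadratic_form[OF w] .
    moreover have "(cmod ((V *\<^sub>v w) $ i))\<^sup>2 = (v i + e * (\<Sum>j<m. L i j * v j))\<^sup>2" if "i < m" for i
    proof -
      have "(V *\<^sub>v w) $ i = of_real (v i + e * (\<Sum>j<m. L i j * v j))"
        unfolding Vw[OF w that] using that by (simp add: w_def)
      thus ?thesis by (metis norm_of_real power2_abs)
    qed
    ultimately show ?thesis by (simp add: w_def del: index_mult_mat_vec)
  qed
  define W where "W i = (\<Sum>j<m. L i j * v j)" for i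
  \<comment> \<open>The right derivative after the substitution \<open>h = e * t\<close>;
    \<open>t = 0\<close> is separate because the quotient by \<open>e * t\<close> would
    degenerate.\<close>
  have lim: "((\<lambda>e. (f (x i + e * t) - f (x i)) / e) \<longlongrightarrow> d i * t) (at_right 0)" if "i < m" "t \<ge> 0" for i t
  proof (cases "t = 0")
    case False
    hence t: "t > 0" using that by simp
    have "filterlim (\<lambda>e. e * t) (at_right 0) (at_right (0::real))"
    proof (rule filterlim_at_withinI)
      show "((\<lambda>e. e * t) \<longlongrightarrow> 0) (at_right 0)" by (rule tendsto_eq_intros refl | simp)+
      show "\<forall>\<^sub>F e in at_right 0. e * t \<in> {0<..} - {0}"
        using t by (auto simp: eventually_at_right_field intro!: exI[of _ 1])
    qed
    from filterlim_compose[OF d[OF that(1)] this]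
    have "((\<lambda>e. (f (x i + e * t) - f (x i)) / (e * t) * t) \<longlongrightarrow> d i * t) (at_right 0)"
      by (intro tendsto_mult) auto
    thus ?thesis using t by (simp add: divide_simps cong: if_cong)
  qed simp
  \<comment> \<open>The inequality \<open>main\<close> divided by \<open>e\<close>: the terms
    \<open>f (x i) * (v i)^2\<close> of order zero cancel, and what remains has a limit.\<close>
  have "((\<lambda>e. (\<Sum>i<m. (f (x i + e * a i) - f (x i)) / e * (v i)\<^sup>2) -
      (\<Sum>i<m. (f (x i + e * b i) - f (x i)) / e * (v i + e * W i)\<^sup>2 + f (x i) * (2 * v i * W i + e * (W i)\<^sup>2)))
      \<longlongrightarrow> (\<Sum>i<m. d i * a i * (v i)\<^sup>2) - (\<Sum>i<m. d i * b i * (v i + 0 * W i)\<^sup>2 + f (x i) * (2 * v i * W i + 0 * (W i)\<^sup>2)))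
      (at_right 0)"
    by (intro tendsto_intros lim a b) auto
  moreover have "\<forall>\<^sub>F e in at_right 0. 0 \<le> (\<Sum>i<m. (f (x i + e * a i) - f (x i)) / e * (v i)\<^sup>2) -
      (\<Sum>i<m. (f (x i + e * b i) - f (x i)) / e * (v i + e * W i)\<^sup>2 + f (x i) * (2 * v i * W i + e * (W i)\<^sup>2))"
    unfolding eventually_at_right_field
  proof (intro exI[of _ e0] conjI allI impI)
    fix e :: real assume e: "0 < e" "e < e0"
    have eq: "(\<Sum>i<m. (f (x i + e * a i) - f (x i)) / e * (v i)\<^sup>2) -
      (\<Sum>i<m. (f (x i + e * b i) - f (x i)) / e * (v i + e * W i)\<^sup>2 + f (x i) * (2 * v i * W i + e * (W i)\<^sup>2))
      = (\<Sum>i<m. (f (x i + e * a i) * (v i)\<^sup>2 - f (x i + e * b i) * (v i + e * W i)\<^sup>2) / e)"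
      unfolding sum_subtractf[symmetric]
      by (intro sum.cong refl) (use e in \<open>simp add: field_simps power2_eq_square\<close>)
    have "0 \<le> (\<Sum>i<m. f (x i + e * a i) * (v i)\<^sup>2 - f (x i + e * b i) * (v i + e * W i)\<^sup>2)"
      using main[OF e] by (simp add: sum_subtractf W_def)
    thus "0 \<le> (\<Sum>i<m. (f (x i + e * a i) - f (x i)) / e * (v i)\<^sup>2) -
      (\<Sum>i<m. (f (x i + e * b i) - f (x i)) / e * (v i + e * W i)\<^sup>2 + f (x i) * (2 * v i * W i + e * (W i)\<^sup>2))"
      unfolding eq sum_divide_distrib[symmetric] using e by simp
  qed (use e0 in auto)
  ultimately have "0 \<le> (\<Sum>i<m. d i * a i * (v i)\<^sup>2) - (\<Sum>i<m. d i * b i * (v i + 0 * W i)\<^sup>2 + f (x i) * (2 * v i * W i + 0 * (W i)\<^sup>2))"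
    by (rule tendsto_lowerbound) simp
  also have "\<dots> = (\<Sum>i<m. d i * (a i - b i) * (v i)\<^sup>2) - 2 * (\<Sum>i<m. \<Sum>j<m. (f (x i) * L i j) * (v i * v j))"
    by (simp add: W_def algebra_simps sum.distrib sum_subtractf sum_distrib_left)
  also have "2 * (\<Sum>i<m. \<Sum>j<m. (f (x i) * L i j) * (v i * v j)) =
      (\<Sum>i<m. \<Sum>j<m. (f (x i) * L i j + f (x j) * L j i) * (v i * v j))"
    by (rule sum_sum_symmetrize) simp
  finally show ?thesis .
qed

section \<open>Two special perturbations and the Loewner kernels\<close>

lemma sum_sum_diagonal:
  "(\<Sum>i<m. \<Sum>j<m. (if i = j then p i else 0) * g i j) = (\<Sum>i<(m::nat). p i * g i i :: real)"
proof (rule sum.cong[OF refl])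
  fix i assume i: "i \<in> {..<m}"
  have "(\<Sum>j<m. (if i = j then p i else 0) * g i j) = (\<Sum>j<m. if i = j then p i * g i i else 0)"
    by (rule sum.cong) auto
  thus "(\<Sum>j<m. (if i = j then p i else 0) * g i j) = p i * g i i" using i by simp
qed

lemma sum_sum_Re_mult_cnj: "(\<Sum>i<m. \<Sum>j<m. Re (v j * cnj (v i))) = (cmod (\<Sum>i<m. v i))\<^sup>2"
proof -
  have "complex_of_real ((cmod (\<Sum>i<m. v i))\<^sup>2) = (\<Sum>i<m. \<Sum>j<m. v j * cnj (v i))"
    by (subst sum.swap) (simp only: complex_norm_square cnj_sum sum_product)
  hence "Re (complex_of_real ((cmod (\<Sum>i<m. v i))\<^sup>2)) = Re (\<Sum>i<m. \<Sum>j<m. v j * cnj (v i))" by simp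
  thus ?thesis by (simp only: Re_sum Re_complex_of_real)
qed

lemma nonneg_if_perturbed_nonneg:
  fixes P F :: real
  assumes "\<And>\<eta>. \<eta> > 0 \<Longrightarrow> 0 \<le> P + \<eta> * F"
  shows "0 \<le> P"
proof -
  have "((\<lambda>\<eta>. P + \<eta> * F) \<longlongrightarrow> P + 0 * F) (at_right 0)" by (intro tendsto_intros)
  moreover have "\<forall>\<^sub>F \<eta> in at_right 0. 0 \<le> P + \<eta> * F"
    using assms by (auto simp: eventually_at_right_field intro!: exI[of _ 1])
  ultimately have "0 \<le> P + 0 * F" by (rule tendsto_lowerbound) simp
  thus ?thesis by simp
qed

text \<open>Each kernel is the first-order inequality for a suitable choice of \<open>a\<close>,
  \<open>b\<close>, \<open>L\<close>, with \<open>d\<close> the right derivatives. The choices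
  satisfy the two conditions on \<open>L\<close> only in the limiting form \<open><= 0\<close>;
  adding \<open>-\<eta>\<close> to the diagonal of \<open>L\<close> makes them strict, and
  \<open>\<eta>\<close> tends to 0 at the end.\<close>

theorem loewner_kernels:
  fixes x :: "nat \<Rightarrow> real"
  assumes f: "\<And>x. x > 0 \<Longrightarrow> f x \<ge> 0" and conc: "matrix_concave f"
    and x: "\<And>i. i < m \<Longrightarrow> x i > 0" and inj: "inj_on x {..<m}"
  obtains d where
    "\<And>v. 0 \<le> (\<Sum>i<m. \<Sum>j<m. (if i = j then d i else (f (x i) - f (x j)) / (x i - x j)) * (v i * v j))"
    "\<And>v. 0 \<le> (\<Sum>i<m. \<Sum>j<m. (if i = j then f (x i) - x i * d i
        else (x i * f (x j) - x j * f (x i)) / (x i - x j)) * (v i * v j))"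
proof -
  have "\<forall>i. \<exists>d. i < m \<longrightarrow> ((\<lambda>h. (f (x i + h) - f (x i)) / h) \<longlongrightarrow> d) (at_right 0)"
    using concave_on_right_derivative[OF matrix_concave_imp_concave_on[OF conc] x] by metis
  then obtain d where d: "\<And>i. i < m \<Longrightarrow> ((\<lambda>h. (f (x i + h) - f (x i)) / h) \<longlongrightarrow> d i) (at_right 0)"
    by metis
  \<comment> \<open>A lower bound for 1 and for all \<open>x i\<close>, so that the one constant
    \<open>c = 2 * \<eta> * \<xi>\<close> works in \<open>H1\<close>, where the gain has weight 1,
    and in \<open>H2\<close>, where it has weight \<open>x i\<close>.\<close>
  define \<xi> where "\<xi> = Min (insert 1 (x ` {..<m}))"
  have \<xi>: "\<xi> > 0" "\<xi> \<le> 1" "\<And>i. i < m \<Longrightarrow> \<xi> \<le> x i" using x by (auto simp: \<xi>_def)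
  have ne: "x i - x j \<noteq> 0" if "i < m" "j < m" "i \<noteq> j" for i j
    using inj that by (auto dest: inj_onD)
  \<comment> \<open>Off the diagonal \<open>x i\<close> is replaced by \<open>x j + D\<close> with
    \<open>D\<close> nonzero, which gives \<open>field_simps\<close> a denominator that it can
    clear.\<close>
  have offdiag: P if "i < m" "j < m" "i = j \<Longrightarrow> P"
    "\<And>D. D \<noteq> 0 \<Longrightarrow> i \<noteq> j \<Longrightarrow> j \<noteq> i \<Longrightarrow> x i = x j + D \<Longrightarrow> P" for i j P
    using that(3) that(4)[of "x i - x j"] ne[OF that(1,2)] by (cases "i = j") auto
  have cn: "v j * cnj (v j) = of_real ((cmod (v j))\<^sup>2)" for v :: "nat \<Rightarrow> complex" and j
    by (simp only: complex_norm_square)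
  have \<xi>le: "\<xi> * (\<Sum>i<m. (cmod (v i))\<^sup>2) \<le> (\<Sum>i<m. x i * (cmod (v i))\<^sup>2)"
      "\<xi> * (\<Sum>i<m. (cmod (v i))\<^sup>2) \<le> (\<Sum>i<m. (cmod (v i))\<^sup>2)" for v :: "nat \<Rightarrow> complex"
    using \<xi> by (auto simp: sum_distrib_left intro!: sum_mono mult_right_mono mult_left_le_one_le)
  have \<xi>le': "(2 * \<eta> * \<xi>) * (\<Sum>i<m. (cmod (v i))\<^sup>2) \<le> 2 * \<eta> * (\<Sum>i<m. x i * (cmod (v i))\<^sup>2)"
      "(2 * \<eta> * \<xi>) * (\<Sum>i<m. (cmod (v i))\<^sup>2) \<le> 2 * \<eta> * (\<Sum>i<m. (cmod (v i))\<^sup>2)"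
    if "\<eta> > 0" for \<eta> and v :: "nat \<Rightarrow> complex"
    using that \<xi>le[of v] by (simp_all only: mult.assoc) (simp_all add: mult_left_mono)
  show thesis
  proof (rule that[of d])
    fix v :: "nat \<Rightarrow> real"
    let ?S = "\<Sum>i<m. \<Sum>j<m. (if i = j then d i else (f (x i) - f (x j)) / (x i - x j)) * (v i * v j)"
    show "0 \<le> ?S"
    proof (rule nonneg_if_perturbed_nonneg)
      fix \<eta> :: real assume \<eta>: "\<eta> > 0"
      \<comment> \<open>Here \<open>a = 1\<close> and \<open>b = 0\<close>. Apart from
        \<open>\<eta>\<close>, this \<open>L\<close> is antisymmetric, so the first condition is an
        equality, and \<open>x i * L i j + x j * L j i\<close> is -1 off the diagonal. With the
        diagonal term \<open>b - a = -1\<close> this makes the all-ones kernel with a negative sign,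
        whose form is \<open><= 0\<close>.\<close>
      define L where "L i j = (if i = j then - \<eta> else - 1 / (x i - x j))" for i j
      have L1: "L i j + L j i = (if i = j then - 2 * \<eta> else 0)" for i j
      proof -
        have "1 / (x j - x i) = - (1 / (x i - x j))"
          by (metis minus_diff_eq minus_divide_right)
        thus ?thesis by (simp add: L_def)
      qed
      have L2: "x i * L i j + x j * L j i = - 1 + (if i = j then 1 - 2 * \<eta> * x i else 0)" if "i < m" "j < m" for i j
        by (rule offdiag[OF that]) (auto simp: L_def field_simps)
      have L3: "f (x i) * L i j + f (x j) * L j i =
          (if i = j then d i else 0) + (if i = j then - 2 * \<eta> * f (x i) else 0)
          - (if i = j then d i else (f (x i) - f (x j)) / (x i - x j))" if "i < m" "j < m" for i j
        by (rule offdiag[OF that]) (auto simp: L_def field_simps)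
      have "0 \<le> (\<Sum>i<m. d i * (1 - 0) * (v i)\<^sup>2) - (\<Sum>i<m. \<Sum>j<m. (f (x i) * L i j + f (x j) * L j i) * (v i * v j))"
      proof (rule matrix_concave_first_order[OF f conc x _ _ d, where c = "2 * \<eta> * \<xi>"])
        fix v :: "nat \<Rightarrow> complex"
        have "(\<Sum>i<m. \<Sum>j<m. (L i j + L j i) * Re (v j * cnj (v i))) = - 2 * \<eta> * (\<Sum>i<m. (cmod (v i))\<^sup>2)"
          unfolding L1 sum_sum_diagonal by (simp add: cn sum_distrib_left sum_negf)
        also have "\<dots> \<le> - (2 * \<eta> * \<xi>) * (\<Sum>i<m. (cmod (v i))\<^sup>2)"
          using \<xi>le'(2)[OF \<eta>, of v] by (simp only: mult_minus_left; linarith)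
        finally show "(\<Sum>i<m. \<Sum>j<m. (L i j + L j i) * Re (v j * cnj (v i))) \<le> - (2 * \<eta> * \<xi>) * (\<Sum>i<m. (cmod (v i))\<^sup>2)" .
        have "(\<Sum>i<m. \<Sum>j<m. (x i * L i j + x j * L j i) * Re (v j * cnj (v i))) =
          (\<Sum>i<m. \<Sum>j<m. - Re (v j * cnj (v i)) + (if i = j then 1 - 2 * \<eta> * x i else 0) * Re (v j * cnj (v i)))"
          by (intro sum.cong refl) (simp add: L2 algebra_simps)
        also have "\<dots> = - (cmod (\<Sum>i<m. v i))\<^sup>2 + (\<Sum>i<m. (1 - 2 * \<eta> * x i) * (cmod (v i))\<^sup>2)"
          unfolding sum.distrib sum_negf sum_sum_diagonal sum_sum_Re_mult_cnj by (simp add: cn)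
        finally have "(\<Sum>i<m. (0 - 1) * (cmod (v i))\<^sup>2) +
            (\<Sum>i<m. \<Sum>j<m. (x i * L i j + x j * L j i) * Re (v j * cnj (v i))) =
            - (cmod (\<Sum>i<m. v i))\<^sup>2 - 2 * \<eta> * (\<Sum>i<m. x i * (cmod (v i))\<^sup>2)"
          by (simp add: sum_negf algebra_simps sum_subtractf sum_distrib_left)
        also have "\<dots> \<le> - (2 * \<eta> * \<xi>) * (\<Sum>i<m. (cmod (v i))\<^sup>2)"
          using \<xi>le'(1)[OF \<eta>, of v] zero_le_power2[of "cmod (\<Sum>i<m. v i)"] by (simp only: mult_minus_left; linarith)
        finally show "(\<Sum>i<m. (0 - 1) * (cmod (v i))\<^sup>2) +
            (\<Sum>i<m. \<Sum>j<m. (x i * L i j + x j * L j i) * Re (v j * cnj (v i)))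
            \<le> - (2 * \<eta> * \<xi>) * (\<Sum>i<m. (cmod (v i))\<^sup>2)" .
      qed (use \<eta> \<xi> in auto)
      also have "(\<Sum>i<m. \<Sum>j<m. (f (x i) * L i j + f (x j) * L j i) * (v i * v j)) =
        (\<Sum>i<m. \<Sum>j<m. (if i = j then d i else 0) * (v i * v j) + (if i = j then - 2 * \<eta> * f (x i) else 0) * (v i * v j)
          - (if i = j then d i else (f (x i) - f (x j)) / (x i - x j)) * (v i * v j))"
        by (intro sum.cong refl) (simp only: L3 lessThan_iff distrib_right left_diff_distrib)
      also have "\<dots> = (\<Sum>i<m. d i * (v i * v i)) + (\<Sum>i<m. - 2 * \<eta> * f (x i) * (v i * v i)) - ?S"
        unfolding sum.distrib sum_subtractf sum_sum_diagonal ..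
      finally show "0 \<le> ?S + \<eta> * (2 * (\<Sum>i<m. f (x i) * (v i * v i)))"
        by (simp add: power2_eq_square sum_distrib_left sum_negf algebra_simps)
    qed
  next
    fix v :: "nat \<Rightarrow> real"
    let ?S = "\<Sum>i<m. \<Sum>j<m. (if i = j then f (x i) - x i * d i
        else (x i * f (x j) - x j * f (x i)) / (x i - x j)) * (v i * v j)"
    show "0 \<le> ?S"
    proof (rule nonneg_if_perturbed_nonneg)
      fix \<eta> :: real assume \<eta>: "\<eta> > 0"
      \<comment> \<open>Here \<open>a = 0\<close> and \<open>b = x\<close>, and the roles are
        exchanged: \<open>L i j + L j i\<close> is -1 everywhere, hence the diagonal value -1/2, and
        \<open>x i * L i j + x j * L j i\<close> vanishes off the diagonal and cancels
        \<open>b\<close> on it.\<close>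
      define L where "L i j = (if i = j then - 1/2 - \<eta> else x j / (x i - x j))" for i j
      have L1: "L i j + L j i = - 1 + (if i = j then - 2 * \<eta> else 0)" if "i < m" "j < m" for i j
        by (rule offdiag[OF that]) (auto simp: L_def field_simps)
      have L2: "x i * L i j + x j * L j i = (if i = j then - x i - 2 * \<eta> * x i else 0)" if "i < m" "j < m" for i j
        by (rule offdiag[OF that]) (auto simp: L_def field_simps)
      have L3: "f (x i) * L i j + f (x j) * L j i =
          (if i = j then - x i * d i else 0) + (if i = j then - 2 * \<eta> * f (x i) else 0)
          - (if i = j then f (x i) - x i * d i else (x i * f (x j) - x j * f (x i)) / (x i - x j))"
        if "i < m" "j < m" for i j
        by (rule offdiag[OF that]) (auto simp: L_def field_simps)
      have "0 \<le> (\<Sum>i<m. d i * (0 - x i) * (v i)\<^sup>2) - (\<Sum>i<m. \<Sum>j<m. (f (x i) * L i j + f (x j) * L j i) * (v i * v j))"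
      proof (rule matrix_concave_first_order[OF f conc x _ _ d, where c = "2 * \<eta> * \<xi>"])
        fix v :: "nat \<Rightarrow> complex"
        have "(\<Sum>i<m. \<Sum>j<m. (L i j + L j i) * Re (v j * cnj (v i))) =
            (\<Sum>i<m. \<Sum>j<m. - Re (v j * cnj (v i)) + (if i = j then - 2 * \<eta> else 0) * Re (v j * cnj (v i)))"
          by (intro sum.cong refl) (simp add: L1 algebra_simps)
        also have "\<dots> = - (cmod (\<Sum>i<m. v i))\<^sup>2 - 2 * \<eta> * (\<Sum>i<m. (cmod (v i))\<^sup>2)"
          unfolding sum.distrib sum_negf sum_sum_diagonal sum_sum_Re_mult_cnj
          by (simp add: cn sum_distrib_left sum_negf)
        also have "\<dots> \<le> - (2 * \<eta> * \<xi>) * (\<Sum>i<m. (cmod (v i))\<^sup>2)"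
          using \<xi>le'(2)[OF \<eta>, of v] zero_le_power2[of "cmod (\<Sum>i<m. v i)"] by (simp only: mult_minus_left; linarith)
        finally show "(\<Sum>i<m. \<Sum>j<m. (L i j + L j i) * Re (v j * cnj (v i))) \<le> - (2 * \<eta> * \<xi>) * (\<Sum>i<m. (cmod (v i))\<^sup>2)" .
        have "(\<Sum>i<m. \<Sum>j<m. (x i * L i j + x j * L j i) * Re (v j * cnj (v i))) =
          (\<Sum>i<m. \<Sum>j<m. (if i = j then - x i - 2 * \<eta> * x i else 0) * Re (v j * cnj (v i)))"
          by (intro sum.cong refl) (simp add: L2)
        also have "\<dots> = (\<Sum>i<m. (- x i - 2 * \<eta> * x i) * (cmod (v i))\<^sup>2)"
          unfolding sum_sum_diagonal by (simp add: cn)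
        finally have "(\<Sum>i<m. (x i - 0) * (cmod (v i))\<^sup>2) +
            (\<Sum>i<m. \<Sum>j<m. (x i * L i j + x j * L j i) * Re (v j * cnj (v i))) =
            - 2 * \<eta> * (\<Sum>i<m. x i * (cmod (v i))\<^sup>2)"
          by (simp add: sum_negf algebra_simps sum_subtractf sum_distrib_left sum.distrib)
        also have "\<dots> \<le> - (2 * \<eta> * \<xi>) * (\<Sum>i<m. (cmod (v i))\<^sup>2)"
          using \<xi>le'(1)[OF \<eta>, of v] by (simp only: mult_minus_left; linarith)
        finally show "(\<Sum>i<m. (x i - 0) * (cmod (v i))\<^sup>2) +
            (\<Sum>i<m. \<Sum>j<m. (x i * L i j + x j * L j i) * Re (v j * cnj (v i)))
            \<le> - (2 * \<eta> * \<xi>) * (\<Sum>i<m. (cmod (v i))\<^sup>2)" .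
      qed (use \<eta> \<xi> x in \<open>auto simp: less_imp_le\<close>)
      also have "(\<Sum>i<m. \<Sum>j<m. (f (x i) * L i j + f (x j) * L j i) * (v i * v j)) =
        (\<Sum>i<m. \<Sum>j<m. (if i = j then - x i * d i else 0) * (v i * v j) + (if i = j then - 2 * \<eta> * f (x i) else 0) * (v i * v j)
          - (if i = j then f (x i) - x i * d i else (x i * f (x j) - x j * f (x i)) / (x i - x j)) * (v i * v j))"
        by (intro sum.cong refl) (simp only: L3 lessThan_iff distrib_right left_diff_distrib)
      also have "\<dots> = (\<Sum>i<m. - x i * d i * (v i * v i)) + (\<Sum>i<m. - 2 * \<eta> * f (x i) * (v i * v i)) - ?S"
        unfolding sum.distrib sum_subtractf sum_sum_diagonal ..
      finally show "0 \<le> ?S + \<eta> * (2 * (\<Sum>i<m. f (x i) * (v i * v i)))"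
        by (simp add: power2_eq_square sum_distrib_left sum_negf algebra_simps)
    qed
  qed
qed

section \<open>Interpolation by Stieltjes functions\<close>

lemma pos_semidef_matD:
  assumes "pos_semidef_mat n X"
  shows "X \<in> carrier_mat n n" "hermitian_mat X" "\<And>x. x \<in> carrier_vec n \<Longrightarrow> Re ((X *\<^sub>v x) \<bullet>c x) \<ge> 0"
  using assms by (auto simp: pos_semidef_mat_def)

text \<open>The form at a complex vector is the sum of the real forms at its real and imaginary
  parts.\<close>

lemma pos_semidef_mat_of_real_kernel:
  fixes K :: "nat \<Rightarrow> nat \<Rightarrow> real"
  assumes sym: "\<And>i j. i < m \<Longrightarrow> j < m \<Longrightarrow> K i j = K j i"
    and psd: "\<And>v :: nat \<Rightarrow> real. 0 \<le> (\<Sum>i<m. \<Sum>j<m. K i j * (v i * v j))"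
  shows "pos_semidef_mat m (mat m m (\<lambda>(i,j). complex_of_real (K i j)))" (is "pos_semidef_mat m ?M")
  unfolding pos_semidef_mat_def
proof (intro conjI ballI)
  show "hermitian_mat ?M" unfolding hermitian_mat_def using sym by (intro eq_matI) auto
  fix z :: "complex vec" assume z: "z \<in> carrier_vec m"
  have "(?M *\<^sub>v z) \<bullet>c z = (\<Sum>i<m. (\<Sum>j<m. ?M $$ (i,j) * z $ j) * cnj (z $ i))"
    unfolding cscalar_prod_sum[OF z]
    by (intro sum.cong refl) (simp only: mat_mult_vec_index_sum[OF mat_carrier z] lessThan_iff)
  also have "\<dots> = (\<Sum>i<m. \<Sum>j<m. of_real (K i j) * (z $ j * cnj (z $ i)))"
    by (simp add: sum_distrib_right mult.assoc)
  finally have "Re ((?M *\<^sub>v z) \<bullet>c z) =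
      (\<Sum>i<m. \<Sum>j<m. Re (of_real (K i j) * (z $ j * cnj (z $ i))))"
    by (simp only: Re_sum)
  also have "\<dots> = (\<Sum>i<m. \<Sum>j<m. K i j * (Re (z $ i) * Re (z $ j)) + K i j * (Im (z $ i) * Im (z $ j)))"
    by (intro sum.cong refl) (simp add: algebra_simps)
  also have "\<dots> = (\<Sum>i<m. \<Sum>j<m. K i j * (Re (z $ i) * Re (z $ j))) +
      (\<Sum>i<m. \<Sum>j<m. K i j * (Im (z $ i) * Im (z $ j)))"
    by (simp only: sum.distrib)
  finally have "Re ((?M *\<^sub>v z) \<bullet>c z) = (\<Sum>i<m. \<Sum>j<m. K i j * (Re (z $ i) * Re (z $ j))) +
      (\<Sum>i<m. \<Sum>j<m. K i j * (Im (z $ i) * Im (z $ j)))" .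
  thus "Re ((?M *\<^sub>v z) \<bullet>c z) \<ge> 0" using psd by (simp add: add_nonneg_nonneg)
qed simp

text \<open>At \<open>t e_i + e_j\<close> the quadratic term in \<open>t\<close> vanishes with
  \<open>H_ii\<close>. What is left is real affine in \<open>t\<close> and bounded below, so its
  slope \<open>H_ji\<close> must be 0.\<close>

lemma pos_semidef_mat_zero_diag:
  assumes H: "pos_semidef_mat n H" and ij: "i < n" "j < n" and 0: "H $$ (i,i) = 0"
  shows "H $$ (j,i) = 0" "H $$ (i,j) = 0"
proof -
  note Hc = pos_semidef_matD(1)[OF H]
  have sym: "H $$ (i,j) = cnj (H $$ (j,i))"
    using hermitian_mat_index[OF pos_semidef_matD(2)[OF H] Hc ij(2,1)] .
  show "H $$ (j,i) = 0"
  proof (rule ccontr)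
    assume ne: "H $$ (j,i) \<noteq> 0"
    hence ji: "j \<noteq> i" using 0 by auto
    define h where "h = H $$ (j,i)"
    define c where "c = Re (H $$ (j,j))"
    have ineq: "0 \<le> 2 * Re (t * h) + c" for t
    proof -
      define z where "z = t \<cdot>\<^sub>v unit_vec n i + unit_vec n j"
      have z: "z \<in> carrier_vec n" by (simp add: z_def)
      have zi: "z $ i = t" "z $ j = 1" using ij ji by (auto simp: z_def)
      have zk: "z $ k = 0" if "k < n" "k \<noteq> i" "k \<noteq> j" for k using that ij by (auto simp: z_def)
      have sum2: "(\<Sum>k<n. g k) = g i + g j" if "\<And>k. k < n \<Longrightarrow> k \<noteq> i \<Longrightarrow> k \<noteq> j \<Longrightarrow> g k = 0" for g :: "nat \<Rightarrow> complex"
      proof -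
        have "(\<Sum>k<n. g k) = (\<Sum>k\<in>{i,j}. g k)"
          by (rule sum.mono_neutral_right) (use that ij in auto)
        thus ?thesis using ji by simp
      qed
      have Hz: "(H *\<^sub>v z) $ k = H $$ (k,i) * t + H $$ (k,j)" if "k < n" for k
        unfolding mat_mult_vec_index_sum[OF Hc z that] by (subst sum2) (simp_all add: zi zk)
      have "(H *\<^sub>v z) \<bullet>c z = (H $$ (i,i) * t + H $$ (i,j)) * cnj t + (H $$ (j,i) * t + H $$ (j,j))"
        unfolding cscalar_prod_sum[OF z]
        by (subst sum2) (simp_all add: zi zk Hz ij del: index_mult_mat_vec)
      also have "\<dots> = cnj (h * t) + h * t + H $$ (j,j)" by (simp add: 0 sym h_def)
      finally have "Re ((H *\<^sub>v z) \<bullet>c z) = 2 * Re (t * h) + c" by (simp add: c_def)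
      thus ?thesis using pos_semidef_matD(3)[OF H z] by simp
    qed
    have hh: "Re (cnj h * h) = (cmod h)\<^sup>2"
      by (simp add: complex_norm_square[symmetric] mult.commute del: of_real_power flip: complex_norm_square)
    have h0: "(cmod h)\<^sup>2 > 0" using ne by (simp add: h_def)
    \<comment> \<open>This value makes the form at \<open>t = - r * cnj h\<close> equal to
      \<open>c - 2 * (\<bar>c\<bar> + 1)\<close>, which is negative.\<close>
    define r where "r = (\<bar>c\<bar> + 1) / (cmod h)\<^sup>2"
    have "0 \<le> 2 * Re ((- of_real r * cnj h) * h) + c" by (rule ineq)
    also have "Re ((- of_real r * cnj h) * h) = - r * Re (cnj h * h)"
      by (simp add: algebra_simps)
    also have "\<dots> = - (\<bar>c\<bar> + 1)" unfolding hh r_def using h0 by simp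
    finally show False by simp
  qed
  thus "H $$ (i,j) = 0" by (simp add: sym)
qed

lemma pos_semidef_mat_congruence:
  assumes H: "pos_semidef_mat n H" and C: "C \<in> carrier_mat n m"
  shows "pos_semidef_mat m (mat_adjoint C * H * C)"
  unfolding pos_semidef_mat_def
proof (intro conjI ballI)
  note Hc = pos_semidef_matD(1)[OF H]
  note dims = carrier_matD[OF Hc] carrier_matD[OF C]
  show "mat_adjoint C * H * C \<in> carrier_mat m m" using dims by (intro carrier_matI) auto
  show "hermitian_mat (mat_adjoint C * H * C)"
    using dims pos_semidef_matD(2)[OF H]
    by (simp add: hermitian_mat_def mat_adjoint_mult_dim mult_mat_assoc_dim)
  fix z :: "complex vec" assume z: "z \<in> carrier_vec m"
  have Cz: "C *\<^sub>v z \<in> carrier_vec n" by (rule mult_mat_vec_carrier[OF C z])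
  have "(mat_adjoint C * H * C *\<^sub>v z) \<bullet>c z = (mat_adjoint C *\<^sub>v (H *\<^sub>v (C *\<^sub>v z))) \<bullet>c z"
    using dims z by (simp add: mult_mat_vec_assoc_dim)
  also have "\<dots> = (H *\<^sub>v (C *\<^sub>v z)) \<bullet>c (C *\<^sub>v z)"
    using cscalar_prod_adjoint[of "mat_adjoint C" m n "H *\<^sub>v (C *\<^sub>v z)" z] C z mult_mat_vec_carrier[OF Hc Cz] by simp
  finally show "Re ((mat_adjoint C * H * C *\<^sub>v z) \<bullet>c z) \<ge> 0"
    using pos_semidef_matD(3)[OF H Cz] by simp
qed

text \<open>
  Both matrices are Gram matrices with respect to one orthonormal basis: with \<open>G = M + N\<close>, the
  compression \<open>G\<^sup>-\<^sup>1\<^sup>/\<^sup>2 M G\<^sup>-\<^sup>1\<^sup>/\<^sup>2\<close> (a pseudo-inverse if \<open>G\<close> is singular) lies between 0 and 1,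
  and its eigenvalues are the \<open>s k\<close>. The last conclusion replaces the
  injectivity of \<open>B\<^sup>*\<close>, which fails in the singular case.
\<close>

lemma simultaneous_gram:
  assumes M: "pos_semidef_mat m M" and N: "pos_semidef_mat m N"
  obtains B s where "B \<in> carrier_mat m m" "\<And>k. k < m \<Longrightarrow> 0 \<le> s k \<and> s k \<le> (1::real)"
    "\<And>i j. i < m \<Longrightarrow> j < m \<Longrightarrow> M $$ (i,j) = (\<Sum>k<m. of_real (s k) * B $$ (k,j) * cnj (B $$ (k,i)))"
    "\<And>i j. i < m \<Longrightarrow> j < m \<Longrightarrow> N $$ (i,j) = (\<Sum>k<m. of_real (1 - s k) * B $$ (k,j) * cnj (B $$ (k,i)))"
    "\<And>y z. y \<in> carrier_vec m \<Longrightarrow> z \<in> carrier_vec m \<Longrightarrow>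
      mat_adjoint B *\<^sub>v (mat_diag m (\<lambda>k. of_real (s k)) *\<^sub>v (B *\<^sub>v y) + B *\<^sub>v z) = 0\<^sub>v m \<Longrightarrow>
      mat_diag m (\<lambda>k. of_real (s k)) *\<^sub>v (B *\<^sub>v y) + B *\<^sub>v z = 0\<^sub>v m"
proof -
  note Mc = pos_semidef_matD(1)[OF M] and Nc = pos_semidef_matD(1)[OF N]
  define G where "G = M + N"
  have Gc: "G \<in> carrier_mat m m" using Mc Nc by (simp add: G_def)
  have Gh: "hermitian_mat G"
    using mat_adjoint_add[OF Mc Nc] pos_semidef_matD(2)[OF M] pos_semidef_matD(2)[OF N]
    by (simp add: hermitian_mat_def G_def)
  obtain U g where U: "U \<in> carrier_mat m m" "U * mat_adjoint U = 1\<^sub>m m" "mat_adjoint U * U = 1\<^sub>m m"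
    and GU: "G = U * mat_diag m (\<lambda>i. complex_of_real (g i)) * mat_adjoint U"
    using hermitian_diagonalization[OF Gc Gh] by blast
  define Mp Np where "Mp = mat_adjoint U * M * U" and "Np = mat_adjoint U * N * U"
  have Mp: "pos_semidef_mat m Mp" and Np: "pos_semidef_mat m Np"
    unfolding Mp_def Np_def by (rule pos_semidef_mat_congruence[OF M U(1)], rule pos_semidef_mat_congruence[OF N U(1)])
  note Mpc = pos_semidef_matD(1)[OF Mp] and Npc = pos_semidef_matD(1)[OF Np]
  note dims0 = carrier_matD[OF Mc] carrier_matD[OF Nc] carrier_matD[OF U(1)] carrier_matD[OF Mpc] carrier_matD[OF Npc]
  define Dg2 where "Dg2 = mat_diag m (\<lambda>i. complex_of_real (g i))"
  have Dg2c: "Dg2 \<in> carrier_mat m m" by (simp add: Dg2_def)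
  have sum: "Mp + Np = Dg2"
  proof -
    have "Mp + Np = mat_adjoint U * (G * U)"
      unfolding Mp_def Np_def G_def using dims0 by (simp add: mat_algebra_dim)
    also have "\<dots> = Dg2"
      unfolding GU Dg2_def[symmetric] using dims0 carrier_matD[OF Dg2c] U(3)
      by (simp add: mat_algebra_dim mult_left_inverse_cancel[OF U(3)] right_mult_one_mat[OF Dg2c])
    finally show ?thesis .
  qed
  have diagsum: "Mp $$ (i,i) + Np $$ (i,i) = of_real (g i)" if "i < m" for i
    using arg_cong[OF sum, of "\<lambda>A. A $$ (i,i)"] that Mpc Npc by (simp add: Dg2_def mat_diag_def)
  have diagM: "Re (H $$ (i,i)) \<ge> 0 \<and> Im (H $$ (i,i)) = 0" if "pos_semidef_mat m H" "i < m" for H i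
  proof -
    note H = pos_semidef_matD[OF that(1)]
    have "(H *\<^sub>v unit_vec m i) \<bullet>c unit_vec m i = H $$ (i,i)"
      using that(2) H(1) by (simp add: cscalar_prod_unit_vec[where n=m] mat_mult_unit_vec[OF H(1)])
    thus ?thesis using H(3)[of "unit_vec m i"] hermitian_mat_index[OF H(2) H(1) that(2) that(2)]
      by (auto simp: complex_eq_iff)
  qed
  have g: "g i \<ge> 0" if "i < m" for i
    using diagsum[OF that] diagM[OF Mp that] diagM[OF Np that] by (auto simp: complex_eq_iff)
  \<comment> \<open>Where \<open>G\<close> has eigenvalue 0, the nonnegative diagonal entries of
    both summands vanish, and then so do the whole row and column.\<close>
  have Mp0: "Mp $$ (i,j) = 0" "Mp $$ (j,i) = 0" if "i < m" "j < m" "g i = 0" for i j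
  proof -
    have "Mp $$ (i,i) = 0"
      using diagsum[OF that(1)] diagM[OF Mp that(1)] diagM[OF Np that(1)] that(3) by (auto simp: complex_eq_iff)
    thus "Mp $$ (i,j) = 0" "Mp $$ (j,i) = 0"
      using pos_semidef_mat_zero_diag[OF Mp that(1,2)] by auto
  qed
  \<comment> \<open>Since \<open>1 / sqrt 0 = 0\<close>, \<open>Dr\<close> is the pseudo-inverse of
    \<open>Dg\<close> and no case distinction is made in the definition.\<close>
  define Dg Dr where "Dg = mat_diag m (\<lambda>i. complex_of_real (sqrt (g i)))"
    and "Dr = mat_diag m (\<lambda>i. complex_of_real (1 / sqrt (g i)))"
  have Dc: "Dg \<in> carrier_mat m m" "Dr \<in> carrier_mat m m" by (simp_all add: Dg_def Dr_def)
  have Dh: "mat_adjoint Dg = Dg" "mat_adjoint Dr = Dr" by (simp_all add: Dg_def Dr_def mat_adjoint_mat_diag)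
  have DgDg: "Dg * Dg = Dg2"
    unfolding Dg_def Dg2_def mat_diag_diag using g by (intro mat_diag_cong) (simp flip: of_real_mult)
  define S where "S = Dr * Mp * Dr"
  have S: "pos_semidef_mat m S" unfolding S_def using pos_semidef_mat_congruence[OF Mp Dc(2)] by (simp add: Dh)
  note Sc = pos_semidef_matD(1)[OF S] and Sh = pos_semidef_matD(2)[OF S]
  note dims = dims0 carrier_matD[OF Dc(1)] carrier_matD[OF Dc(2)] carrier_matD[OF Sc] carrier_matD[OF Dg2c]
  have Sij: "S $$ (i,j) = of_real (1 / sqrt (g i)) * (Mp $$ (i,j) * of_real (1 / sqrt (g j)))" if "i < m" "j < m" for i j
  proof -
    have "S = Dr * (Mp * Dr)" unfolding S_def using dims by (simp add: mult_mat_assoc_dim)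
    also have "Mp * Dr = mat m m (\<lambda>(i,j). Mp $$ (i,j) * of_real (1 / sqrt (g j)))"
      unfolding Dr_def by (rule mat_diag_mult_right[OF Mpc])
    also have "Dr * \<dots> = mat m m (\<lambda>(i,j). of_real (1 / sqrt (g i)) * mat m m (\<lambda>(i,j). Mp $$ (i,j) * of_real (1 / sqrt (g j))) $$ (i,j))"
      unfolding Dr_def by (rule mat_diag_mult_left) simp
    finally show ?thesis using that by simp
  qed
  have DSD: "Dg * S * Dg = Mp"
  proof (rule eq_matI)
    fix i j assume "i < dim_row Mp" "j < dim_col Mp"
    hence ij: "i < m" "j < m" using Mpc by auto
    have "Dg * S * Dg = Dg * (S * Dg)" using dims by (simp add: mult_mat_assoc_dim)
    also have "S * Dg = mat m m (\<lambda>(i,j). S $$ (i,j) * of_real (sqrt (g j)))"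
      unfolding Dg_def by (rule mat_diag_mult_right[OF Sc])
    also have "Dg * \<dots> = mat m m (\<lambda>(i,j). of_real (sqrt (g i)) * mat m m (\<lambda>(i,j). S $$ (i,j) * of_real (sqrt (g j))) $$ (i,j))"
      unfolding Dg_def by (rule mat_diag_mult_left) simp
    finally have "(Dg * S * Dg) $$ (i,j) = of_real (sqrt (g i)) * (S $$ (i,j) * of_real (sqrt (g j)))"
      using ij by simp
    also have "\<dots> = Mp $$ (i,j)"
    proof (cases "g i = 0 \<or> g j = 0")
      case True
      thus ?thesis using Mp0[of i j] Mp0[of j i] ij by auto
    next
      case False
      hence "sqrt (g i) \<noteq> 0" "sqrt (g j) \<noteq> 0" by auto
      thus ?thesis by (simp add: Sij[OF ij])
    qed
    finally show "(Dg * S * Dg) $$ (i,j) = Mp $$ (i,j)" .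
  qed (use dims in auto)
  obtain W s where W: "W \<in> carrier_mat m m" "W * mat_adjoint W = 1\<^sub>m m" "mat_adjoint W * W = 1\<^sub>m m"
    and SW: "S = W * mat_diag m (\<lambda>i. complex_of_real (s i)) * mat_adjoint W"
    using hermitian_diagonalization[OF Sc Sh] by blast
  \<comment> \<open>\<open>s k\<close> is the form of \<open>S\<close> at a unit eigenvector
    \<open>u\<close>, that is the form of \<open>Mp\<close> at \<open>y = Dr u\<close>. It is at
    most the form of \<open>Mp + Np\<close> there, which is the sum of
    \<open>\<bar>u_i\<bar>^2\<close> over the indices with \<open>g i\<close> nonzero.\<close>
  have s: "0 \<le> s k \<and> s k \<le> 1" if k: "k < m" for k
  proof -
    obtain u where u: "u \<in> carrier_vec m" "Re (u \<bullet>c u) = 1" "(S *\<^sub>v u) \<bullet>c u = of_real (s k)"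
      using diagonalization_unit_eigenvector[OF W(1,3) k] SW by metis
    have "0 \<le> s k" using pos_semidef_matD(3)[OF S u(1)] u(3) by simp
    define y where "y = Dr *\<^sub>v u"
    have y: "y \<in> carrier_vec m" unfolding y_def by (rule mult_mat_vec_carrier[OF Dc(2) u(1)])
    have yi: "y $ i = of_real (1 / sqrt (g i)) * u $ i" if "i < m" for i
      unfolding y_def Dr_def by (rule mat_diag_mult_vec_index[OF u(1) that])
    have "(S *\<^sub>v u) \<bullet>c u = (Dr *\<^sub>v (Mp *\<^sub>v y)) \<bullet>c u"
      unfolding S_def y_def using dims u by (simp add: mult_mat_vec_assoc_dim)
    also have "\<dots> = (Mp *\<^sub>v y) \<bullet>c y"
      using cscalar_prod_adjoint[OF Dc(2) mult_mat_vec_carrier[OF Mpc y] u(1)] by (simp add: Dh y_def)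
    finally have "s k = Re ((Mp *\<^sub>v y) \<bullet>c y)" using u(3) by (metis Re_complex_of_real)
    also have "\<dots> \<le> Re ((Mp *\<^sub>v y) \<bullet>c y) + Re ((Np *\<^sub>v y) \<bullet>c y)"
      using pos_semidef_matD(3)[OF Np y] by simp
    also have "\<dots> = Re ((Dg2 *\<^sub>v y) \<bullet>c y)"
      unfolding sum[symmetric] using add_mult_distrib_mat_vec[OF Mpc Npc y]
        cscalar_prod_left_add[OF mult_mat_vec_carrier[OF Mpc y] mult_mat_vec_carrier[OF Npc y] y] by simp
    also have "(Dg2 *\<^sub>v y) \<bullet>c y = (\<Sum>i<m. of_real (g i) * y $ i * cnj (y $ i))"
      unfolding cscalar_prod_sum[OF y] Dg2_def using y by (intro sum.cong refl) (simp del: index_mult_mat_vec)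
    also have "Re \<dots> = (\<Sum>i<m. g i * (cmod (y $ i))\<^sup>2)"
      by (simp add: mult.assoc complex_norm_square[symmetric] del: of_real_power)
    also have "\<dots> \<le> (\<Sum>i<m. (cmod (u $ i))\<^sup>2)"
    proof (rule sum_mono)
      fix i assume i: "i \<in> {..<m}"
      have "g i * (cmod (y $ i))\<^sup>2 = g i * (1 / sqrt (g i))\<^sup>2 * (cmod (u $ i))\<^sup>2"
        using i by (simp add: yi norm_mult norm_divide power_mult_distrib power_divide)
      also have "g i * (1 / sqrt (g i))\<^sup>2 \<le> 1" using g[of i] i by (simp add: power_divide)
      finally show "g i * (cmod (y $ i))\<^sup>2 \<le> (cmod (u $ i))\<^sup>2"
        by (simp add: mult_left_le_one_le mult_right_mono)
    qed
    also have "\<dots> = 1" using u(2) by (simp add: cscalar_prod_self[OF u(1)])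
    finally show ?thesis using \<open>0 \<le> s k\<close> by simp
  qed
  define Ds where "Ds = mat_diag m (\<lambda>k. complex_of_real (s k))"
  have Dsc: "Ds \<in> carrier_mat m m" by (simp add: Ds_def)
  \<comment> \<open>With this \<open>B\<close>, \<open>B^* B = G\<close> and
    \<open>B^* Ds B = M\<close>, so \<open>B^* (1 - Ds) B = N\<close>.\<close>
  define B where "B = mat_adjoint W * (Dg * mat_adjoint U)"
  have Bc: "B \<in> carrier_mat m m" unfolding B_def using dims carrier_matD[OF W(1)] by (intro carrier_matI) auto
  note dims' = dims carrier_matD[OF W(1)] carrier_matD[OF Bc] carrier_matD[OF Dsc]
  have Ba: "mat_adjoint B = U * (Dg * W)"
    unfolding B_def using dims' by (simp add: mat_adjoint_mult_dim Dh mult_mat_assoc_dim)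
  have WB: "W * B = Dg * mat_adjoint U"
    unfolding B_def using dims' by (intro mult_left_inverse_cancel[OF W(2)]) auto
  have WDB: "W * (Ds * B) = S * (Dg * mat_adjoint U)"
    unfolding B_def SW Ds_def[symmetric] using dims' by (simp add: mult_mat_assoc_dim)
  have UMU: "U * (Mp * mat_adjoint U) = M"
    unfolding Mp_def using dims' U(2)
    by (simp add: mult_mat_assoc_dim mult_left_inverse_cancel[OF U(2)] right_mult_one_mat[OF Mc])
  have "mat_adjoint B * (Ds * B) = U * (Dg * (W * (Ds * B)))"
    unfolding Ba using dims' by (simp add: mult_mat_assoc_dim)
  also have "\<dots> = U * ((Dg * S * Dg) * mat_adjoint U)"
    unfolding WDB using dims' by (simp add: mult_mat_assoc_dim)
  also have "\<dots> = M" unfolding DSD by (rule UMU)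
  finally have BDB: "mat_adjoint B * (Ds * B) = M" .
  have "mat_adjoint B * B = U * (Dg * (W * B))"
    unfolding Ba using dims' by (simp add: mult_mat_assoc_dim)
  also have "\<dots> = U * ((Dg * Dg) * mat_adjoint U)"
    unfolding WB using dims' by (simp add: mult_mat_assoc_dim)
  also have "\<dots> = G" unfolding DgDg GU Dg2_def[symmetric] using dims' by (simp add: mult_mat_assoc_dim)
  finally have BB: "mat_adjoint B * B = G" .
  show thesis
  proof (rule that[of B s])
    fix i j assume ij: "i < m" "j < m"
    have "M $$ (i,j) = (\<Sum>k<m. cnj (B $$ (k,i)) * (Ds * B) $$ (k,j))"
      unfolding BDB[symmetric] by (rule mat_adjoint_mult_index) (use Bc Dsc ij in auto)
    also have "\<dots> = (\<Sum>k<m. of_real (s k) * B $$ (k,j) * cnj (B $$ (k,i)))"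
      unfolding Ds_def mat_diag_mult_left[OF Bc] using ij by (intro sum.cong refl) simp
    finally show Meq: "M $$ (i,j) = (\<Sum>k<m. of_real (s k) * B $$ (k,j) * cnj (B $$ (k,i)))" .
    have "M $$ (i,j) + N $$ (i,j) = (\<Sum>k<m. cnj (B $$ (k,i)) * B $$ (k,j))"
      using arg_cong[OF BB, of "\<lambda>A. A $$ (i,j)"] mat_adjoint_mult_index[OF Bc Bc ij] Mc Nc ij
      by (simp add: G_def)
    thus "N $$ (i,j) = (\<Sum>k<m. of_real (1 - s k) * B $$ (k,j) * cnj (B $$ (k,i)))"
      unfolding Meq by (simp add: algebra_simps sum_subtractf)
  next
    fix y z :: "complex vec" assume yz: "y \<in> carrier_vec m" "z \<in> carrier_vec m"
    let ?d = "mat_diag m (\<lambda>k. of_real (s k)) *\<^sub>v (B *\<^sub>v y) + B *\<^sub>v z"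
    define \<delta> where "\<delta> = Ds *\<^sub>v (B *\<^sub>v y) + B *\<^sub>v z"
    assume "mat_adjoint B *\<^sub>v ?d = 0\<^sub>v m"
    hence B0: "mat_adjoint B *\<^sub>v \<delta> = 0\<^sub>v m" by (simp only: \<delta>_def Ds_def)
    have By: "B *\<^sub>v y \<in> carrier_vec m" "B *\<^sub>v z \<in> carrier_vec m" "Ds *\<^sub>v (B *\<^sub>v y) \<in> carrier_vec m"
      using mult_mat_vec_carrier[OF Bc yz(1)] mult_mat_vec_carrier[OF Bc yz(2)] mult_mat_vec_carrier[OF Dsc] by auto
    hence d: "\<delta> \<in> carrier_vec m" by (simp add: \<delta>_def)
    define p q where "p = Dg *\<^sub>v (mat_adjoint U *\<^sub>v y)" and "q = Dg *\<^sub>v (mat_adjoint U *\<^sub>v z)"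
    have Uy: "mat_adjoint U *\<^sub>v y \<in> carrier_vec m" "mat_adjoint U *\<^sub>v z \<in> carrier_vec m"
      using U(1) yz by (auto intro!: mult_mat_vec_carrier)
    have pq: "p \<in> carrier_vec m" "q \<in> carrier_vec m"
      unfolding p_def q_def by (rule mult_mat_vec_carrier[OF Dc(1) Uy(1)], rule mult_mat_vec_carrier[OF Dc(1) Uy(2)])
    \<comment> \<open>In the eigenbasis of \<open>G\<close> the vector becomes
      \<open>S p + q\<close>. Its coordinates with \<open>g i = 0\<close> vanish, because row
      \<open>i\<close> of \<open>S\<close> and entry \<open>i\<close> of \<open>q\<close> do; the
      others vanish because \<open>Dg\<close> maps the vector to 0 and is injective on them.\<close>
    have WD: "W *\<^sub>v \<delta> = S *\<^sub>v p + q"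
    proof -
      have "W *\<^sub>v \<delta> = W *\<^sub>v (Ds *\<^sub>v (B *\<^sub>v y)) + W *\<^sub>v (B *\<^sub>v z)"
        unfolding \<delta>_def by (rule mult_add_distrib_mat_vec[OF W(1) By(3) By(2)])
      also have "W *\<^sub>v (Ds *\<^sub>v (B *\<^sub>v y)) = (W * (Ds * B)) *\<^sub>v y"
        using dims' yz by (simp add: mult_mat_vec_assoc_dim)
      also have "\<dots> = S *\<^sub>v p" unfolding WDB p_def using dims' yz by (simp add: mult_mat_vec_assoc_dim)
      also have "W *\<^sub>v (B *\<^sub>v z) = (W * B) *\<^sub>v z" using dims' yz by (simp add: mult_mat_vec_assoc_dim)
      also have "\<dots> = q" unfolding WB q_def using dims' yz by (simp add: mult_mat_vec_assoc_dim)
      finally show ?thesis .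
    qed
    have Wd: "W *\<^sub>v \<delta> \<in> carrier_vec m" by (rule mult_mat_vec_carrier[OF W(1) d])
    have "Dg *\<^sub>v (W *\<^sub>v \<delta>) = mat_adjoint U *\<^sub>v (U *\<^sub>v (Dg *\<^sub>v (W *\<^sub>v \<delta>)))"
      using dims' by (intro mult_left_inverse_cancel_vec[OF U(3), symmetric]) auto
    also have "U *\<^sub>v (Dg *\<^sub>v (W *\<^sub>v \<delta>)) = mat_adjoint B *\<^sub>v \<delta>"
      unfolding Ba using dims' d by (simp add: mult_mat_vec_assoc_dim)
    also have "mat_adjoint U *\<^sub>v \<dots> = 0\<^sub>v m"
      unfolding B0 by (rule mult_mat_zero_vec) (use U in simp)
    finally have DW: "Dg *\<^sub>v (W *\<^sub>v \<delta>) = 0\<^sub>v m" .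
    have "(W *\<^sub>v \<delta>) $ i = 0" if i: "i < m" for i
    proof (cases "g i = 0")
      case True
      have q0: "q $ i = 0" unfolding q_def Dg_def using mat_diag_mult_vec_index[OF Uy(2) i] True by simp
      have "(S *\<^sub>v p) $ i = (\<Sum>j<m. S $$ (i,j) * p $ j)" by (rule mat_mult_vec_index_sum[OF Sc pq(1) i])
      also have "\<dots> = 0" using True i by (intro sum.neutral) (simp add: Sij)
      finally have Sp0: "(S *\<^sub>v p) $ i = 0" .
      have "(S *\<^sub>v p + q) $ i = (S *\<^sub>v p) $ i + q $ i" using pq i by (intro index_add_vec) auto
      thus ?thesis unfolding WD using q0 Sp0 by simp
    next
      case False
      have "of_real (sqrt (g i)) * (W *\<^sub>v \<delta>) $ i = (0\<^sub>v m :: complex vec) $ i"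
        unfolding DW[symmetric] Dg_def using mat_diag_mult_vec_index[OF Wd i] by simp
      thus ?thesis using False i by simp
    qed
    hence "W *\<^sub>v \<delta> = 0\<^sub>v m" using dims' by (intro eq_vecI) (auto simp del: index_mult_mat_vec)
    hence "\<delta> = mat_adjoint W *\<^sub>v 0\<^sub>v m"
      using mult_left_inverse_cancel_vec[OF W(3), of \<delta>] dims' d by simp
    also have "\<dots> = 0\<^sub>v m" by (rule mult_mat_zero_vec) (use W in simp)
    finally show "?d = 0\<^sub>v m" by (simp only: \<delta>_def Ds_def)
  qed (use Bc s in auto)
qed

text \<open>Divide the second kernel by \<open>x i * x j\<close> to get \<open>N\<close>. Then
  \<open>F i / x i = K i j + x j * N i j\<close> holds for every \<open>j\<close>, and the Gram
  representation turns it into \<open>(B^* v_j)_i\<close> with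
  \<open>v_j k = D k (x j) * B_kj\<close>. The left side is free of \<open>j\<close>, so
  \<open>B^*\<close> annihilates \<open>v_j - v_0\<close>, and the kernel conclusion gives
  \<open>v_j = v_0\<close>. Hence \<open>B_kj = v_0 k / D k (x j)\<close>, and inserting this at
  \<open>j = i\<close> is the claim.\<close>

theorem stieltjes_interpolation:
  fixes K :: "nat \<Rightarrow> nat \<Rightarrow> real" and x F :: "nat \<Rightarrow> real"
  assumes x: "\<And>i. i < m \<Longrightarrow> x i > 0"
    and sym: "\<And>i j. i < m \<Longrightarrow> j < m \<Longrightarrow> K i j = K j i"
    and sym': "\<And>i j. i < m \<Longrightarrow> j < m \<Longrightarrow> F i - x i * K i j = F j - x j * K j i"
    and psd: "\<And>v :: nat \<Rightarrow> real. 0 \<le> (\<Sum>i<m. \<Sum>j<m. K i j * (v i * v j))"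
    and psd': "\<And>v :: nat \<Rightarrow> real. 0 \<le> (\<Sum>i<m. \<Sum>j<m. (F i - x i * K i j) * (v i * v j))"
  obtains s w where "\<And>k. k < m \<Longrightarrow> 0 \<le> s k \<and> s k \<le> (1::real)" "\<And>k. k < m \<Longrightarrow> 0 \<le> (w k :: real)"
    "\<And>i. i < m \<Longrightarrow> F i = (\<Sum>k<m. w k * (x i / ((1 - s k) * x i + s k)))"
proof (cases "m = 0")
  case True
  thus thesis using that by simp
next
  case False
  hence m0: "0 < m" by simp
  define N where "N i j = (F i - x i * K i j) / (x i * x j)" for i j
  have psdN: "0 \<le> (\<Sum>i<m. \<Sum>j<m. N i j * (v i * v j))" for v
    using psd'[of "\<lambda>i. v i / x i"] by (simp add: N_def)
  have symN: "N i j = N j i" if "i < m" "j < m" for i j using sym'[OF that] by (simp add: N_def mult.commute)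
  show thesis
  proof (rule simultaneous_gram[OF pos_semidef_mat_of_real_kernel[OF sym psd] pos_semidef_mat_of_real_kernel[OF symN psdN]])
    fix B s
    assume B: "B \<in> carrier_mat m m" and s: "\<And>k. k < m \<Longrightarrow> 0 \<le> s k \<and> s k \<le> (1::real)"
      and K: "\<And>i j. i < m \<Longrightarrow> j < m \<Longrightarrow> mat m m (\<lambda>(i,j). complex_of_real (K i j)) $$ (i,j) =
        (\<Sum>k<m. of_real (s k) * B $$ (k,j) * cnj (B $$ (k,i)))"
      and N: "\<And>i j. i < m \<Longrightarrow> j < m \<Longrightarrow> mat m m (\<lambda>(i,j). complex_of_real (N i j)) $$ (i,j) =
        (\<Sum>k<m. of_real (1 - s k) * B $$ (k,j) * cnj (B $$ (k,i)))"
      and ker: "\<And>y z. y \<in> carrier_vec m \<Longrightarrow> z \<in> carrier_vec m \<Longrightarrow>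
        mat_adjoint B *\<^sub>v (mat_diag m (\<lambda>k. of_real (s k)) *\<^sub>v (B *\<^sub>v y) + B *\<^sub>v z) = 0\<^sub>v m \<Longrightarrow>
        mat_diag m (\<lambda>k. of_real (s k)) *\<^sub>v (B *\<^sub>v y) + B *\<^sub>v z = 0\<^sub>v m"
    define D where "D k t = (1 - s k) * t + s k" for k t
    have Dpos: "D k (x i) > 0" if "k < m" "i < m" for k i
    proof (cases "s k = 0")
      case False
      hence "s k > 0" using s[OF that(1)] by simp
      thus ?thesis unfolding D_def using s[OF that(1)] x[OF that(2)] by (intro add_nonneg_pos) auto
    qed (use x[OF that(2)] in \<open>simp add: D_def\<close>)
    define v where "v j k = of_real (D k (x j)) * B $$ (k,j)" for j k
    have F: "complex_of_real (F i / x i) = (\<Sum>k<m. v j k * cnj (B $$ (k,i)))" if ij: "i < m" "j < m" for i j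
    proof -
      have "F i / x i = K i j + x j * N i j"
        using x[OF ij(1)] x[OF ij(2)] by (simp add: N_def field_simps)
      hence "complex_of_real (F i / x i) = (\<Sum>k<m. of_real (s k) * B $$ (k,j) * cnj (B $$ (k,i))) +
          of_real (x j) * (\<Sum>k<m. of_real (1 - s k) * B $$ (k,j) * cnj (B $$ (k,i)))"
        using K[OF ij] N[OF ij] ij by simp
      also have "\<dots> = (\<Sum>k<m. v j k * cnj (B $$ (k,i)))"
        by (simp add: v_def D_def sum_distrib_left sum.distrib[symmetric] algebra_simps)
      finally show ?thesis .
    qed
    have v: "v j k = v 0 k" if j: "j < m" and k: "k < m" for j k
    proof -
      \<comment> \<open>Since \<open>D k t = s k * (1 - t) + t\<close>, the difference
        \<open>v_j - v_0\<close> is \<open>Ds B y + B z\<close> for these two vectors, the shape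
        that \<open>ker\<close> covers.\<close>
      define y where "y = complex_of_real (1 - x j) \<cdot>\<^sub>v unit_vec m j - of_real (1 - x 0) \<cdot>\<^sub>v unit_vec m 0"
      define z where "z = complex_of_real (x j) \<cdot>\<^sub>v unit_vec m j - of_real (x 0) \<cdot>\<^sub>v unit_vec m 0"
      have yz: "y \<in> carrier_vec m" "z \<in> carrier_vec m" by (simp_all add: y_def z_def)
      have Bl: "(B *\<^sub>v (a \<cdot>\<^sub>v unit_vec m j - b \<cdot>\<^sub>v unit_vec m 0)) $ k = a * B $$ (k,j) - b * B $$ (k,0)" if "k < m" for a b k
      proof -
        have "B *\<^sub>v (a \<cdot>\<^sub>v unit_vec m j - b \<cdot>\<^sub>v unit_vec m 0) = a \<cdot>\<^sub>v col B j - b \<cdot>\<^sub>v col B 0"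
          using j m0 by (simp add: mult_minus_distrib_mat_vec[OF B] mult_mat_vec[OF B] mat_mult_unit_vec[OF B])
        thus ?thesis using that j m0 B by (simp del: index_mult_mat_vec)
      qed
      let ?d = "mat_diag m (\<lambda>k. of_real (s k)) *\<^sub>v (B *\<^sub>v y) + B *\<^sub>v z"
      have By: "B *\<^sub>v y \<in> carrier_vec m" "B *\<^sub>v z \<in> carrier_vec m"
        by (rule mult_mat_vec_carrier[OF B yz(1)], rule mult_mat_vec_carrier[OF B yz(2)])
      have dc: "?d \<in> carrier_vec m" using By mult_mat_vec_carrier[OF mat_diag_dim By(1)] by simp
      have dk: "?d $ k = v j k - v 0 k" if "k < m" for k
      proof -
        have "?d $ k = (mat_diag m (\<lambda>k. of_real (s k)) *\<^sub>v (B *\<^sub>v y)) $ k + (B *\<^sub>v z) $ k"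
          by (rule index_add_vec) (use carrier_matD[OF B] that in auto)
        also have "\<dots> = of_real (s k) * (B *\<^sub>v y) $ k + (B *\<^sub>v z) $ k"
          using mat_diag_mult_vec_index[OF By(1) that] by simp
        also have "\<dots> = v j k - v 0 k"
          unfolding y_def z_def Bl[OF that] by (simp add: v_def D_def algebra_simps)
        finally show ?thesis .
      qed
      have "mat_adjoint B *\<^sub>v ?d = 0\<^sub>v m"
      proof (rule eq_vecI)
        fix i assume "i < dim_vec (0\<^sub>v m :: complex vec)"
        hence i: "i < m" by simp
        have Bac: "mat_adjoint B \<in> carrier_mat m m" using B by simp
        have "(mat_adjoint B *\<^sub>v ?d) $ i = (\<Sum>k<m. mat_adjoint B $$ (i,k) * ?d $ k)"
          by (rule mat_mult_vec_index_sum[OF Bac dc i])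
        also have "\<dots> = (\<Sum>k<m. v j k * cnj (B $$ (k,i)) - v 0 k * cnj (B $$ (k,i)))"
          using B i by (intro sum.cong refl) (simp add: dk algebra_simps del: index_add_vec index_mult_mat_vec)
        also have "\<dots> = 0" using F[OF i j] F[OF i m0] by (simp add: sum_subtractf)
        finally show "(mat_adjoint B *\<^sub>v ?d) $ i = 0\<^sub>v m $ i" using i by simp
      qed (use B in simp)
      from ker[OF yz this] have "?d $ k = 0" using k by simp
      thus ?thesis using dk[OF k] by simp
    qed
    \<comment> \<open>The weights are the squared moduli of the common vector
      \<open>v_0\<close>.\<close>
    show thesis
    proof (rule that[of s "\<lambda>k. (cmod (v 0 k))\<^sup>2"])
      fix i assume i: "i < m"
      have "complex_of_real (F i / x i) = (\<Sum>k<m. v i k * cnj (B $$ (k,i)))" by (rule F[OF i i])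
      also have "\<dots> = (\<Sum>k<m. of_real ((cmod (v 0 k))\<^sup>2 / D k (x i)))"
      proof (rule sum.cong[OF refl])
        fix k assume "k \<in> {..<m}"
        hence k: "k < m" by simp
        have "B $$ (k,i) = v i k / of_real (D k (x i))" using Dpos[OF k i] by (simp add: v_def)
        hence "v i k * cnj (B $$ (k,i)) = (v i k * cnj (v i k)) / of_real (D k (x i))" by simp
        also have "v i k * cnj (v i k) = of_real ((cmod (v i k))\<^sup>2)" by (simp only: complex_norm_square)
        finally show "v i k * cnj (B $$ (k,i)) = of_real ((cmod (v 0 k))\<^sup>2 / D k (x i))"
          using v[OF i k] by simp
      qed
      finally have "complex_of_real (F i / x i) = of_real (\<Sum>k<m. (cmod (v 0 k))\<^sup>2 / D k (x i))"
        by (simp only: of_real_sum)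
      hence "F i / x i = (\<Sum>k<m. (cmod (v 0 k))\<^sup>2 / D k (x i))" by (simp only: of_real_eq_iff)
      hence "F i = x i * (\<Sum>k<m. (cmod (v 0 k))\<^sup>2 / D k (x i))" using x[OF i] by (simp add: field_simps)
      thus "F i = (\<Sum>k<m. (cmod (v 0 k))\<^sup>2 * (x i / ((1 - s k) * x i + s k)))"
        by (simp add: D_def sum_distrib_left mult.commute)
    qed (use s in auto)
  qed
qed

section \<open>Approximation of the analytic extension\<close>

text \<open>The reciprocal is \<open>(1 - s) + s / z\<close>. The compact parameter interval
  contains the constant 1 at \<open>s = 0\<close> and the identity at \<open>s = 1\<close>, which
  the usual kernels \<open>z / (z + t)\<close> reach only as limits.\<close>

definition stieltjes_kernel :: "real \<Rightarrow> complex \<Rightarrow> complex" where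
  "stieltjes_kernel s z = z / (of_real (1 - s) * z + of_real s)"

text \<open>All kernels are 1 at the point 1, so total weight 1 is the normalization
  \<open>f 1 = 1\<close>; it makes the sums convex combinations.\<close>

definition unit_weights :: "nat \<Rightarrow> (nat \<Rightarrow> real) \<Rightarrow> (nat \<Rightarrow> real) \<Rightarrow> bool" where
  "unit_weights m s w \<longleftrightarrow> (\<forall>k<m. 0 \<le> s k \<and> s k \<le> 1 \<and> 0 \<le> w k) \<and> (\<Sum>k<m. w k) = 1"

definition stieltjes_sum :: "nat \<Rightarrow> (nat \<Rightarrow> real) \<Rightarrow> (nat \<Rightarrow> real) \<Rightarrow> complex \<Rightarrow> complex" where
  "stieltjes_sum m s w z = (\<Sum>k<m. of_real (w k) * stieltjes_kernel (s k) z)"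

text \<open>The only zero of the denominator is \<open>- s / (1 - s)\<close>, which lies on the
  slit.\<close>

lemma stieltjes_denominator_nonzero:
  assumes "0 \<le> s" "s \<le> 1" "z \<in> - \<real>\<^sub>\<le>\<^sub>0"
  shows "complex_of_real (1 - s) * z + of_real s \<noteq> 0"
proof
  assume eq: "complex_of_real (1 - s) * z + of_real s = 0"
  have im: "(1 - s) * Im z = 0" and re: "(1 - s) * Re z + s = 0"
    using arg_cong[OF eq, of Im] arg_cong[OF eq, of Re] by simp_all
  have s1: "s \<noteq> 1" using re by auto
  hence "Im z = 0" using im by simp
  moreover have "Re z \<le> 0"
  proof (rule ccontr)
    assume "\<not> Re z \<le> 0"
    hence "(1 - s) * Re z > 0" using assms s1 by (intro mult_pos_pos) auto
    thus False using re assms by simp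
  qed
  ultimately show False using assms(3) by (simp add: complex_nonpos_Reals_iff)
qed

lemma stieltjes_kernel_holomorphic:
  assumes "0 \<le> s" "s \<le> 1"
  shows "stieltjes_kernel s holomorphic_on (- \<real>\<^sub>\<le>\<^sub>0)"
  unfolding stieltjes_kernel_def [abs_def]
  using stieltjes_denominator_nonzero[OF assms] by (intro holomorphic_intros) auto

text \<open>The kernel is jointly continuous on the compact set \<open>{0..1} \<times> K\<close>, so
  the bound is uniform in \<open>s\<close>. It passes to all convex combinations and supplies the
  local boundedness for Montel's theorem.\<close>

lemma stieltjes_kernel_bounded:
  assumes "compact K" "K \<subseteq> - \<real>\<^sub>\<le>\<^sub>0"
  obtains B where "\<And>s z. 0 \<le> s \<Longrightarrow> s \<le> 1 \<Longrightarrow> z \<in> K \<Longrightarrow> cmod (stieltjes_kernel s z) \<le> B"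
proof -
  have "continuous_on ({0..1} \<times> K) (\<lambda>p. stieltjes_kernel (fst p) (snd p))"
    unfolding stieltjes_kernel_def
    by (intro continuous_intros) (use stieltjes_denominator_nonzero assms(2) in auto)
  hence "compact ((\<lambda>p. stieltjes_kernel (fst p) (snd p)) ` ({0..1} \<times> K))"
    by (rule compact_continuous_image) (intro compact_Times assms compact_Icc)
  hence "bounded ((\<lambda>p. stieltjes_kernel (fst p) (snd p)) ` ({0..1} \<times> K))"
    by (rule compact_imp_bounded)
  then obtain B where B: "\<And>p. p \<in> {0..1} \<times> K \<Longrightarrow> cmod (stieltjes_kernel (fst p) (snd p)) \<le> B"
    unfolding bounded_iff by blast
  show thesis by (rule that[of B]) (use B in force)
qed

lemma stieltjes_sum_bounded:
  assumes w: "unit_weights m s w" and B: "\<And>s. 0 \<le> s \<Longrightarrow> s \<le> 1 \<Longrightarrow> cmod (stieltjes_kernel s z) \<le> B"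
  shows "cmod (stieltjes_sum m s w z) \<le> B"
proof -
  have "cmod (stieltjes_sum m s w z) \<le> (\<Sum>k<m. w k * B)"
    unfolding stieltjes_sum_def
    by (rule sum_norm_le) (use w B in \<open>auto simp: unit_weights_def norm_mult intro!: mult_mono\<close>)
  thus ?thesis using w by (simp add: unit_weights_def flip: sum_distrib_right)
qed

lemma stieltjes_sum_holomorphic:
  assumes "unit_weights m s w"
  shows "stieltjes_sum m s w holomorphic_on (- \<real>\<^sub>\<le>\<^sub>0)"
  unfolding stieltjes_sum_def [abs_def]
  by (intro holomorphic_intros) (use assms in \<open>auto simp: unit_weights_def intro!: stieltjes_kernel_holomorphic\<close>)

text \<open>The grid has step \<open>1 / (n+1)!\<close> and ends at \<open>n + 1\<close>. The shift
  to \<open>Suc n\<close> guarantees that it contains the point 1, where the interpolation condition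
  reads that the weights add up to 1.\<close>

lemma stieltjes_sum_interpolation:
  assumes f: "\<And>x. x > 0 \<Longrightarrow> f x \<ge> 0" and conc: "matrix_concave f" and one: "f 1 = 1"
  shows "\<exists>m s w. unit_weights m s w \<and>
    (\<forall>i < Suc n * fact (Suc n). stieltjes_sum m s w (of_real (real (i + 1) / fact (Suc n))) = of_real (f (real (i + 1) / fact (Suc n))))"
proof -
  define N :: nat where "N = fact (Suc n)"
  define m where "m = Suc n * N"
  have N: "N > 0" by (simp add: N_def)
  define x where "x i = real (i + 1) / real N" for i
  have x: "x i > 0" for i using N by (simp add: x_def)
  have inj: "inj_on x {..<m}" using N by (auto simp: inj_on_def x_def)
  define K where "K d i j = (if i = j then d i else (f (x i) - f (x j)) / (x i - x j))" for d i j
  obtain d where K1: "\<And>v. 0 \<le> (\<Sum>i<m. \<Sum>j<m. K d i j * (v i * v j))"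
    and K2: "\<And>v. 0 \<le> (\<Sum>i<m. \<Sum>j<m. (if i = j then f (x i) - x i * d i
        else (x i * f (x j) - x j * f (x i)) / (x i - x j)) * (v i * v j))"
    using loewner_kernels[OF f conc x inj] unfolding K_def by blast
  have ne: "x i - x j \<noteq> 0" if "i \<noteq> j" for i j using N that by (auto simp: x_def)
  \<comment> \<open>The second Loewner kernel in the form in which the interpolation expects
    it.\<close>
  have K2': "(if i = j then f (x i) - x i * d i else (x i * f (x j) - x j * f (x i)) / (x i - x j)) =
      f (x i) - x i * K d i j" for i j
  proof (cases "i = j")
    case False
    define D where "D = x i - x j"
    have D: "D \<noteq> 0" "x i = x j + D" using ne[OF False] by (simp_all add: D_def)
    show ?thesis using False D(1) unfolding K_def D(2) by (simp add: field_simps)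
  qed (simp add: K_def)
  have sym: "K d i j = K d j i" for i j
    using ne[of i j] ne[of j i] by (auto simp: K_def field_simps)
  have sym': "f (x i) - x i * K d i j = f (x j) - x j * K d j i" for i j
  proof (cases "i = j")
    case False
    hence "(x i - x j) * K d i j = f (x i) - f (x j)" using ne[of i j] by (simp add: K_def)
    thus ?thesis unfolding sym[of j i] by (simp add: algebra_simps)
  qed simp
  obtain s w where sw: "\<And>k. k < m \<Longrightarrow> 0 \<le> s k \<and> s k \<le> (1::real)" "\<And>k. k < m \<Longrightarrow> 0 \<le> (w k :: real)"
    "\<And>i. i < m \<Longrightarrow> f (x i) = (\<Sum>k<m. w k * (x i / ((1 - s k) * x i + s k)))"
    using stieltjes_interpolation[OF x sym sym' K1 K2[unfolded K2']] by blast
  have val: "stieltjes_sum m s w (of_real (x i)) = of_real (f (x i))" if "i < m" for i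
    unfolding sw(3)[OF that] by (simp add: stieltjes_sum_def stieltjes_kernel_def)
  \<comment> \<open>Indices start at 0, so the grid point 1 has index \<open>N - 1\<close>.\<close>
  have "N - 1 < m"
    using N by (simp add: m_def)
  moreover have "x (N - 1) = 1" using N by (simp add: x_def of_nat_diff)
  ultimately have "1 = (\<Sum>k<m. w k)" using sw(3)[of "N - 1"] one by simp
  hence "unit_weights m s w" using sw by (auto simp: unit_weights_def)
  moreover have "\<forall>i < Suc n * fact (Suc n). stieltjes_sum m s w (of_real (real (i + 1) / fact (Suc n))) = of_real (f (real (i + 1) / fact (Suc n)))"
  proof (intro allI impI)
    fix i assume "i < Suc n * fact (Suc n)"
    hence "i < m" by (simp add: m_def N_def)
    from val[OF this] show "stieltjes_sum m s w (of_real (real (i + 1) / fact (Suc n))) = of_real (f (real (i + 1) / fact (Suc n)))"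
      by (simp only: x_def N_def of_nat_fact)
  qed
  ultimately show ?thesis by blast
qed

section \<open>Montel limit and identification of the analytic extension\<close>

lemma simply_connected_slit_plane:
  "simply_connected (- \<real>\<^sub>\<le>\<^sub>0 :: complex set)" "connected (- \<real>\<^sub>\<le>\<^sub>0 :: complex set)"
proof -
  have "(\<real>\<^sub>\<le>\<^sub>0 :: complex set) = complex_of_real ` {..0}" by (auto simp: nonpos_Reals_def)
  thus "simply_connected (- \<real>\<^sub>\<le>\<^sub>0 :: complex set)" "connected (- \<real>\<^sub>\<le>\<^sub>0 :: complex set)"
    using starlike_imp_simply_connected[OF starlike_slotted_complex_plane_left[of 0]]
      starlike_imp_connected[OF starlike_slotted_complex_plane_left[of 0]] by simp_all
qed

text \<open>Every positive rational lies on all but finitely many of the grids \<open>{1/n!, 2/n!, \<dots>, n}\<close>.\<close>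

theorem analytic_extension_approximation:
  assumes f: "\<And>x. x > 0 \<Longrightarrow> f x \<ge> 0" and conc: "matrix_concave f" and one: "f 1 = 1"
  obtains m s w where "\<And>N :: nat. unit_weights (m N) (s N) (w N)"
    "analytic_extension f holomorphic_on (- \<real>\<^sub>\<le>\<^sub>0)"
    "\<And>x. x > 0 \<Longrightarrow> analytic_extension f (of_real x) = of_real (f x)"
    "\<And>K. compact K \<Longrightarrow> K \<subseteq> - \<real>\<^sub>\<le>\<^sub>0 \<Longrightarrow>
      uniform_limit K (\<lambda>N. stieltjes_sum (m N) (s N) (w N)) (analytic_extension f) sequentially"
proof -
  have "\<forall>n. \<exists>m s w. unit_weights m s w \<and>
    (\<forall>i < Suc n * fact (Suc n). stieltjes_sum m s w (of_real (real (i + 1) / fact (Suc n))) = of_real (f (real (i + 1) / fact (Suc n))))"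
    using stieltjes_sum_interpolation[OF assms] by blast
  then obtain m s w where W: "\<And>n. unit_weights (m n) (s n) (w n)"
    and int: "\<And>n i. i < Suc n * fact (Suc n) \<Longrightarrow>
      stieltjes_sum (m n) (s n) (w n) (of_real (real (i + 1) / fact (Suc n))) = of_real (f (real (i + 1) / fact (Suc n)))"
    by metis
  define G where "G n = stieltjes_sum (m n) (s n) (w n)" for n
  have S: "open (- \<real>\<^sub>\<le>\<^sub>0 :: complex set)" by (simp add: open_Compl)
  obtain g r where g: "g holomorphic_on (- \<real>\<^sub>\<le>\<^sub>0)" "strict_mono (r :: nat \<Rightarrow> nat)"
    "\<And>x. x \<in> - \<real>\<^sub>\<le>\<^sub>0 \<Longrightarrow> ((\<lambda>n. G (r n) x) \<longlongrightarrow> g x) sequentially"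
    "\<And>K. \<lbrakk>compact K; K \<subseteq> - \<real>\<^sub>\<le>\<^sub>0\<rbrakk> \<Longrightarrow> uniform_limit K (G \<circ> r) g sequentially"
  proof (rule Montel[OF S, of "range G" G])
    show "h holomorphic_on (- \<real>\<^sub>\<le>\<^sub>0)" if "h \<in> range G" for h
      using that stieltjes_sum_holomorphic[OF W] by (auto simp: G_def)
    show "\<exists>B. \<forall>h\<in>range G. \<forall>z\<in>K. cmod (h z) \<le> B" if K: "compact K" "K \<subseteq> - \<real>\<^sub>\<le>\<^sub>0" for K
    proof -
      obtain B where "\<And>s z. 0 \<le> s \<Longrightarrow> s \<le> 1 \<Longrightarrow> z \<in> K \<Longrightarrow> cmod (stieltjes_kernel s z) \<le> B"
        using stieltjes_kernel_bounded[OF K] by blast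
      thus ?thesis unfolding G_def by (intro exI[of _ B]) (auto intro!: stieltjes_sum_bounded[OF W])
    qed
  qed auto
  have pos: "complex_of_real x \<in> - \<real>\<^sub>\<le>\<^sub>0" if "x > 0" for x
    using that by (simp add: complex_nonpos_Reals_iff)
  have rat: "g (of_real x) = of_real (f x)" if x: "x > 0" "x \<in> \<rat>" for x
  proof -
    obtain p q where pq: "p > 0" "q > 0" "x = real p / real q"
    proof -
      obtain a b where ab: "b \<noteq> 0" "\<bar>x\<bar> = real a / real b"
        using Rats_abs_nat_div_natE[OF x(2)] by metis
      hence "a > 0" using x by (cases a) auto
      thus thesis using that[of a b] ab x by simp
    qed
    have ev: "eventually (\<lambda>n. G n (of_real x) = of_real (f x)) sequentially"
      unfolding eventually_sequentially
    \<comment> \<open>From \<open>n \<ge> p + q\<close> on, \<open>q\<close> divides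
      \<open>(n+1)!\<close> and \<open>p / q\<close> does not exceed \<open>n + 1\<close>, so the
      rational is a grid point.\<close>
    proof (intro exI[of _ "p + q"] allI impI)
      fix n assume n: "p + q \<le> n"
      obtain t where t: "fact (Suc n) = q * t" using dvd_fact[of q "Suc n"] pq n by (auto simp: dvd_def)
      have t0: "t > 0" using t by (metis fact_nonzero mult_0_right not_gr_zero)
      define i where "i = p * t - 1"
      have i1: "i + 1 = p * t" using pq t0 by (simp add: i_def)
      have "i + 1 \<le> Suc n * fact (Suc n)"
        unfolding i1 t using n pq by (intro mult_le_mono) auto
      hence "i < Suc n * fact (Suc n)" by (rule less_le_trans[rotated]) simp
      moreover have "real (i + 1) / fact (Suc n) = x"
      proof -
        have "(fact (Suc n) :: real) = real (q * t)" using t by (metis of_nat_fact)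
        thus ?thesis unfolding i1 pq(3) using t0 pq by simp
      qed
      ultimately show "G n (of_real x) = of_real (f x)" using int[of i n] by (simp only: G_def)
    qed
    have "eventually (\<lambda>n. G (r n) (of_real x) = of_real (f x)) sequentially"
      using eventually_compose_filterlim[OF ev filterlim_subseq[OF g(2)]] .
    hence "((\<lambda>n. G (r n) (of_real x)) \<longlongrightarrow> of_real (f x)) sequentially"
      by (rule tendsto_eventually)
    with g(3)[OF pos[OF x(1)]] show ?thesis by (rule LIMSEQ_unique)
  qed
  \<comment> \<open>A concave function on an open interval is continuous, which extends the
    agreement of \<open>g\<close> and \<open>f\<close> from the rationals to all positive
    reals.\<close>
  have contf: "continuous_on {0<..} f"
  proof -
    have "continuous_on {0<..} (\<lambda>x. - f x)"
      using matrix_concave_imp_concave_on[OF conc] by (intro convex_on_continuous) (auto simp: concave_on_def)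
    hence "continuous_on {0<..} (\<lambda>x. - (- f x))" by (rule continuous_on_minus)
    thus ?thesis by simp
  qed
  have gf: "g (of_real x) = of_real (f x)" if x: "x > 0" for x
  proof -
    have "\<forall>n. \<exists>q. q \<in> \<rat> \<and> x < q \<and> q < x + inverse (real (Suc n))"
      using Rats_dense_in_real[of x "x + inverse (real (Suc _))"] by auto
    then obtain q where q: "\<And>n. q n \<in> \<rat>" "\<And>n. x < q n" "\<And>n. q n < x + inverse (real (Suc n))" by metis
    have qx: "q \<longlonglongrightarrow> x"
    proof (rule real_tendsto_sandwich[of "\<lambda>_. x" q sequentially "\<lambda>n. x + inverse (real (Suc n))"])
      show "(\<lambda>n. x + inverse (real (Suc n))) \<longlonglongrightarrow> x"
        using tendsto_add[OF tendsto_const LIMSEQ_inverse_real_of_nat, of x] by simp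
    qed (use q in \<open>auto intro!: always_eventually less_imp_le\<close>)
    have "continuous (at (of_real x)) g"
      using g(1) S pos[OF x] by (metis continuous_on_eq_continuous_at holomorphic_on_imp_continuous_on)
    hence "(\<lambda>n. g (of_real (q n))) \<longlonglongrightarrow> g (of_real x)"
      by (rule isCont_tendsto_compose) (intro tendsto_of_real qx)
    moreover have "isCont f x"
      using contf x by (simp add: continuous_on_eq_continuous_at)
    hence "(\<lambda>n. complex_of_real (f (q n))) \<longlonglongrightarrow> of_real (f x)"
      by (intro tendsto_of_real isCont_tendsto_compose[OF _ qx])
    moreover have "g (of_real (q n)) = of_real (f (q n))" for n
      using rat[of "q n"] q(1,2)[of n] x by auto
    ultimately show ?thesis by (metis (no_types, lifting) LIMSEQ_unique ext)
  qed
  \<comment> \<open>The limit \<open>g\<close> is a witness, so the \<open>SOME\<close> in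
    \<open>analytic_extension\<close> has the intended properties.\<close>
  have ae: "analytic_extension f holomorphic_on (- \<real>\<^sub>\<le>\<^sub>0) \<and> (\<forall>x>0. analytic_extension f (of_real x) = of_real (f x))"
    unfolding analytic_extension_def by (rule someI[of _ g]) (use g(1) gf in auto)
  \<comment> \<open>Identity theorem on the connected slit plane: the two functions agree on the
    positive axis, which accumulates at 1.\<close>
  have aeg: "analytic_extension f z = g z" if z: "z \<in> - \<real>\<^sub>\<le>\<^sub>0" for z
  proof -
    have lp: "1 islimpt (complex_of_real ` {0<..})"
    proof (unfold islimpt_approachable, intro allI impI)
      fix e :: real assume e: "e > 0"
      show "\<exists>x'\<in>complex_of_real ` {0<..}. x' \<noteq> 1 \<and> dist x' 1 < e"
      proof (intro bexI conjI)
        show "complex_of_real (1 + e / 2) \<in> complex_of_real ` {0<..}" using e by (intro imageI) simp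
      qed (use e in \<open>simp_all add: dist_norm\<close>)
    qed
    have "analytic_extension f z - g z = 0"
      by (rule analytic_continuation[of "\<lambda>z. analytic_extension f z - g z" "- \<real>\<^sub>\<le>\<^sub>0" "complex_of_real ` {0<..}" 1])
        (use ae g(1) S simply_connected_slit_plane(2) lp z gf pos in \<open>auto intro!: holomorphic_intros\<close>)
    thus ?thesis by simp
  qed
  show thesis
  proof (rule that[of "\<lambda>N. m (r N)" "\<lambda>N. s (r N)" "\<lambda>N. w (r N)"])
    fix K :: "complex set" assume K: "compact K" "K \<subseteq> - \<real>\<^sub>\<le>\<^sub>0"
    have "uniform_limit K (G \<circ> r) (analytic_extension f) sequentially \<longleftrightarrow> uniform_limit K (G \<circ> r) g sequentially"
      by (rule uniform_limit_cong') (use K aeg in auto)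
    thus "uniform_limit K (\<lambda>N. stieltjes_sum (m (r N)) (s (r N)) (w (r N))) (analytic_extension f) sequentially"
      using g(4)[OF K] by (simp add: G_def comp_def)
  qed (use W ae in auto)
qed

section \<open>Resolvents and the contour integral\<close>

lemma mat_inverse_nonsingular:
  fixes A :: "complex mat"
  assumes A: "A \<in> carrier_mat n n" and ker: "\<And>v. v \<in> carrier_vec n \<Longrightarrow> v \<noteq> 0\<^sub>v n \<Longrightarrow> A *\<^sub>v v \<noteq> 0\<^sub>v n"
  shows "det A \<noteq> 0" "the (mat_inverse A) \<in> carrier_mat n n"
    "A * the (mat_inverse A) = 1\<^sub>m n" "the (mat_inverse A) * A = 1\<^sub>m n"
proof -
  show d: "det A \<noteq> 0" using det_0_iff_vec_prod_zero_field[OF A] ker by blast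
  obtain B where "mat_inverse A = Some B"
  proof (cases "mat_inverse A")
    case None
    hence "A \<notin> Units (ring_mat TYPE(complex) n ())" by (rule mat_inverse(1)[OF A])
    thus thesis using det_non_zero_imp_unit[OF A d, of "()"] by blast
  qed (use that in auto)
  with mat_inverse(2)[OF A this] show "the (mat_inverse A) \<in> carrier_mat n n"
    "A * the (mat_inverse A) = 1\<^sub>m n" "the (mat_inverse A) * A = 1\<^sub>m n" by auto
qed

lemma inverse_mat_unique:
  fixes A :: "complex mat"
  assumes "A \<in> carrier_mat n n" "B \<in> carrier_mat n n" "C \<in> carrier_mat n n" "A * B = 1\<^sub>m n" "C * A = 1\<^sub>m n"
  shows "B = C"
proof -
  have "B = C * A * B" using assms by (simp add: left_mult_one_mat[OF assms(2)])
  also have "\<dots> = C * (A * B)" by (rule assoc_mult_square_mat[OF assms(3,1,2)])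
  finally show ?thesis using assms by (simp add: right_mult_one_mat[OF assms(3)])
qed

lemma smult_mat_mult_vec:
  fixes A :: "'a :: comm_semiring_0 mat"
  assumes A: "A \<in> carrier_mat n m" and v: "v \<in> carrier_vec m"
  shows "(c \<cdot>\<^sub>m A) *\<^sub>v v = c \<cdot>\<^sub>v (A *\<^sub>v v)"
proof (rule eq_vecI)
  fix i assume "i < dim_vec (c \<cdot>\<^sub>v (A *\<^sub>v v))"
  hence i: "i < n" using A by simp
  have "((c \<cdot>\<^sub>m A) *\<^sub>v v) $ i = (\<Sum>j<m. (c \<cdot>\<^sub>m A) $$ (i,j) * v $ j)"
    by (rule mat_mult_vec_index_sum[OF _ v i]) (use A in simp)
  also have "\<dots> = c * (\<Sum>j<m. A $$ (i,j) * v $ j)"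
    unfolding sum_distrib_left by (intro sum.cong refl) (use A i in \<open>simp add: mult.assoc\<close>)
  also have "(\<Sum>j<m. A $$ (i,j) * v $ j) = (A *\<^sub>v v) $ i"
    by (rule mat_mult_vec_index_sum[OF A v i, symmetric])
  finally show "((c \<cdot>\<^sub>m A) *\<^sub>v v) $ i = (c \<cdot>\<^sub>v (A *\<^sub>v v)) $ i" using A i by simp
qed (use A in simp)

lemma resolvent_mat:
  assumes X: "X \<in> carrier_mat n n" and z: "z \<notin> spectrum X"
  defines "A \<equiv> z \<cdot>\<^sub>m 1\<^sub>m n - X"
  shows "det A \<noteq> 0" "resolvent_mat X z \<in> carrier_mat n n"
    "A * resolvent_mat X z = 1\<^sub>m n" "resolvent_mat X z * A = 1\<^sub>m n"
proof -
  have A: "A \<in> carrier_mat n n" unfolding A_def using X by (intro minus_carrier_mat)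
  have ker: "A *\<^sub>v v \<noteq> 0\<^sub>v n" if v: "v \<in> carrier_vec n" "v \<noteq> 0\<^sub>v n" for v
  proof
    assume "A *\<^sub>v v = 0\<^sub>v n"
    moreover have "A *\<^sub>v v = z \<cdot>\<^sub>v v - X *\<^sub>v v"
      unfolding A_def using minus_mult_distrib_mat_vec[of "z \<cdot>\<^sub>m 1\<^sub>m n" n n X v] X v
      by (simp add: smult_mat_mult_vec[OF one_carrier_mat v(1)])
    ultimately have eq: "z \<cdot>\<^sub>v v - X *\<^sub>v v = 0\<^sub>v n" by simp
    have "X *\<^sub>v v = z \<cdot>\<^sub>v v"
    proof (rule eq_vecI)
      fix i assume "i < dim_vec (z \<cdot>\<^sub>v v)"
      hence i: "i < n" using v by simp
      have "(z \<cdot>\<^sub>v v - X *\<^sub>v v) $ i = 0" using eq i by simp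
      thus "(X *\<^sub>v v) $ i = (z \<cdot>\<^sub>v v) $ i" using i v X by simp
    qed (use X v in auto)
    hence "eigenvalue X z" using X v unfolding eigenvalue_def eigenvector_def by (intro exI[of _ v]) auto
    thus False using z by (simp add: spectrum_def)
  qed
  have R: "resolvent_mat X z = the (mat_inverse A)" using X by (simp add: resolvent_mat_def A_def)
  show "det A \<noteq> 0" "resolvent_mat X z \<in> carrier_mat n n"
    "A * resolvent_mat X z = 1\<^sub>m n" "resolvent_mat X z * A = 1\<^sub>m n"
    unfolding R by (rule mat_inverse_nonsingular[OF A ker]; assumption)+
qed

text \<open>By the Leibniz formula the determinant is a polynomial in the entries.\<close>

lemma holomorphic_on_det:
  assumes M: "\<And>z. z \<in> S \<Longrightarrow> M z \<in> carrier_mat n n"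
    and hol: "\<And>i j. i < n \<Longrightarrow> j < n \<Longrightarrow> (\<lambda>z. M z $$ (i,j)) holomorphic_on S"
  shows "(\<lambda>z. det (M z)) holomorphic_on S"
proof -
  have "(\<lambda>z. \<Sum>p\<in>{p. p permutes {0..<n}}. signof p * (\<Prod>i=0..<n. M z $$ (i, p i))) holomorphic_on S"
    by (intro holomorphic_intros hol) (auto simp: permutes_in_image)
  thus ?thesis by (rule holomorphic_transform) (simp add: det_def'[OF M])
qed

text \<open>Cramer's rule: the entry \<open>(i,j)\<close> is the signed minor with row
  \<open>j\<close> and column \<open>i\<close> deleted, divided by a determinant that vanishes only
  on the spectrum.\<close>

lemma resolvent_mat_holomorphic:
  assumes X: "X \<in> carrier_mat n n" and ij: "i < n" "j < n"
  shows "(\<lambda>z. resolvent_mat X z $$ (i,j)) holomorphic_on (- spectrum X)"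
proof -
  define A where "A z = z \<cdot>\<^sub>m 1\<^sub>m n - X" for z
  have A: "A z \<in> carrier_mat n n" for z unfolding A_def using X by (intro minus_carrier_mat)
  have ent: "A z $$ (k,l) = (if k = l then z else 0) - X $$ (k,l)" if "k < n" "l < n" for k l z
    using that X by (auto simp: A_def)
  have holA: "(\<lambda>z. A z $$ (k,l)) holomorphic_on UNIV" if "k < n" "l < n" for k l
    unfolding ent[OF that] by (cases "k = l") (auto intro!: holomorphic_intros)
  have holdet: "(\<lambda>z. det (A z)) holomorphic_on (- spectrum X)"
    by (rule holomorphic_on_det[OF A]) (use holA holomorphic_on_subset in blast)
  have "(\<lambda>z. det (mat_delete (A z) j i)) holomorphic_on (- spectrum X)"
  proof (rule holomorphic_on_det[where n = "n - 1"])
    show "mat_delete (A z) j i \<in> carrier_mat (n - 1) (n - 1)" for z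
      using A[of z] by (simp add: mat_delete_def)
    fix k l assume kl: "k < n - 1" "l < n - 1"
    have "mat_delete (A z) j i $$ (k,l) = A z $$ (if k < j then k else Suc k, if l < i then l else Suc l)" for z
      using A[of z] kl by (simp add: mat_delete_def)
    moreover have "(\<lambda>z. A z $$ (if k < j then k else Suc k, if l < i then l else Suc l)) holomorphic_on (- spectrum X)"
      by (rule holomorphic_on_subset[OF holA]) (use kl in auto)
    ultimately show "(\<lambda>z. mat_delete (A z) j i $$ (k,l)) holomorphic_on (- spectrum X)" by simp
  qed
  hence "(\<lambda>z. ((-1) ^ (j + i) * det (mat_delete (A z) j i)) / det (A z)) holomorphic_on (- spectrum X)"
    using resolvent_mat(1)[OF X] by (intro holomorphic_intros holdet) (auto simp: A_def)
  thus ?thesis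
  proof (rule holomorphic_transform)
    fix z assume "z \<in> - spectrum X"
    hence z: "z \<notin> spectrum X" by simp
    note R = resolvent_mat[OF X z, folded A_def]
    define C where "C = (1 / det (A z)) \<cdot>\<^sub>m adj_mat (A z)"
    have C: "C \<in> carrier_mat n n" using adj_mat(1)[OF A[of z]] by (simp add: C_def)
    have "A z * C = (1 / det (A z)) \<cdot>\<^sub>m (A z * adj_mat (A z))"
      unfolding C_def by (rule mult_smult_distrib[OF A adj_mat(1)[OF A]])
    also have "\<dots> = 1\<^sub>m n" unfolding adj_mat(2)[OF A] using R(1) by (intro eq_matI) auto
    finally have "resolvent_mat X z = C" using inverse_mat_unique[OF A C R(2) _ R(4)] by simp
    thus "((-1) ^ (j + i) * det (mat_delete (A z) j i)) / det (A z) = resolvent_mat X z $$ (i,j)"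
      using ij A[of z] by (simp add: C_def adj_mat_def cofactor_def)
  qed
qed

text \<open>From \<open>z R = 1 + X R\<close>, the largest entry modulus \<open>\<rho>\<close> of
  \<open>R\<close> satisfies \<open>(\<bar>z\<bar> - c) \<rho> <= 1\<close>, because
  \<open>c\<close> bounds the row sums of \<open>X\<close>. Then \<open>R - 1/z = X R / z\<close> is
  of order \<open>1 / \<bar>z\<bar>^2\<close>.\<close>

lemma resolvent_mat_decay:
  assumes X: "X \<in> carrier_mat n n"
  defines "c \<equiv> (\<Sum>i<n. \<Sum>j<n. cmod (X $$ (i,j)))"
  assumes z: "z \<notin> spectrum X" and large: "cmod z > c" and ij: "i < n" "j < n"
  shows "cmod (resolvent_mat X z $$ (i,j) - (if i = j then 1 / z else 0)) \<le> c / (cmod z * (cmod z - c))"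
proof -
  define R where "R = resolvent_mat X z"
  note Rp = resolvent_mat[OF X z, folded R_def]
  have c0: "c \<ge> 0" unfolding c_def by (intro sum_nonneg) auto
  have z0: "cmod z > 0" using large c0 by linarith
  have row: "(\<Sum>l<n. cmod (X $$ (k,l))) \<le> c" if "k < n" for k
    unfolding c_def using that by (intro member_le_sum[of k "{..<n}" "\<lambda>k. \<Sum>l<n. cmod (X $$ (k,l))"]) (auto intro: sum_nonneg)
  have eq: "z * R $$ (k,l) = (if k = l then 1 else 0) + (\<Sum>p<n. X $$ (k,p) * R $$ (p,l))" if kl: "k < n" "l < n" for k l
  proof -
    have "(z \<cdot>\<^sub>m 1\<^sub>m n - X) * R = z \<cdot>\<^sub>m R - X * R"
      using minus_mult_distrib_mat[of "z \<cdot>\<^sub>m 1\<^sub>m n" n n X R n] X Rp(2)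
      by (simp add: smult_mult_mat_dim left_mult_one_mat[OF Rp(2)])
    hence "(z \<cdot>\<^sub>m R - X * R) $$ (k,l) = 1\<^sub>m n $$ (k,l)" using Rp(3) by simp
    moreover have "(X * R) $$ (k,l) = (\<Sum>p<n. X $$ (k,p) * R $$ (p,l))"
      using X Rp(2) kl by (auto simp: scalar_prod_def atLeast0LessThan)
    ultimately show ?thesis using kl X Rp(2) by (simp add: algebra_simps del: index_mult_mat(1))
  qed
  define \<rho> where "\<rho> = Max ((\<lambda>(k,l). cmod (R $$ (k,l))) ` ({..<n} \<times> {..<n}))"
  have fin: "finite ((\<lambda>(k,l). cmod (R $$ (k,l))) ` ({..<n} \<times> {..<n}))" by simp
  have \<rho>: "cmod (R $$ (k,l)) \<le> \<rho>" if "k < n" "l < n" for k l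
    unfolding \<rho>_def by (rule Max_ge[OF fin]) (use that in force)
  have XR: "cmod (\<Sum>p<n. X $$ (k,p) * R $$ (p,l)) \<le> c * \<rho>" if kl: "k < n" "l < n" for k l
  proof -
    have "cmod (\<Sum>p<n. X $$ (k,p) * R $$ (p,l)) \<le> (\<Sum>p<n. cmod (X $$ (k,p)) * \<rho>)"
      by (rule sum_norm_le) (use \<rho> kl in \<open>auto simp: norm_mult intro!: mult_left_mono\<close>)
    also have "\<dots> \<le> c * \<rho>"
      unfolding sum_distrib_right[symmetric]
      by (intro mult_right_mono row kl order_trans[OF norm_ge_zero \<rho>[OF kl]])
    finally show ?thesis .
  qed
  have "\<rho> \<in> (\<lambda>(k,l). cmod (R $$ (k,l))) ` ({..<n} \<times> {..<n})"
    unfolding \<rho>_def by (rule Max_in[OF fin]) (use ij in auto)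
  then obtain k l where kl: "k < n" "l < n" "\<rho> = cmod (R $$ (k,l))" by auto
  have "cmod z * \<rho> = cmod (z * R $$ (k,l))" by (simp add: norm_mult kl)
  also have "\<dots> \<le> 1 + c * \<rho>"
    unfolding eq[OF kl(1,2)]
    by (rule order_trans[OF norm_triangle_ineq]) (use XR[OF kl(1,2)] in \<open>auto split: if_splits\<close>)
  finally have "(cmod z - c) * \<rho> \<le> 1" by (simp add: algebra_simps)
  hence \<rho>le: "\<rho> \<le> 1 / (cmod z - c)" using large by (simp add: field_simps)
  have zne: "z \<noteq> 0" using z0 by auto
  have "R $$ (i,j) - (if i = j then 1 / z else 0) = (\<Sum>p<n. X $$ (i,p) * R $$ (p,j)) / z"
    using eq[OF ij] zne by (auto simp: field_simps)
  hence "cmod (R $$ (i,j) - (if i = j then 1 / z else 0)) \<le> (c * \<rho>) / cmod z"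
    using XR[OF ij] z0 by (simp add: norm_divide divide_right_mono)
  also have "\<dots> \<le> (c * (1 / (cmod z - c))) / cmod z"
    using \<rho>le c0 by (intro divide_right_mono mult_left_mono) auto
  finally show ?thesis by (simp add: R_def mult.commute)
qed

text \<open>By the residue theorem only the winding numbers around the spectrum matter, so the
  contour may be exchanged for any large circle about 0. There the resolvent is \<open>1/z\<close>
  up to an error whose integral tends to 0 with growing radius.\<close>

lemma contour_integral_resolvent:
  assumes X: "X \<in> carrier_mat n n" and \<gamma>: "surrounding_contour X \<gamma>" and ij: "i < n" "j < n"
  shows "contour_integral \<gamma> (\<lambda>z. resolvent_mat X z $$ (i,j)) = (if i = j then 2 * of_real pi * \<i> else 0)"
proof -
  let ?f = "\<lambda>z. resolvent_mat X z $$ (i,j)"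
  define c where "c = (\<Sum>i<n. \<Sum>j<n. cmod (X $$ (i,j)))"
  have c0: "c \<ge> 0" unfolding c_def by (intro sum_nonneg) auto
  have fin: "finite (spectrum X)" using card_finite_spectrum[OF X] by simp
  have hol: "?f holomorphic_on (UNIV - spectrum X)"
    using resolvent_mat_holomorphic[OF X ij] by (simp add: Compl_eq_Diff_UNIV)
  have res: "contour_integral g ?f = 2 * pi * \<i> * (\<Sum>p\<in>spectrum X. residue ?f p)"
    if "valid_path g" "pathfinish g = pathstart g" "path_image g \<subseteq> - spectrum X"
      "\<forall>w\<in>spectrum X. winding_number g w = 1" for g
  proof -
    have "contour_integral g ?f = 2 * pi * \<i> * (\<Sum>p\<in>spectrum X. winding_number g p * residue ?f p)"
      by (rule Residue_theorem[OF open_UNIV connected_UNIV fin hol]) (use that in auto)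
    thus ?thesis using that(4) by simp
  qed
  obtain b where b: "\<And>w. w \<in> spectrum X \<Longrightarrow> cmod w \<le> b"
    using finite_imp_bounded[OF fin] by (auto simp: bounded_iff)
  define I where "I = contour_integral \<gamma> ?f"
  have bound: "cmod (I - (if i = j then 2 * of_real pi * \<i> else 0)) \<le> 2 * pi * (c / (r - c))"
    if r: "r > max (max b c) 1" for r
  proof -
    have nin: "z \<notin> spectrum X" if "cmod z = r" for z using b[of z] that r by auto
    have wn: "winding_number (circlepath 0 r) w = 1" if "w \<in> spectrum X" for w
      using b[OF that] r by (intro winding_number_circlepath) auto
    have pi: "path_image (circlepath 0 r) \<subseteq> - spectrum X" using nin r by auto
    have I: "contour_integral (circlepath 0 r) ?f = I"
      unfolding I_def by (subst (1 2) res) (use \<gamma> wn pi in \<open>auto simp: surrounding_contour_def\<close>)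
    have int: "?f contour_integrable_on (circlepath 0 r)"
      by (rule contour_integrable_holomorphic_simple[OF _ _ _ pi])
        (use resolvent_mat_holomorphic[OF X ij] fin in \<open>auto simp: open_Compl finite_imp_closed\<close>)
    have one: "((\<lambda>z. if i = j then 1 / z else 0) has_contour_integral (if i = j then 2 * of_real pi * \<i> else 0)) (circlepath 0 r)"
      using Cauchy_integral_circlepath_simple[of "\<lambda>_. 1" 0 r 0] r has_contour_integral_0 by auto
    have "((\<lambda>z. ?f z - (if i = j then 1 / z else 0)) has_contour_integral (I - (if i = j then 2 * of_real pi * \<i> else 0))) (circlepath 0 r)"
      using has_contour_integral_diff[OF has_contour_integral_integral[OF int] one] by (simp only: I)
    hence "cmod (I - (if i = j then 2 * of_real pi * \<i> else 0)) \<le> c / (r * (r - c)) * (2 * pi * r)"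
    proof (rule has_contour_integral_bound_circlepath)
      show "0 \<le> c / (r * (r - c))" using c0 r by simp
      fix z assume z: "cmod (z - 0) = r"
      show "cmod (?f z - (if i = j then 1 / z else 0)) \<le> c / (r * (r - c))"
        using resolvent_mat_decay[OF X nin _ ij, of z] z r by (simp add: c_def)
    qed (use r in auto)
    also have "\<dots> = 2 * pi * (c / (r - c))" using r by simp
    finally show ?thesis .
  qed
  \<comment> \<open>\<open>I\<close> does not depend on \<open>r\<close>, so the error bound may be
    taken to its limit.\<close>
  have "((\<lambda>r. 2 * pi * (c / (r - c))) \<longlongrightarrow> 2 * pi * 0) at_top"
    by (intro tendsto_intros real_tendsto_divide_at_top[OF tendsto_const])
      (rule filterlim_tendsto_add_at_top[OF tendsto_const filterlim_ident, of "- c", simplified])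
  moreover have "\<forall>\<^sub>F r in at_top. cmod (I - (if i = j then 2 * of_real pi * \<i> else 0)) \<le> 2 * pi * (c / (r - c))"
    using eventually_gt_at_top[of "max (max b c) 1"] by eventually_elim (rule bound)
  ultimately have "cmod (I - (if i = j then 2 * of_real pi * \<i> else 0)) \<le> 2 * pi * 0"
    by (rule tendsto_lowerbound) simp
  thus ?thesis by (simp add: I_def)
qed

text \<open>A compact part of the right half-plane lies in a disc with a far centre on the positive
  axis that still keeps a distance from the imaginary axis.\<close>

lemma surrounding_contour_exists:
  assumes X: "X \<in> carrier_mat n n" and spec: "\<And>w. w \<in> spectrum X \<Longrightarrow> Re w > 0"
  shows "\<exists>c r. r > 0 \<and> surrounding_contour X (circlepath c r)"
proof -
  have fin: "finite (spectrum X)" using card_finite_spectrum[OF X] by simp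
  define \<delta> where "\<delta> = Min (insert 1 (Re ` spectrum X))"
  have \<delta>: "\<delta> > 0" "\<And>w. w \<in> spectrum X \<Longrightarrow> \<delta> \<le> Re w" using fin spec by (auto simp: \<delta>_def)
  obtain b where b: "\<And>w. w \<in> spectrum X \<Longrightarrow> cmod w \<le> b"
    using finite_imp_bounded[OF fin] by (auto simp: bounded_iff)
  \<comment> \<open>For \<open>c \<ge> b^2 / \<delta>\<close> an eigenvalue \<open>w\<close>
    satisfies \<open>\<bar>w - c\<bar>^2 <= b^2 - 2 c \<delta> + c^2 <= c^2 - c \<delta> < (c -
    \<delta>/4)^2\<close>. The leftmost point of the circle is \<open>\<delta>/4\<close>; the
    maximum with \<open>\<delta>\<close> keeps the radius positive.\<close>
  define c where "c = max (b\<^sup>2 / \<delta>) \<delta>"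
  define r where "r = c - \<delta> / 4"
  have c: "c \<ge> \<delta>" "b\<^sup>2 \<le> c * \<delta>" using \<delta> by (simp_all add: c_def max_def field_simps)
  have r: "r > 0" using c \<delta> by (simp add: r_def)
  have inside: "cmod (w - of_real c) < r" if w: "w \<in> spectrum X" for w
  proof -
    have "(cmod (w - of_real c))\<^sup>2 = (cmod w)\<^sup>2 - 2 * c * Re w + c\<^sup>2"
      by (simp only: cmod_power2) (simp add: power2_eq_square algebra_simps)
    also have "(cmod w)\<^sup>2 \<le> b\<^sup>2" using b[OF w] by (intro power_mono) auto
    also have "c * \<delta> \<le> c * Re w" using \<delta>(2)[OF w] c \<delta>(1) by (intro mult_left_mono) auto
    hence "b\<^sup>2 - 2 * c * Re w + c\<^sup>2 \<le> c\<^sup>2 - c * \<delta>" using c(2) by linarith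
    also have "c\<^sup>2 - c * \<delta> < r\<^sup>2"
    proof -
      have "r\<^sup>2 - (c\<^sup>2 - c * \<delta>) = c * \<delta> / 2 + \<delta>\<^sup>2 / 16"
        by (simp add: r_def power2_eq_square algebra_simps)
      moreover have "c * \<delta> / 2 + \<delta>\<^sup>2 / 16 > 0"
        using c(1) \<delta>(1) by (intro add_pos_pos) auto
      ultimately show ?thesis by linarith
    qed
    finally show ?thesis using r by (simp add: power2_less_imp_less)
  qed
  have "path_image (circlepath (of_real c) r) \<subseteq> - \<real>\<^sub>\<le>\<^sub>0"
  proof
    fix z assume "z \<in> path_image (circlepath (of_real c) r)"
    hence "cmod (of_real c - z) = r" using r by (simp add: dist_norm)
    hence "c - Re z \<le> r" using complex_Re_le_cmod[of "of_real c - z"] by simp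
    hence "Re z > 0" using \<delta>(1) by (simp add: r_def)
    thus "z \<in> - \<real>\<^sub>\<le>\<^sub>0" by (simp add: complex_nonpos_Reals_iff)
  qed
  moreover have "path_image (circlepath (of_real c) r) \<inter> spectrum X = {}"
    using inside r by (force simp: dist_norm norm_minus_commute)
  ultimately have "surrounding_contour X (circlepath (of_real c) r)"
    using inside r unfolding surrounding_contour_def
    by (auto simp: simple_path_circlepath intro!: winding_number_circlepath)
  thus ?thesis using r by blast
qed

text \<open>A contour in the simply connected slit plane has winding number 0 about every point
  outside of it, so the residue theorem gives the same sum of residues for all surrounding contours.
  The \<open>SOME\<close> in \<open>matrix_fun\<close> may thus be replaced by a circle.\<close>

lemma surrounding_contour_independent:
  assumes X: "X \<in> carrier_mat n n" and ij: "i < n" "j < n" and F: "F holomorphic_on (- \<real>\<^sub>\<le>\<^sub>0)"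
    and \<gamma>: "surrounding_contour X \<gamma>" and \<gamma>': "surrounding_contour X \<gamma>'"
  shows "contour_integral \<gamma> (\<lambda>z. F z * resolvent_mat X z $$ (i,j)) =
    contour_integral \<gamma>' (\<lambda>z. F z * resolvent_mat X z $$ (i,j))"
proof -
  let ?f = "\<lambda>z. F z * resolvent_mat X z $$ (i,j)"
  have fin: "finite (spectrum X)" using card_finite_spectrum[OF X] by simp
  have hol: "?f holomorphic_on (- \<real>\<^sub>\<le>\<^sub>0 - spectrum X)"
    by (intro holomorphic_intros holomorphic_on_subset[OF F] holomorphic_on_subset[OF resolvent_mat_holomorphic[OF X ij]]) auto
  have "contour_integral g ?f = 2 * pi * \<i> * (\<Sum>p\<in>spectrum X. residue ?f p)" if g: "surrounding_contour X g" for g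
  proof -
    note g' = g[unfolded surrounding_contour_def]
    have "contour_integral g ?f = 2 * pi * \<i> * (\<Sum>p\<in>spectrum X. winding_number g p * residue ?f p)"
    proof (rule Residue_theorem[OF _ simply_connected_slit_plane(2) fin hol])
      show "\<forall>z. z \<notin> - \<real>\<^sub>\<le>\<^sub>0 \<longrightarrow> winding_number g z = 0"
        using simply_connected_imp_winding_number_zero[OF simply_connected_slit_plane(1), of g] g'
        by (auto intro: valid_path_imp_path)
    qed (use g' in \<open>auto simp: open_Compl\<close>)
    thus ?thesis using g' by simp
  qed
  from this[OF \<gamma>] this[OF \<gamma>'] show ?thesis by simp
qed

text \<open>\<open>f_s(X)\<close> by plain algebra, without a contour; the agreement with the
  contour integral is \<open>contour_integral_kernel_resolvent\<close>.\<close>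

definition stieltjes_mat :: "real \<Rightarrow> complex mat \<Rightarrow> complex mat" where
  "stieltjes_mat s X = X * the (mat_inverse (of_real (1 - s) \<cdot>\<^sub>m X + of_real s \<cdot>\<^sub>m 1\<^sub>m (dim_row X)))"

text \<open>A kernel vector of \<open>D\<close> would be an eigenvector of \<open>X\<close> with
  eigenvalue \<open>- s / (1 - s) <= 0\<close>. Being a polynomial in \<open>X\<close>,
  \<open>D\<close> commutes with \<open>X\<close>, hence so does its inverse; therefore
  \<open>f_s(X)\<close> can be written with the inverse on either side.\<close>

lemma stieltjes_denominator_mat:
  assumes X: "X \<in> carrier_mat n n" and spec: "\<And>w. w \<in> spectrum X \<Longrightarrow> Re w > 0" and s: "0 \<le> s" "s \<le> 1"
  defines "D \<equiv> complex_of_real (1 - s) \<cdot>\<^sub>m X + complex_of_real s \<cdot>\<^sub>m 1\<^sub>m n"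
  obtains E where "D \<in> carrier_mat n n" "E \<in> carrier_mat n n" "D * E = 1\<^sub>m n" "E * D = 1\<^sub>m n"
    "stieltjes_mat s X = X * E" "stieltjes_mat s X = E * X"
proof -
  have D: "D \<in> carrier_mat n n" using X by (simp add: D_def)
  have ker: "D *\<^sub>v v \<noteq> 0\<^sub>v n" if v: "v \<in> carrier_vec n" "v \<noteq> 0\<^sub>v n" for v
  proof
    assume "D *\<^sub>v v = 0\<^sub>v n"
    moreover have "D *\<^sub>v v = complex_of_real (1 - s) \<cdot>\<^sub>v (X *\<^sub>v v) + complex_of_real s \<cdot>\<^sub>v v"
      unfolding D_def using X v
      by (subst add_mult_distrib_mat_vec[of _ n n]) (simp_all add: smult_mat_mult_vec[OF X v(1)] smult_mat_mult_vec[OF one_carrier_mat v(1)])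
    ultimately have eq: "complex_of_real (1 - s) \<cdot>\<^sub>v (X *\<^sub>v v) + complex_of_real s \<cdot>\<^sub>v v = 0\<^sub>v n" by simp
    have ent: "complex_of_real (1 - s) * (X *\<^sub>v v) $ i + complex_of_real s * v $ i = 0" if "i < n" for i
    proof -
      have "(complex_of_real (1 - s) \<cdot>\<^sub>v (X *\<^sub>v v) + complex_of_real s \<cdot>\<^sub>v v) $ i = 0" using eq that by simp
      thus ?thesis using that X v by (simp del: index_mult_mat_vec)
    qed
    obtain k where k: "k < n" "v $ k \<noteq> 0" using v by (metis carrier_vecD eq_vecI index_zero_vec)
    have s1: "s \<noteq> 1" using ent[OF k(1)] k(2) by auto
    define w where "w = - complex_of_real (s / (1 - s))"
    have "X *\<^sub>v v = w \<cdot>\<^sub>v v"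
    proof (rule eq_vecI)
      fix i assume "i < dim_vec (w \<cdot>\<^sub>v v)"
      hence i: "i < n" using v by simp
      have "complex_of_real (1 - s) * (X *\<^sub>v v) $ i = - (complex_of_real s * v $ i)"
        using ent[OF i] by (simp add: add_eq_0_iff2)
      moreover have ne: "complex_of_real (1 - s) \<noteq> 0" using s1 by (simp only: of_real_eq_0_iff; simp)
      ultimately have "(X *\<^sub>v v) $ i = - (complex_of_real s * v $ i) / complex_of_real (1 - s)"
        by (metis nonzero_mult_div_cancel_left)
      also have "\<dots> = w * v $ i" by (simp add: w_def)
      finally show "(X *\<^sub>v v) $ i = (w \<cdot>\<^sub>v v) $ i" using i v by simp
    qed (use X v in auto)
    hence "eigenvalue X w" using X v unfolding eigenvalue_def eigenvector_def by (intro exI[of _ v]) auto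
    hence "Re w > 0" using spec by (simp add: spectrum_def)
    moreover have "Re w \<le> 0" using s s1 by (simp add: w_def)
    ultimately show False by simp
  qed
  define E where "E = the (mat_inverse D)"
  note E = mat_inverse_nonsingular(2-4)[OF D ker, folded E_def]
  have XD: "X * D = D * X"
    unfolding D_def using carrier_matD[OF X]
    by (simp add: mat_algebra_dim right_mult_one_mat[OF X] left_mult_one_mat[OF X])
  have "X * E = E * D * (X * E)" using E X by (simp add: left_mult_one_mat[OF mult_square_mat_carrier[OF X E(1)]])
  also have "\<dots> = E * (D * X) * E"
    using X D E(1) by (simp add: mult_mat_assoc_dim)
  also have "\<dots> = E * X * (D * E)"
    unfolding XD[symmetric] using X D E(1) by (simp add: mult_mat_assoc_dim)
  also have "\<dots> = E * X" using E X by (simp add: right_mult_one_mat[OF mult_square_mat_carrier[OF E(1) X]])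
  finally have comm: "X * E = E * X" .
  have T: "stieltjes_mat s X = X * E" using X by (simp add: stieltjes_mat_def E_def D_def)
  show thesis by (rule that[of E]) (use D E T comm in auto)
qed

text \<open>With \<open>d(z) = (1 - s) z + s\<close>, multiply
  \<open>z D = d(z) X + s (z - X)\<close> by \<open>D^-1\<close> on the left and by the resolvent
  \<open>R\<close> on the right, and divide by \<open>d(z)\<close>:
  \<open>f_s(z) R = f_s(X) R + (s / d(z)) D^-1\<close>. The last term is holomorphic in the slit
  plane and integrates to 0, and \<open>R\<close> integrates to \<open>2 \<pi> \<i>\<close> times
  the identity.\<close>

lemma contour_integral_kernel_resolvent:
  assumes X: "X \<in> carrier_mat n n" and spec: "\<And>w. w \<in> spectrum X \<Longrightarrow> Re w > 0" and s: "0 \<le> s" "s \<le> 1"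
    and \<gamma>: "surrounding_contour X \<gamma>" and ij: "i < n" "j < n"
  shows "((\<lambda>z. stieltjes_kernel s z * resolvent_mat X z $$ (i,j)) has_contour_integral
    2 * of_real pi * \<i> * stieltjes_mat s X $$ (i,j)) \<gamma>"
proof -
  define D where "D = complex_of_real (1 - s) \<cdot>\<^sub>m X + complex_of_real s \<cdot>\<^sub>m 1\<^sub>m n"
  obtain E where DE: "D \<in> carrier_mat n n" "E \<in> carrier_mat n n" "D * E = 1\<^sub>m n" "E * D = 1\<^sub>m n"
    and TE: "stieltjes_mat s X = X * E" "stieltjes_mat s X = E * X"
    using stieltjes_denominator_mat[OF X spec s] unfolding D_def by blast
  define T where "T = stieltjes_mat s X"
  have T: "T \<in> carrier_mat n n" using X DE by (simp add: T_def TE(1) mult_square_mat_carrier)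
  define d where "d z = complex_of_real (1 - s) * z + of_real s" for z
  note g = \<gamma>[unfolded surrounding_contour_def]
  have eq: "stieltjes_kernel s z * resolvent_mat X z $$ (i,j) =
      (\<Sum>l<n. T $$ (i,l) * resolvent_mat X z $$ (l,j)) + (of_real s / d z) * E $$ (i,j)"
    if z: "z \<in> - \<real>\<^sub>\<le>\<^sub>0 - spectrum X" for z
  proof -
    define R where "R = resolvent_mat X z"
    have zX: "z \<notin> spectrum X" using z by auto
    note R = resolvent_mat[OF X zX, folded R_def]
    define A where "A = z \<cdot>\<^sub>m 1\<^sub>m n - X"
    have A: "A \<in> carrier_mat n n" unfolding A_def by (rule minus_carrier_mat[OF X])
    have d0: "d z \<noteq> 0" using stieltjes_denominator_nonzero[OF s, of z] z by (simp add: d_def)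
    have lin: "z \<cdot>\<^sub>m D = d z \<cdot>\<^sub>m X + of_real s \<cdot>\<^sub>m A"
      using X by (intro eq_matI) (auto simp: D_def A_def d_def algebra_simps)
    have "z \<cdot>\<^sub>m R = E * (z \<cdot>\<^sub>m D) * R"
      using DE R(2) by (simp add: mult_smult_distrib[OF DE(2,1)] smult_mult_mat_dim left_mult_one_mat[OF R(2)])
    also have "\<dots> = d z \<cdot>\<^sub>m (E * X * R) + of_real s \<cdot>\<^sub>m (E * (A * R))"
      unfolding lin using carrier_matD[OF X] carrier_matD[OF A] carrier_matD[OF DE(2)] carrier_matD[OF R(2)]
      by (simp add: mat_algebra_dim)
    also have "A * R = 1\<^sub>m n" using R(3) by (simp add: A_def)
    also have "E * 1\<^sub>m n = E" by (rule right_mult_one_mat[OF DE(2)])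
    finally have "z \<cdot>\<^sub>m R = d z \<cdot>\<^sub>m (T * R) + of_real s \<cdot>\<^sub>m E" by (simp only: T_def TE(2))
    hence "(z \<cdot>\<^sub>m R) $$ (i,j) = (d z \<cdot>\<^sub>m (T * R) + of_real s \<cdot>\<^sub>m E) $$ (i,j)" by simp
    also have "\<dots> = d z * (T * R) $$ (i,j) + of_real s * E $$ (i,j)"
      using ij T R(2) DE(2) by (simp del: index_mult_mat(1))
    also have "(T * R) $$ (i,j) = (\<Sum>l<n. T $$ (i,l) * R $$ (l,j))"
      using T R(2) ij by (auto simp: scalar_prod_def atLeast0LessThan)
    finally have "z * R $$ (i,j) = d z * (\<Sum>l<n. T $$ (i,l) * R $$ (l,j)) + of_real s * E $$ (i,j)"
      using ij R(2) by simp
    hence "(z * R $$ (i,j)) / d z = (d z * (\<Sum>l<n. T $$ (i,l) * R $$ (l,j)) + of_real s * E $$ (i,j)) / d z" by simp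
    moreover have "stieltjes_kernel s z = z / d z" by (simp add: stieltjes_kernel_def d_def)
    ultimately show ?thesis using d0 by (simp add: add_divide_distrib R_def)
  qed
  have resint: "((\<lambda>z. resolvent_mat X z $$ (l,j)) has_contour_integral (if l = j then 2 * of_real pi * \<i> else 0)) \<gamma>"
    if l: "l < n" for l
  proof -
    have "(\<lambda>z. resolvent_mat X z $$ (l,j)) contour_integrable_on \<gamma>"
      by (rule contour_integrable_holomorphic_simple[OF resolvent_mat_holomorphic[OF X l ij(2)]])
        (use g card_finite_spectrum[OF X] in \<open>auto simp: open_Compl finite_imp_closed\<close>)
    from has_contour_integral_integral[OF this] show ?thesis
      by (simp only: contour_integral_resolvent[OF X \<gamma> l ij(2)])
  qed
  have "((\<lambda>z. of_real s / d z) has_contour_integral 0) \<gamma>"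
  proof (rule Cauchy_theorem_simply_connected[OF _ simply_connected_slit_plane(1)])
    show "(\<lambda>z. of_real s / d z) holomorphic_on (- \<real>\<^sub>\<le>\<^sub>0)"
      unfolding d_def using stieltjes_denominator_nonzero[OF s] by (intro holomorphic_intros) auto
  qed (use g in \<open>auto simp: open_Compl\<close>)
  hence "((\<lambda>z. (of_real s / d z) * E $$ (i,j)) has_contour_integral 0 * E $$ (i,j)) \<gamma>"
    by (rule has_contour_integral_rmul)
  moreover have "((\<lambda>z. \<Sum>l<n. T $$ (i,l) * resolvent_mat X z $$ (l,j)) has_contour_integral
      (\<Sum>l<n. T $$ (i,l) * (if l = j then 2 * of_real pi * \<i> else 0))) \<gamma>"
    by (intro has_contour_integral_sum has_contour_integral_lmul resint) auto
  ultimately have "((\<lambda>z. (\<Sum>l<n. T $$ (i,l) * resolvent_mat X z $$ (l,j)) + (of_real s / d z) * E $$ (i,j)) has_contour_integral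
      (\<Sum>l<n. T $$ (i,l) * (if l = j then 2 * of_real pi * \<i> else 0)) + 0 * E $$ (i,j)) \<gamma>"
    by (rule has_contour_integral_add[rotated])
  hence "((\<lambda>z. stieltjes_kernel s z * resolvent_mat X z $$ (i,j)) has_contour_integral
      (\<Sum>l<n. T $$ (i,l) * (if l = j then 2 * of_real pi * \<i> else 0)) + 0 * E $$ (i,j)) \<gamma>"
    by (rule has_contour_integral_eq) (use eq g in auto)
  moreover have "(\<Sum>l<n. T $$ (i,l) * (if l = j then 2 * of_real pi * \<i> else 0)) = T $$ (i,j) * (2 * of_real pi * \<i>)"
    using ij by (simp add: if_distrib cong: if_cong)
  ultimately show ?thesis by (simp add: T_def mult.commute)
qed

theorem matrix_fun_approximation:
  assumes X: "X \<in> carrier_mat n n" and spec: "\<And>w. w \<in> spectrum X \<Longrightarrow> Re w > 0" and ij: "i < n" "j < n"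
    and W: "\<And>N :: nat. unit_weights (m N) (s N) (w N)"
    and hol: "analytic_extension f holomorphic_on (- \<real>\<^sub>\<le>\<^sub>0)"
    and ul: "\<And>K. compact K \<Longrightarrow> K \<subseteq> - \<real>\<^sub>\<le>\<^sub>0 \<Longrightarrow>
      uniform_limit K (\<lambda>N. stieltjes_sum (m N) (s N) (w N)) (analytic_extension f) sequentially"
  shows "(\<lambda>N. \<Sum>k<m N. of_real (w N k) * stieltjes_mat (s N k) X $$ (i,j)) \<longlonglongrightarrow> matrix_fun f X $$ (i,j)"
proof -
  let ?R = "\<lambda>z. resolvent_mat X z $$ (i,j)"
  obtain c r where r: "r > 0" and C: "surrounding_contour X (circlepath c r)"
    using surrounding_contour_exists[OF X spec] by blast
  note g = C[unfolded surrounding_contour_def]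
  have sph: "sphere c r \<subseteq> - \<real>\<^sub>\<le>\<^sub>0" "sphere c r \<subseteq> - spectrum X" using g r by auto
  define \<gamma> where "\<gamma> = (SOME \<gamma>. surrounding_contour X \<gamma>)"
  have \<gamma>: "surrounding_contour X \<gamma>" unfolding \<gamma>_def by (rule someI[of "surrounding_contour X"]) (rule C)
  \<comment> \<open>The chosen contour is traded for a circle, a compact set on which the
    interpolants converge uniformly.\<close>
  have mf: "matrix_fun f X $$ (i,j) = 1 / (2 * of_real pi * \<i>) * contour_integral (circlepath c r) (\<lambda>z. analytic_extension f z * ?R z)"
    unfolding surrounding_contour_independent[OF X ij hol C \<gamma>]
    using X ij by (simp add: matrix_fun_def Let_def \<gamma>_def)
  have val: "((\<lambda>z. stieltjes_sum (m N) (s N) (w N) z * ?R z) has_contour_integral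
      (\<Sum>k<m N. of_real (w N k) * (2 * of_real pi * \<i> * stieltjes_mat (s N k) X $$ (i,j)))) (circlepath c r)" for N
    unfolding stieltjes_sum_def sum_distrib_right mult.assoc
    by (intro has_contour_integral_sum has_contour_integral_lmul
        contour_integral_kernel_resolvent[OF X spec _ _ C ij, unfolded mult.assoc])
      (use W[of N] in \<open>auto simp: unit_weights_def\<close>)
  have "(\<lambda>N. contour_integral (circlepath c r) (\<lambda>z. stieltjes_sum (m N) (s N) (w N) z * ?R z))
      \<longlonglongrightarrow> contour_integral (circlepath c r) (\<lambda>z. analytic_extension f z * ?R z)"
  proof (rule contour_integral_uniform_limit_circlepath)
    show "uniform_limit (sphere c r) (\<lambda>N z. stieltjes_sum (m N) (s N) (w N) z * ?R z) (\<lambda>z. analytic_extension f z * ?R z) sequentially"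
    proof (rule uniform_lim_mult[OF ul[OF compact_sphere sph(1)] uniform_limit_const])
      show "bounded (analytic_extension f ` sphere c r)"
        by (intro compact_imp_bounded compact_continuous_image compact_sphere
            holomorphic_on_imp_continuous_on holomorphic_on_subset[OF hol sph(1)])
      show "bounded (?R ` sphere c r)"
        by (intro compact_imp_bounded compact_continuous_image compact_sphere
            holomorphic_on_imp_continuous_on holomorphic_on_subset[OF resolvent_mat_holomorphic[OF X ij] sph(2)])
    qed
    show "\<forall>\<^sub>F N in sequentially. (\<lambda>z. stieltjes_sum (m N) (s N) (w N) z * ?R z) contour_integrable_on circlepath c r"
      using val unfolding contour_integrable_on_def by (intro always_eventually allI) blast
  qed (use r in auto)
  hence "(\<lambda>N. 1 / (2 * of_real pi * \<i>) * contour_integral (circlepath c r) (\<lambda>z. stieltjes_sum (m N) (s N) (w N) z * ?R z))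
      \<longlonglongrightarrow> matrix_fun f X $$ (i,j)"
    unfolding mf by (rule tendsto_mult_left)
  moreover have "1 / (2 * of_real pi * \<i>) * contour_integral (circlepath c r) (\<lambda>z. stieltjes_sum (m N) (s N) (w N) z * ?R z)
      = (\<Sum>k<m N. of_real (w N k) * stieltjes_mat (s N k) X $$ (i,j))" for N
    unfolding contour_integral_unique[OF val] sum_distrib_left by (intro sum.cong refl) (simp add: field_simps)
  ultimately show ?thesis by simp
qed

section \<open>Accretive matrices\<close>

lemma re_mat_carrier:
  assumes "A \<in> carrier_mat n n"
  shows "re_mat A \<in> carrier_mat n n" "hermitian_mat (re_mat A)"
proof -
  have A': "mat_adjoint A \<in> carrier_mat n n" using assms by simp
  show "re_mat A \<in> carrier_mat n n" using assms A' by (simp add: re_mat_def)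
  have "mat_adjoint (A + mat_adjoint A) = A + mat_adjoint A"
    unfolding mat_adjoint_add[OF assms A'] using assms A' by (simp add: comm_add_mat[of _ n n])
  thus "hermitian_mat (re_mat A)" by (simp add: hermitian_mat_def re_mat_def mat_adjoint_smult)
qed

lemma re_mat_quadratic_form:
  assumes A: "A \<in> carrier_mat n n" and x: "x \<in> carrier_vec n"
  shows "(re_mat A *\<^sub>v x) \<bullet>c x = of_real (Re ((A *\<^sub>v x) \<bullet>c x))"
proof -
  have A': "mat_adjoint A \<in> carrier_mat n n" using A by simp
  have Ax: "A *\<^sub>v x \<in> carrier_vec n" "mat_adjoint A *\<^sub>v x \<in> carrier_vec n"
    by (rule mult_mat_vec_carrier[OF A x], rule mult_mat_vec_carrier[OF A' x])
  have "re_mat A *\<^sub>v x = (1/2) \<cdot>\<^sub>v (A *\<^sub>v x + mat_adjoint A *\<^sub>v x)"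
    unfolding re_mat_def smult_mat_mult_vec[OF add_carrier_mat[OF A'] x]
    by (simp only: add_mult_distrib_mat_vec[OF A A' x])
  hence "(re_mat A *\<^sub>v x) \<bullet>c x = (1/2) * ((A *\<^sub>v x) \<bullet>c x + (mat_adjoint A *\<^sub>v x) \<bullet>c x)"
    using Ax x by (simp add: cscalar_prod_left_smult[where n=n] cscalar_prod_left_add[where n=n])
  also have "(mat_adjoint A *\<^sub>v x) \<bullet>c x = cnj ((A *\<^sub>v x) \<bullet>c x)"
    using cscalar_prod_adjoint[OF A x x] cscalar_prod_commute[OF x Ax(2)] by simp
  also have "(1/2) * ((A *\<^sub>v x) \<bullet>c x + cnj ((A *\<^sub>v x) \<bullet>c x)) = of_real (Re ((A *\<^sub>v x) \<bullet>c x))"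
    by (simp add: complex_add_cnj)
  finally show ?thesis .
qed

lemma accretive_matD:
  assumes "accretive_mat n A"
  shows "A \<in> carrier_mat n n" "\<And>x. x \<in> carrier_vec n \<Longrightarrow> x \<noteq> 0\<^sub>v n \<Longrightarrow> Re ((A *\<^sub>v x) \<bullet>c x) > 0"
proof -
  show A: "A \<in> carrier_mat n n" using assms by (simp add: accretive_mat_def)
  fix x :: "complex vec" assume x: "x \<in> carrier_vec n" "x \<noteq> 0\<^sub>v n"
  show "Re ((A *\<^sub>v x) \<bullet>c x) > 0"
    using assms x re_mat_quadratic_form[OF A x(1)] by (auto simp: accretive_mat_def pos_def_mat_def)
qed

lemma accretive_matI:
  assumes A: "A \<in> carrier_mat n n"
    and "\<And>x. x \<in> carrier_vec n \<Longrightarrow> x \<noteq> 0\<^sub>v n \<Longrightarrow> Re ((A *\<^sub>v x) \<bullet>c x) > 0"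
  shows "accretive_mat n A"
  using assms re_mat_carrier[OF A] re_mat_quadratic_form[OF A]
  by (auto simp: accretive_mat_def pos_def_mat_def)

text \<open>At an eigenvector the form is the eigenvalue times a positive number.\<close>

lemma accretive_mat_spectrum:
  assumes A: "accretive_mat n A" and w: "w \<in> spectrum A"
  shows "Re w > 0"
proof -
  note Ac = accretive_matD(1)[OF A]
  obtain v where v: "v \<in> carrier_vec n" "v \<noteq> 0\<^sub>v n" "A *\<^sub>v v = w \<cdot>\<^sub>v v"
    using w Ac by (auto simp: spectrum_def eigenvalue_def eigenvector_def)
  have "0 < Re ((A *\<^sub>v v) \<bullet>c v)" by (rule accretive_matD(2)[OF A v(1,2)])
  also have "(A *\<^sub>v v) \<bullet>c v = w * of_real (Re (v \<bullet>c v))"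
    using v cscalar_prod_self_nonneg(2)[OF v(1)]
    by (simp add: cscalar_prod_left_smult[where n=n] complex_eq_iff)
  finally show ?thesis using cscalar_prod_self_pos[OF v(1,2)] by (simp add: zero_less_mult_iff)
qed

text \<open>Normalizing \<open>x\<close> turns the condition on unit vectors into a homogeneous
  inequality that also holds at 0 and survives convex combinations of matrices.\<close>

lemma numerical_range_sector:
  assumes A: "A \<in> carrier_mat n n" and W: "numerical_range n A \<subseteq> sector \<alpha>" and x: "x \<in> carrier_vec n"
  shows "\<bar>Im ((A *\<^sub>v x) \<bullet>c x)\<bar> \<le> tan \<alpha> * Re ((A *\<^sub>v x) \<bullet>c x)"
proof (cases "x = 0\<^sub>v n")
  case True
  thus ?thesis by (simp add: mult_mat_zero_vec[OF A])
next
  case False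
  define r where "r = Re (x \<bullet>c x)"
  have r: "r > 0" unfolding r_def by (rule cscalar_prod_self_pos[OF x False])
  have xx: "x \<bullet>c x = of_real r" using cscalar_prod_self_nonneg(2)[OF x] by (simp add: r_def complex_eq_iff)
  define c where "c = complex_of_real (1 / sqrt r)"
  define y where "y = c \<cdot>\<^sub>v x"
  have y: "y \<in> carrier_vec n" using x by (simp add: y_def)
  have cc: "c * c * of_real r = 1" "c * c = of_real (1 / r)"
  proof -
    have "c * c = of_real ((1 / sqrt r) * (1 / sqrt r))" by (simp only: c_def of_real_mult)
    also have "(1 / sqrt r) * (1 / sqrt r) = 1 / r" using r by simp
    finally show "c * c = of_real (1 / r)" .
    thus "c * c * of_real r = 1" using r by simp
  qed
  have "y \<bullet>c y = c * c * (x \<bullet>c x)"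
    using x by (simp add: y_def cscalar_prod_left_smult[where n=n] cscalar_prod_right_smult[where n=n] c_def)
  hence "sqrt (Re (y \<bullet>c y)) = 1" using cc by (simp add: xx)
  hence "(A *\<^sub>v y) \<bullet>c y \<in> sector \<alpha>" using W y by (auto simp: numerical_range_def)
  moreover have "(A *\<^sub>v y) \<bullet>c y = c * c * ((A *\<^sub>v x) \<bullet>c x)"
    using x mult_mat_vec_carrier[OF A x]
    by (simp add: y_def mult_mat_vec[OF A x] cscalar_prod_left_smult[where n=n] cscalar_prod_right_smult[where n=n] c_def)
  ultimately have "\<bar>Im (of_real (1 / r) * ((A *\<^sub>v x) \<bullet>c x))\<bar> \<le> tan \<alpha> * Re (of_real (1 / r) * ((A *\<^sub>v x) \<bullet>c x))"
    unfolding cc(2) by (simp add: sector_def)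
  hence "\<bar>Im ((A *\<^sub>v x) \<bullet>c x)\<bar> / r \<le> tan \<alpha> * Re ((A *\<^sub>v x) \<bullet>c x) / r" using r by (simp add: abs_mult)
  thus ?thesis using r by (simp add: divide_le_cancel)
qed

lemma quadratic_form_combination:
  fixes A :: "complex mat"
  assumes A: "A \<in> carrier_mat n n" and u: "u \<in> carrier_vec n" and v: "v \<in> carrier_vec n"
  shows "(A *\<^sub>v (of_real a \<cdot>\<^sub>v u + of_real b \<cdot>\<^sub>v v)) \<bullet>c (of_real a \<cdot>\<^sub>v u + of_real b \<cdot>\<^sub>v v) =
    of_real (a\<^sup>2) * ((A *\<^sub>v u) \<bullet>c u) + of_real (a * b) * ((A *\<^sub>v u) \<bullet>c v + (A *\<^sub>v v) \<bullet>c u)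
    + of_real (b\<^sup>2) * ((A *\<^sub>v v) \<bullet>c v)"
proof -
  have Au: "A *\<^sub>v u \<in> carrier_vec n" and Av: "A *\<^sub>v v \<in> carrier_vec n"
    by (rule mult_mat_vec_carrier[OF A u], rule mult_mat_vec_carrier[OF A v])
  have "A *\<^sub>v (of_real a \<cdot>\<^sub>v u + of_real b \<cdot>\<^sub>v v) = of_real a \<cdot>\<^sub>v (A *\<^sub>v u) + of_real b \<cdot>\<^sub>v (A *\<^sub>v v)"
    using mult_add_distrib_mat_vec[OF A, of "of_real a \<cdot>\<^sub>v u" "of_real b \<cdot>\<^sub>v v"] u v
    by (simp add: mult_mat_vec[OF A u] mult_mat_vec[OF A v])
  thus ?thesis using u v Au Av
    by (simp add: cscalar_prod_algebra[where n=n] power2_eq_square algebra_simps)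
qed

lemma hermitian_form_commute:
  assumes "A \<in> carrier_mat n n" "hermitian_mat A" "u \<in> carrier_vec n" "v \<in> carrier_vec n"
  shows "(A *\<^sub>v v) \<bullet>c u = cnj ((A *\<^sub>v u) \<bullet>c v)"
  using cscalar_prod_adjoint[OF assms(1,4,3)] assms cscalar_prod_commute[OF mult_mat_vec_carrier[OF assms(1,3)] assms(4)]
  by (simp add: hermitian_mat_def)

lemma hermitian_form_combination:
  assumes A: "A \<in> carrier_mat n n" "hermitian_mat A" and u: "u \<in> carrier_vec n" and v: "v \<in> carrier_vec n"
  shows "Re ((A *\<^sub>v (of_real a \<cdot>\<^sub>v u + of_real b \<cdot>\<^sub>v v)) \<bullet>c (of_real a \<cdot>\<^sub>v u + of_real b \<cdot>\<^sub>v v)) =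
    a\<^sup>2 * Re ((A *\<^sub>v u) \<bullet>c u) + 2 * a * b * Re ((A *\<^sub>v u) \<bullet>c v) + b\<^sup>2 * Re ((A *\<^sub>v v) \<bullet>c v)"
  unfolding quadratic_form_combination[OF A(1) u v] hermitian_form_commute[OF A u v] by simp

text \<open>
  With \<open>H\<close> and \<open>K\<close> the real and imaginary parts of \<open>A\<close>, this bounds
  \<open>\<langle>A\<^sup>* H\<^sup>-\<^sup>1 A u, u\<rangle> = \<langle>H u, u\<rangle> + \<langle>K H\<^sup>-\<^sup>1 K u, u\<rangle>\<close>.
\<close>

lemma sectorial_form_bound:
  assumes A: "A \<in> carrier_mat n n" and pos: "\<And>x. x \<in> carrier_vec n \<Longrightarrow> 0 \<le> Re ((A *\<^sub>v x) \<bullet>c x)"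
    and sec: "\<And>x. x \<in> carrier_vec n \<Longrightarrow> \<bar>Im ((A *\<^sub>v x) \<bullet>c x)\<bar> \<le> \<tau> * Re ((A *\<^sub>v x) \<bullet>c x)" and \<tau>: "\<tau> \<ge> 0"
    and u: "u \<in> carrier_vec n" and y: "y \<in> carrier_vec n" and Hy: "re_mat A *\<^sub>v y = A *\<^sub>v u"
  shows "Re ((re_mat A *\<^sub>v y) \<bullet>c y) \<le> (1 + \<tau>\<^sup>2) * Re ((A *\<^sub>v u) \<bullet>c u)"
proof -
  define H where "H = re_mat A"
  note Hc = re_mat_carrier[OF A, folded H_def]
  have form: "Re ((H *\<^sub>v z) \<bullet>c z) = Re ((A *\<^sub>v z) \<bullet>c z)" if "z \<in> carrier_vec n" for z
    unfolding H_def by (simp add: re_mat_quadratic_form[OF A that])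
  have A': "mat_adjoint A \<in> carrier_mat n n" using A by simp
  define h where "h z = Re ((H *\<^sub>v z) \<bullet>c z)" for z
  \<comment> \<open>For \<open>A = H + i K\<close> this is \<open>e = i H^-1 K u\<close>, so
    \<open>h e\<close> is the form \<open><K H^-1 K u, u>\<close> to be bounded.\<close>
  define e where "e = y - u"
  have e: "e \<in> carrier_vec n" using u y by (simp add: e_def)
  have Hu: "H *\<^sub>v u \<in> carrier_vec n" and Au: "A *\<^sub>v u \<in> carrier_vec n"
    by (rule mult_mat_vec_carrier[OF Hc(1) u], rule mult_mat_vec_carrier[OF A u])
  have He: "H *\<^sub>v e = A *\<^sub>v u - H *\<^sub>v u"
    unfolding e_def mult_minus_distrib_mat_vec[OF Hc(1) y u] using Hy by (simp add: H_def)
  \<comment> \<open>\<open>w = H^-1 K u\<close>; the rotation by \<open>-\<i>\<close> turns the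
    cross term of \<open>u\<close> and \<open>w\<close> into a purely imaginary contribution of size
    \<open>2 * h e\<close>.\<close>
  define w where "w = - \<i> \<cdot>\<^sub>v e"
  have w: "w \<in> carrier_vec n" using e by (simp add: w_def)
  have Hew: "H *\<^sub>v e \<in> carrier_vec n" by (rule mult_mat_vec_carrier[OF Hc(1) e])
  have hw: "h w = h e"
    unfolding h_def w_def mult_mat_vec[OF Hc(1) e] using e Hew
    by (simp add: cscalar_prod_algebra[where n=n])
  have cross: "Im ((A *\<^sub>v u) \<bullet>c w + (A *\<^sub>v w) \<bullet>c u) = 2 * h e"
  proof -
    have Aw: "A *\<^sub>v w \<in> carrier_vec n" and Hw: "H *\<^sub>v w \<in> carrier_vec n"
      by (rule mult_mat_vec_carrier[OF A w], rule mult_mat_vec_carrier[OF Hc(1) w])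
    have A'u: "mat_adjoint A *\<^sub>v u \<in> carrier_vec n" by (rule mult_mat_vec_carrier[OF A' u])
    have "H *\<^sub>v u = (1/2) \<cdot>\<^sub>v (A *\<^sub>v u + mat_adjoint A *\<^sub>v u)"
      unfolding H_def re_mat_def smult_mat_mult_vec[OF add_carrier_mat[OF A'] u]
      by (simp only: add_mult_distrib_mat_vec[OF A A' u])
    hence Huw: "(H *\<^sub>v u) \<bullet>c w = (1/2) * ((A *\<^sub>v u) \<bullet>c w + (mat_adjoint A *\<^sub>v u) \<bullet>c w)"
      using Au A'u w by (simp add: cscalar_prod_algebra[where n=n])
    have "(A *\<^sub>v w) \<bullet>c u = cnj ((mat_adjoint A *\<^sub>v u) \<bullet>c w)"
      unfolding cscalar_prod_adjoint[OF A w u] by (rule cscalar_prod_commute[OF A'u w])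
    also have "(mat_adjoint A *\<^sub>v u) \<bullet>c w = 2 * ((H *\<^sub>v u) \<bullet>c w) - (A *\<^sub>v u) \<bullet>c w"
      unfolding Huw by (simp add: add_divide_distrib)
    finally have "Im ((A *\<^sub>v u) \<bullet>c w + (A *\<^sub>v w) \<bullet>c u) = 2 * Im ((A *\<^sub>v u) \<bullet>c w - (H *\<^sub>v u) \<bullet>c w)" by simp
    also have "(A *\<^sub>v u) \<bullet>c w - (H *\<^sub>v u) \<bullet>c w = (H *\<^sub>v e) \<bullet>c w"
      unfolding He using Au Hu w by (simp add: cscalar_prod_algebra[where n=n])
    also have "(H *\<^sub>v e) \<bullet>c w = \<i> * ((H *\<^sub>v e) \<bullet>c e)"
      unfolding w_def using Hew e by (simp add: cscalar_prod_algebra[where n=n])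
    also have "Im (\<i> * ((H *\<^sub>v e) \<bullet>c e)) = h e" by (simp add: h_def)
    finally show ?thesis .
  qed
  \<comment> \<open>The sector condition at \<open>c u + w\<close> and \<open>c u - w\<close>: in
    the difference of the imaginary parts only the cross terms survive, in the sum of the real parts
    only the squares.\<close>
  have key: "2 * c * h e \<le> \<tau> * (c\<^sup>2 * h u + h e)" for c :: real
  proof -
    have z: "of_real c \<cdot>\<^sub>v u + of_real b \<cdot>\<^sub>v w \<in> carrier_vec n" for b :: real using u w by simp
    have im: "Im ((A *\<^sub>v (of_real c \<cdot>\<^sub>v u + of_real b \<cdot>\<^sub>v w)) \<bullet>c (of_real c \<cdot>\<^sub>v u + of_real b \<cdot>\<^sub>v w)) =
        c\<^sup>2 * Im ((A *\<^sub>v u) \<bullet>c u) + c * b * (2 * h e) + b\<^sup>2 * Im ((A *\<^sub>v w) \<bullet>c w)" for b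
      unfolding quadratic_form_combination[OF A u w] cross[symmetric] by simp
    have re: "Re ((A *\<^sub>v (of_real c \<cdot>\<^sub>v u + of_real b \<cdot>\<^sub>v w)) \<bullet>c (of_real c \<cdot>\<^sub>v u + of_real b \<cdot>\<^sub>v w)) =
        c\<^sup>2 * h u + 2 * c * b * Re ((H *\<^sub>v u) \<bullet>c w) + b\<^sup>2 * h e" for b
      unfolding form[OF z, symmetric] hw[symmetric] unfolding h_def
      by (rule hermitian_form_combination[OF Hc u w])
    have "Im ((A *\<^sub>v (of_real c \<cdot>\<^sub>v u + of_real 1 \<cdot>\<^sub>v w)) \<bullet>c (of_real c \<cdot>\<^sub>v u + of_real 1 \<cdot>\<^sub>v w))
        - Im ((A *\<^sub>v (of_real c \<cdot>\<^sub>v u + of_real (-1) \<cdot>\<^sub>v w)) \<bullet>c (of_real c \<cdot>\<^sub>v u + of_real (-1) \<cdot>\<^sub>v w))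
      \<le> \<tau> * Re ((A *\<^sub>v (of_real c \<cdot>\<^sub>v u + of_real 1 \<cdot>\<^sub>v w)) \<bullet>c (of_real c \<cdot>\<^sub>v u + of_real 1 \<cdot>\<^sub>v w))
        + \<tau> * Re ((A *\<^sub>v (of_real c \<cdot>\<^sub>v u + of_real (-1) \<cdot>\<^sub>v w)) \<bullet>c (of_real c \<cdot>\<^sub>v u + of_real (-1) \<cdot>\<^sub>v w))"
      using sec[OF z, of 1] sec[OF z, of "-1"] by linarith
    thus ?thesis unfolding im re by (simp add: algebra_simps)
  qed
  have he0: "h e \<ge> 0" using pos[OF e] form[OF e] by (simp add: h_def)
  have hu: "h u = Re ((A *\<^sub>v u) \<bullet>c u)" using form[OF u] by (simp add: h_def)
  have hele: "h e \<le> \<tau>\<^sup>2 * h u"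
  proof (cases "\<tau> = 0")
    case True
    thus ?thesis using key[of 1] he0 by simp
  next
    case False
    hence t: "\<tau> > 0" using \<tau> by simp
    \<comment> \<open>The choice \<open>c = \<tau>\<close> balances both sides and gives
      \<open>h e <= \<tau>^2 h u\<close>.\<close>
    have "\<tau> * h e \<le> \<tau> * (\<tau>\<^sup>2 * h u)" using key[of \<tau>] by (simp add: algebra_simps)
    thus ?thesis using t by simp
  qed
  \<comment> \<open>Pythagoras: the real part of the cross term of \<open>u\<close> and
    \<open>e\<close> vanishes, because \<open>Re A = H\<close>.\<close>
  have "y = of_real 1 \<cdot>\<^sub>v u + of_real 1 \<cdot>\<^sub>v e" unfolding e_def using u y by (intro eq_vecI) auto
  hence "h y = h u + 2 * Re ((H *\<^sub>v u) \<bullet>c e) + h e"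
    unfolding h_def using hermitian_form_combination[OF Hc u e, of 1 1] by simp
  also have "Re ((H *\<^sub>v u) \<bullet>c e) = Re ((H *\<^sub>v e) \<bullet>c u)"
    using hermitian_form_commute[OF Hc u e] by simp
  also have "(H *\<^sub>v e) \<bullet>c u = (A *\<^sub>v u) \<bullet>c u - (H *\<^sub>v u) \<bullet>c u"
    unfolding He using Au Hu u by (simp add: cscalar_prod_algebra[where n=n])
  also have "Re \<dots> = 0" by (simp add: form[OF u])
  finally have "h y = h u + h e" by simp
  thus ?thesis using hele hu by (simp add: h_def H_def algebra_simps)
qed

lemma pos_def_re_mat:
  assumes "pos_def_mat n H"
  shows "re_mat H = H" "accretive_mat n H"
proof -
  note H = pos_def_matD[OF assms]
  show "re_mat H = H" using H(1,2) by (intro eq_matI) (auto simp: re_mat_def hermitian_mat_def)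
  thus "accretive_mat n H" using assms H(1) by (simp add: accretive_mat_def)
qed

text \<open>In the eigenbasis the map \<open>F\<close> from functions on the spectrum to matrices is
  multiplicative, so uniqueness of inverses identifies the inverse of the denominator.\<close>

lemma stieltjes_mat_pos_def:
  assumes X: "pos_def_mat n X" and s: "0 \<le> s" "s \<le> 1"
  shows "stieltjes_mat s X = spectral_fun (\<lambda>x. x / ((1 - s) * x + s)) X"
proof -
  note Xc = pos_def_matD(1)[OF X]
  obtain U d where U: "U \<in> carrier_mat n n" "U * mat_adjoint U = 1\<^sub>m n" "mat_adjoint U * U = 1\<^sub>m n"
    "X = U * mat_diag n (\<lambda>i. complex_of_real (d i)) * mat_adjoint U"
    "\<And>f. spectral_fun f X = U * mat_diag n (\<lambda>i. complex_of_real (f (d i))) * mat_adjoint U"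
    "\<And>i. i < n \<Longrightarrow> d i > 0"
    using spectral_fun_pos_def[OF X] by blast
  define F where "F h = U * mat_diag n (\<lambda>i. complex_of_real (h i)) * mat_adjoint U" for h
  have Fc: "F h \<in> carrier_mat n n" for h unfolding F_def using U(1) by (intro carrier_matI) auto
  have FF: "F g * F h = F (\<lambda>i. g i * h i)" for g h
  proof -
    have "F g * F h = U * (mat_diag n (\<lambda>i. complex_of_real (g i)) * mat_diag n (\<lambda>i. complex_of_real (h i))) * mat_adjoint U"
      unfolding F_def using carrier_matD[OF U(1)]
      by (simp add: mult_mat_assoc_dim mult_left_inverse_cancel[OF U(3)] del: mat_diag_diag)
    thus ?thesis by (simp add: F_def)
  qed
  have F1: "F (\<lambda>_. 1) = 1\<^sub>m n" using U(1,2) by (simp add: F_def right_mult_one_mat[OF U(1)])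
  have Fcong: "F g = F h" if "\<And>i. i < n \<Longrightarrow> g i = h i" for g h
    unfolding F_def using that by (simp cong: mat_diag_cong)
  define D where "D = complex_of_real (1 - s) \<cdot>\<^sub>m X + complex_of_real s \<cdot>\<^sub>m 1\<^sub>m n"
  have spec: "Re w > 0" if "w \<in> spectrum X" for w
    by (rule accretive_mat_spectrum[OF pos_def_re_mat(2)[OF X] that])
  obtain E where DE: "D \<in> carrier_mat n n" "E \<in> carrier_mat n n" "D * E = 1\<^sub>m n" "E * D = 1\<^sub>m n"
    and TE: "stieltjes_mat s X = X * E"
    using stieltjes_denominator_mat[OF Xc spec s] unfolding D_def by blast
  have DF: "D = F (\<lambda>i. (1 - s) * d i + s)"
  proof -
    have "D = U * (complex_of_real (1 - s) \<cdot>\<^sub>m mat_diag n (\<lambda>i. complex_of_real (d i)) + complex_of_real s \<cdot>\<^sub>m 1\<^sub>m n) * mat_adjoint U"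
      unfolding D_def U(4) using carrier_matD[OF U(1)] U(2)
      by (simp add: mat_algebra_dim right_mult_one_mat[OF U(1)])
    also have "complex_of_real (1 - s) \<cdot>\<^sub>m mat_diag n (\<lambda>i. complex_of_real (d i)) + complex_of_real s \<cdot>\<^sub>m 1\<^sub>m n =
        mat_diag n (\<lambda>i. complex_of_real ((1 - s) * d i + s))"
      by (intro eq_matI) (auto simp: mat_diag_def)
    finally show ?thesis by (simp only: F_def)
  qed
  have pos: "(1 - s) * d i + s > 0" if "i < n" for i
    using U(6)[OF that] s by (cases "s = 0") (auto intro: add_nonneg_pos)
  have "E = F (\<lambda>i. 1 / ((1 - s) * d i + s))"
  proof (rule inverse_mat_unique[OF DE(1,2) Fc DE(3)])
    show "F (\<lambda>i. 1 / ((1 - s) * d i + s)) * D = 1\<^sub>m n"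
      unfolding DF FF F1[symmetric] using less_imp_neq[OF pos] by (intro Fcong) force
  qed
  moreover have "X = F d" by (simp only: F_def U(4)[symmetric])
  ultimately show ?thesis unfolding TE U(5) using FF[of d "\<lambda>i. 1 / ((1 - s) * d i + s)"] by (simp add: F_def)
qed

text \<open>Substituting \<open>u = ((1 - s) A + s)^-1 x\<close> removes the inverse: both
  \<open>x\<close> and \<open>f_s(A) x\<close> become linear in \<open>u\<close>.\<close>

lemma stieltjes_mat_vec:
  assumes A: "accretive_mat n A" and s: "0 \<le> s" "s \<le> 1" and x: "x \<in> carrier_vec n"
  obtains u where "u \<in> carrier_vec n" "stieltjes_mat s A *\<^sub>v x = A *\<^sub>v u"
    "x = of_real (1 - s) \<cdot>\<^sub>v (A *\<^sub>v u) + of_real s \<cdot>\<^sub>v u"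
proof -
  note Ac = accretive_matD(1)[OF A]
  define D where "D = complex_of_real (1 - s) \<cdot>\<^sub>m A + complex_of_real s \<cdot>\<^sub>m 1\<^sub>m n"
  obtain E where DE: "D \<in> carrier_mat n n" "E \<in> carrier_mat n n" "D * E = 1\<^sub>m n"
    and TE: "stieltjes_mat s A = A * E"
    using stieltjes_denominator_mat[OF Ac accretive_mat_spectrum[OF A] s] unfolding D_def by blast
  show thesis
  proof (rule that[of "E *\<^sub>v x"])
    show u: "E *\<^sub>v x \<in> carrier_vec n" by (rule mult_mat_vec_carrier[OF DE(2) x])
    show "stieltjes_mat s A *\<^sub>v x = A *\<^sub>v (E *\<^sub>v x)" unfolding TE by (rule assoc_mult_mat_vec[OF Ac DE(2) x])
    have "x = D *\<^sub>v (E *\<^sub>v x)"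
      using DE x by (intro mult_left_inverse_cancel_vec[OF DE(3), symmetric]) auto
    also have "D *\<^sub>v (E *\<^sub>v x) = of_real (1 - s) \<cdot>\<^sub>v (A *\<^sub>v (E *\<^sub>v x)) + of_real s \<cdot>\<^sub>v (E *\<^sub>v x)"
      unfolding D_def using Ac u
      by (subst add_mult_distrib_mat_vec[of _ n n]) (simp_all add: smult_mat_mult_vec[OF Ac u] smult_mat_mult_vec[OF one_carrier_mat u])
    finally show "x = of_real (1 - s) \<cdot>\<^sub>v (A *\<^sub>v (E *\<^sub>v x)) + of_real s \<cdot>\<^sub>v (E *\<^sub>v x)" .
  qed
qed

text \<open>
  Writing \<open>x = (1 - s) g + s u\<close> with \<open>g = A u\<close> gives \<open>Re \<langle>f\<^sub>s(A) x, x\<rangle> = (1 - s) |g|\<^sup>2 + s \<langle>H u, u\<rangle>\<close>, and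
  \<open>\<langle>f\<^sub>s(H) x, x\<rangle>\<close> is the minimum of \<open>(1 - s) |p|\<^sup>2 + s \<langle>H q, q\<rangle>\<close> over all \<open>x = (1 - s) p + s q\<close>. The upper
  bound is the Cauchy-Schwarz inequality for the semi-inner product behind this expression.
\<close>

lemma stieltjes_mat_re_bounds:
  assumes A: "accretive_mat n A" and s: "0 \<le> s" "s \<le> 1" and x: "x \<in> carrier_vec n"
    and sec: "\<And>x. x \<in> carrier_vec n \<Longrightarrow> \<bar>Im ((A *\<^sub>v x) \<bullet>c x)\<bar> \<le> \<tau> * Re ((A *\<^sub>v x) \<bullet>c x)" and \<tau>: "\<tau> \<ge> 0"
  shows "Re ((stieltjes_mat s (re_mat A) *\<^sub>v x) \<bullet>c x) \<le> Re ((stieltjes_mat s A *\<^sub>v x) \<bullet>c x)"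
    "Re ((stieltjes_mat s A *\<^sub>v x) \<bullet>c x) \<le> (1 + \<tau>\<^sup>2) * Re ((stieltjes_mat s (re_mat A) *\<^sub>v x) \<bullet>c x)"
proof -
  note Ac = accretive_matD(1)[OF A]
  define H where "H = re_mat A"
  have H: "pos_def_mat n H" using A by (simp add: accretive_mat_def H_def)
  note Hc = pos_def_matD(1,2)[OF H] and Ha = pos_def_re_mat(2)[OF H]
  have Hnn: "0 \<le> Re ((H *\<^sub>v z) \<bullet>c z)" if "z \<in> carrier_vec n" for z
    using pos_def_matD(3)[OF H that] mult_mat_zero_vec[OF Hc(1)] by (cases "z = 0\<^sub>v n") auto
  have HA: "Re ((H *\<^sub>v z) \<bullet>c z) = Re ((A *\<^sub>v z) \<bullet>c z)" if "z \<in> carrier_vec n" for z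
    unfolding H_def by (simp add: re_mat_quadratic_form[OF Ac that])
  obtain u where u: "u \<in> carrier_vec n" "stieltjes_mat s A *\<^sub>v x = A *\<^sub>v u"
    "x = of_real (1 - s) \<cdot>\<^sub>v (A *\<^sub>v u) + of_real s \<cdot>\<^sub>v u"
    using stieltjes_mat_vec[OF A s x] by metis
  obtain q where q: "q \<in> carrier_vec n" "stieltjes_mat s H *\<^sub>v x = H *\<^sub>v q"
    "x = of_real (1 - s) \<cdot>\<^sub>v (H *\<^sub>v q) + of_real s \<cdot>\<^sub>v q"
    using stieltjes_mat_vec[OF Ha s x] by metis
  define g p where "g = A *\<^sub>v u" and "p = H *\<^sub>v q"
  have g: "g \<in> carrier_vec n" and p: "p \<in> carrier_vec n"
    unfolding g_def p_def by (rule mult_mat_vec_carrier[OF Ac u(1)], rule mult_mat_vec_carrier[OF Hc(1) q(1)])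
  define h where "h z = Re ((H *\<^sub>v z) \<bullet>c z)" for z
  define \<Phi> \<Psi> where "\<Phi> = Re (g \<bullet>c x)" and "\<Psi> = Re (p \<bullet>c x)"
  have xu: "Re (z \<bullet>c x) = (1 - s) * Re (z \<bullet>c g) + s * Re (z \<bullet>c u)"
    and xq: "Re (z \<bullet>c x) = (1 - s) * Re (z \<bullet>c p) + s * Re (z \<bullet>c q)" if "z \<in> carrier_vec n" for z
    using that g p u(1) q(1)
    by (subst u(3), simp add: cscalar_prod_algebra[where n=n] g_def[symmetric],
        subst q(3), simp add: cscalar_prod_algebra[where n=n] p_def[symmetric])
  have \<Phi>: "\<Phi> = (1 - s) * Re (g \<bullet>c g) + s * h u"
    unfolding \<Phi>_def xu[OF g] by (simp add: h_def HA[OF u(1)] g_def)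
  have \<Psi>: "\<Psi> = (1 - s) * Re (p \<bullet>c p) + s * h q"
    unfolding \<Psi>_def xq[OF p] by (simp add: h_def p_def)
  have sq: "0 \<le> a\<^sup>2 * Re (v \<bullet>c v) + 2 * a * b * Re (v \<bullet>c w) + b\<^sup>2 * Re (w \<bullet>c w)"
    if vw: "v \<in> carrier_vec n" "w \<in> carrier_vec n" for v w :: "complex vec" and a b
  proof -
    have "hermitian_mat (1\<^sub>m n)" by (simp add: hermitian_mat_def)
    from hermitian_form_combination[OF one_carrier_mat this vw, of a b]
    show ?thesis using vw cscalar_prod_self_nonneg(1)[of "of_real a \<cdot>\<^sub>v v + of_real b \<cdot>\<^sub>v w" n] by simp
  qed
  have hsq: "0 \<le> a\<^sup>2 * h v + 2 * a * b * Re ((H *\<^sub>v v) \<bullet>c w) + b\<^sup>2 * h w"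
    if vw: "v \<in> carrier_vec n" "w \<in> carrier_vec n" for v w :: "complex vec" and a b
    unfolding h_def hermitian_form_combination[OF Hc vw, symmetric]
    by (rule Hnn) (use vw in simp)
  \<comment> \<open>The semi-inner product at the pair \<open>(p - g, q - u)\<close>. As
    \<open>H q = p\<close>, its cross terms combine to the product of \<open>p\<close> with
    \<open>x\<close>, which is \<open>\<Psi>\<close>.\<close>
  have "0 \<le> (1 - s) * (1\<^sup>2 * Re (p \<bullet>c p) + 2 * 1 * (-1) * Re (p \<bullet>c g) + (-1)\<^sup>2 * Re (g \<bullet>c g))
      + s * (1\<^sup>2 * h q + 2 * 1 * (-1) * Re ((H *\<^sub>v q) \<bullet>c u) + (-1)\<^sup>2 * h u)"
    using s by (intro add_nonneg_nonneg mult_nonneg_nonneg sq hsq p g q u) auto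
  also have "\<dots> = \<Psi> + \<Phi> - 2 * ((1 - s) * Re (p \<bullet>c g) + s * Re (p \<bullet>c u))"
    unfolding \<Psi> \<Phi> p_def[symmetric] by (simp add: algebra_simps)
  also have "(1 - s) * Re (p \<bullet>c g) + s * Re (p \<bullet>c u) = \<Psi>" unfolding \<Psi>_def xu[OF p] ..
  finally have lower: "\<Psi> \<le> \<Phi>" by simp
  obtain Z Zi where Z: "Z \<in> carrier_mat n n" "Zi \<in> carrier_mat n n" "mat_adjoint Z * Z = H"
    "Z * Zi = 1\<^sub>m n" "Zi * Z = 1\<^sub>m n"
    using pos_def_mat_sqrt[OF H] by blast
  \<comment> \<open>\<open>y = H^-1 g\<close>. Paired with \<open>g\<close> it makes the cross terms
    in the upper bound combine to the product of \<open>g\<close> with \<open>x\<close>, which is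
    \<open>\<Phi>\<close>; \<open>u\<close> would not, since \<open>H u\<close> differs from
    \<open>g\<close>.\<close>
  define y where "y = Zi *\<^sub>v (mat_adjoint Zi *\<^sub>v g)"
  have Zig: "mat_adjoint Zi *\<^sub>v g \<in> carrier_vec n" by (rule mult_mat_vec_carrier[OF _ g]) (use Z in simp)
  have y: "y \<in> carrier_vec n" unfolding y_def by (rule mult_mat_vec_carrier[OF Z(2) Zig])
  have "mat_adjoint (Zi * Z) = mat_adjoint Z * mat_adjoint Zi" by (rule mat_adjoint_mult[OF Z(2,1)])
  hence ZZ: "mat_adjoint Z * mat_adjoint Zi = 1\<^sub>m n" using Z(5) by simp
  have Hy: "H *\<^sub>v y = g"
  proof -
    have "H *\<^sub>v y = mat_adjoint Z *\<^sub>v (Z *\<^sub>v y)"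
      unfolding Z(3)[symmetric] using Z(1) y by (simp add: mult_mat_vec_assoc_dim)
    also have "Z *\<^sub>v y = mat_adjoint Zi *\<^sub>v g"
      unfolding y_def using Z Zig by (intro mult_left_inverse_cancel_vec[OF Z(4)]) auto
    also have "mat_adjoint Z *\<^sub>v (mat_adjoint Zi *\<^sub>v g) = g"
      using Z g by (intro mult_left_inverse_cancel_vec[OF ZZ]) auto
    finally show ?thesis .
  qed
  have hy: "h y \<le> (1 + \<tau>\<^sup>2) * h u"
  proof -
    have "Re ((re_mat A *\<^sub>v y) \<bullet>c y) \<le> (1 + \<tau>\<^sup>2) * Re ((A *\<^sub>v u) \<bullet>c u)"
      by (rule sectorial_form_bound[OF Ac _ sec \<tau> u(1) y]) (use Hnn HA Hy in \<open>auto simp: H_def g_def\<close>)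
    thus ?thesis unfolding h_def HA[OF u(1)] unfolding H_def .
  qed
  define \<kappa> where "\<kappa> = 1 + \<tau>\<^sup>2"
  have \<kappa>: "\<kappa> \<ge> 1" by (simp add: \<kappa>_def)
  \<comment> \<open>The square of \<open>(g, y)\<close> is at most \<open>\<kappa> \<Phi>\<close>,
    so positivity at \<open>(l g - p, l y - q)\<close> gives
    \<open>0 <= l^2 \<kappa> \<Phi> - 2 l \<Phi> + \<Psi>\<close>; the minimizing \<open>l\<close>
    is \<open>1 / \<kappa>\<close>.\<close>
  define l where "l = 1 / \<kappa>"
  have "0 \<le> (1 - s) * (l\<^sup>2 * Re (g \<bullet>c g) + 2 * l * (-1) * Re (g \<bullet>c p) + (-1)\<^sup>2 * Re (p \<bullet>c p))
      + s * (l\<^sup>2 * h y + 2 * l * (-1) * Re ((H *\<^sub>v y) \<bullet>c q) + (-1)\<^sup>2 * h q)"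
    using s by (intro add_nonneg_nonneg mult_nonneg_nonneg sq hsq p g q y) auto
  also have "\<dots> = l\<^sup>2 * ((1 - s) * Re (g \<bullet>c g) + s * h y) - 2 * l * ((1 - s) * Re (g \<bullet>c p) + s * Re (g \<bullet>c q)) + \<Psi>"
    unfolding \<Psi> Hy by (simp add: algebra_simps)
  also have "(1 - s) * Re (g \<bullet>c p) + s * Re (g \<bullet>c q) = \<Phi>" unfolding \<Phi>_def xq[OF g] ..
  finally have a1: "0 \<le> l\<^sup>2 * ((1 - s) * Re (g \<bullet>c g) + s * h y) - 2 * l * \<Phi> + \<Psi>" .
  have "(1 - s) * Re (g \<bullet>c g) + s * h y \<le> \<kappa> * ((1 - s) * Re (g \<bullet>c g)) + s * (\<kappa> * h u)"
  proof (rule add_mono)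
    have "0 \<le> (1 - s) * Re (g \<bullet>c g)" using s cscalar_prod_self_nonneg(1)[OF g] by simp
    thus "(1 - s) * Re (g \<bullet>c g) \<le> \<kappa> * ((1 - s) * Re (g \<bullet>c g))"
      using mult_right_mono[OF \<kappa>] by fastforce
    show "s * h y \<le> s * (\<kappa> * h u)" using hy s by (intro mult_left_mono) (auto simp: \<kappa>_def)
  qed
  also have "\<dots> = \<kappa> * \<Phi>" unfolding \<Phi> by (simp add: algebra_simps)
  finally have "l\<^sup>2 * ((1 - s) * Re (g \<bullet>c g) + s * h y) \<le> l\<^sup>2 * (\<kappa> * \<Phi>)" by (rule mult_left_mono) simp
  also have "l\<^sup>2 * (\<kappa> * \<Phi>) = l * \<Phi>" using \<kappa> by (simp add: l_def power2_eq_square)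
  finally have "l * \<Phi> \<le> \<Psi>" using a1 by linarith
  hence upper: "\<Phi> \<le> \<kappa> * \<Psi>" using \<kappa> by (simp add: l_def field_simps)
  show "Re ((stieltjes_mat s (re_mat A) *\<^sub>v x) \<bullet>c x) \<le> Re ((stieltjes_mat s A *\<^sub>v x) \<bullet>c x)"
    "Re ((stieltjes_mat s A *\<^sub>v x) \<bullet>c x) \<le> (1 + \<tau>\<^sup>2) * Re ((stieltjes_mat s (re_mat A) *\<^sub>v x) \<bullet>c x)"
    using lower upper unfolding u(2) H_def[symmetric] q(2) \<Phi>_def \<Psi>_def g_def p_def \<kappa>_def by auto
qed

section \<open>Passage from the Stieltjes functions to f\<close>

lemma matrix_fun_carrier:
  "X \<in> carrier_mat n n \<Longrightarrow> matrix_fun f X \<in> carrier_mat n n"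
  by (simp add: matrix_fun_def Let_def)

lemma quadratic_form_entries:
  fixes M :: "complex mat"
  assumes "M \<in> carrier_mat n n" "x \<in> carrier_vec n"
  shows "(M *\<^sub>v x) \<bullet>c x = (\<Sum>i<n. \<Sum>j<n. M $$ (i,j) * (x $ j * cnj (x $ i)))"
  unfolding cscalar_prod_sum[OF assms(2)]
  by (intro sum.cong refl)
    (simp only: mat_mult_vec_index_sum[OF assms] lessThan_iff sum_distrib_right mult.assoc)

lemma stieltjes_mat_carrier:
  assumes A: "accretive_mat n A" and s: "0 \<le> s" "s \<le> 1"
  shows "stieltjes_mat s A \<in> carrier_mat n n"
  using stieltjes_denominator_mat[OF accretive_matD(1)[OF A] accretive_mat_spectrum[OF A] s]
    mult_square_mat_carrier accretive_matD(1)[OF A] by metis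

lemma matrix_fun_form_limit:
  assumes A: "accretive_mat n A" and x: "x \<in> carrier_vec n"
    and W: "\<And>N :: nat. unit_weights (m N) (s N) (w N)"
    and hol: "analytic_extension f holomorphic_on (- \<real>\<^sub>\<le>\<^sub>0)"
    and ul: "\<And>K. compact K \<Longrightarrow> K \<subseteq> - \<real>\<^sub>\<le>\<^sub>0 \<Longrightarrow>
      uniform_limit K (\<lambda>N. stieltjes_sum (m N) (s N) (w N)) (analytic_extension f) sequentially"
  shows "(\<lambda>N. \<Sum>k<m N. w N k * Re ((stieltjes_mat (s N k) A *\<^sub>v x) \<bullet>c x)) \<longlonglongrightarrow> Re ((matrix_fun f A *\<^sub>v x) \<bullet>c x)"
proof -
  note Ac = accretive_matD(1)[OF A]
  have "(\<lambda>N. \<Sum>i<n. \<Sum>j<n. (\<Sum>k<m N. of_real (w N k) * stieltjes_mat (s N k) A $$ (i,j)) * (x $ j * cnj (x $ i)))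
      \<longlonglongrightarrow> (\<Sum>i<n. \<Sum>j<n. matrix_fun f A $$ (i,j) * (x $ j * cnj (x $ i)))"
    by (intro tendsto_sum tendsto_mult_right matrix_fun_approximation[OF Ac accretive_mat_spectrum[OF A] _ _ W hol ul]) auto
  hence "(\<lambda>N. Re (\<Sum>i<n. \<Sum>j<n. (\<Sum>k<m N. of_real (w N k) * stieltjes_mat (s N k) A $$ (i,j)) * (x $ j * cnj (x $ i))))
      \<longlonglongrightarrow> Re ((matrix_fun f A *\<^sub>v x) \<bullet>c x)"
    unfolding quadratic_form_entries[OF matrix_fun_carrier[OF Ac] x] by (rule tendsto_Re)
  moreover have "Re (\<Sum>i<n. \<Sum>j<n. (\<Sum>k<m N. of_real (w N k) * stieltjes_mat (s N k) A $$ (i,j)) * (x $ j * cnj (x $ i))) =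
      (\<Sum>k<m N. w N k * Re ((stieltjes_mat (s N k) A *\<^sub>v x) \<bullet>c x))" for N
  proof -
    have sk: "stieltjes_mat (s N k) A \<in> carrier_mat n n" if "k < m N" for k
      by (rule stieltjes_mat_carrier[OF A]) (use W[of N] that in \<open>auto simp: unit_weights_def\<close>)
    have "(\<Sum>i<n. \<Sum>j<n. (\<Sum>k<m N. of_real (w N k) * stieltjes_mat (s N k) A $$ (i,j)) * (x $ j * cnj (x $ i))) =
        (\<Sum>i<n. \<Sum>j<n. \<Sum>k<m N. of_real (w N k) * (stieltjes_mat (s N k) A $$ (i,j) * (x $ j * cnj (x $ i))))"
      by (simp add: sum_distrib_right mult.assoc)
    also have "\<dots> = (\<Sum>i<n. \<Sum>k<m N. \<Sum>j<n. of_real (w N k) * (stieltjes_mat (s N k) A $$ (i,j) * (x $ j * cnj (x $ i))))"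
      by (intro sum.cong refl sum.swap)
    also have "\<dots> = (\<Sum>k<m N. \<Sum>i<n. \<Sum>j<n. of_real (w N k) * (stieltjes_mat (s N k) A $$ (i,j) * (x $ j * cnj (x $ i))))"
      by (rule sum.swap)
    also have "\<dots> = (\<Sum>k<m N. of_real (w N k) * ((stieltjes_mat (s N k) A *\<^sub>v x) \<bullet>c x))"
      by (intro sum.cong refl) (simp add: quadratic_form_entries[OF sk x] sum_distrib_left)
    finally show ?thesis by simp
  qed
  ultimately show ?thesis by simp
qed

text \<open>Only finitely many eigenvalues enter, so convergence of the interpolants at single
  points of the positive axis is enough.\<close>

lemma spectral_fun_form_limit:
  assumes X: "pos_def_mat n X" and x: "x \<in> carrier_vec n"
    and W: "\<And>N :: nat. unit_weights (m N) (s N) (w N)"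
    and ext: "\<And>x. x > 0 \<Longrightarrow> analytic_extension f (of_real x) = of_real (f x)"
    and ul: "\<And>K. compact K \<Longrightarrow> K \<subseteq> - \<real>\<^sub>\<le>\<^sub>0 \<Longrightarrow>
      uniform_limit K (\<lambda>N. stieltjes_sum (m N) (s N) (w N)) (analytic_extension f) sequentially"
  shows "(\<lambda>N. \<Sum>k<m N. w N k * Re ((stieltjes_mat (s N k) X *\<^sub>v x) \<bullet>c x)) \<longlonglongrightarrow> Re ((spectral_fun f X *\<^sub>v x) \<bullet>c x)"
proof -
  obtain d \<omega> where d: "\<And>i. i < n \<Longrightarrow> d i > 0"
    and form: "\<And>f. Re ((spectral_fun f X *\<^sub>v x) \<bullet>c x) = (\<Sum>i<n. f (d i) * \<omega> i)"
    using spectral_fun_quadratic_form[OF X x] by metis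
  have lim: "(\<lambda>N. \<Sum>k<m N. w N k * (t / ((1 - s N k) * t + s N k))) \<longlonglongrightarrow> f t" if t: "t > 0" for t
  proof -
    have "uniform_limit {complex_of_real t} (\<lambda>N. stieltjes_sum (m N) (s N) (w N)) (analytic_extension f) sequentially"
      by (rule ul) (use t in \<open>auto simp: complex_nonpos_Reals_iff\<close>)
    hence "(\<lambda>N. stieltjes_sum (m N) (s N) (w N) (of_real t)) \<longlonglongrightarrow> of_real (f t)"
      using ext[OF t] tendsto_uniform_limitI by fastforce
    moreover have "stieltjes_sum (m N) (s N) (w N) (of_real t) = of_real (\<Sum>k<m N. w N k * (t / ((1 - s N k) * t + s N k)))" for N
      by (simp add: stieltjes_sum_def stieltjes_kernel_def)
    ultimately show ?thesis by (simp only: tendsto_of_real_iff)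
  qed
  have "(\<lambda>N. \<Sum>i<n. (\<Sum>k<m N. w N k * (d i / ((1 - s N k) * d i + s N k))) * \<omega> i) \<longlonglongrightarrow> (\<Sum>i<n. f (d i) * \<omega> i)"
    by (intro tendsto_sum tendsto_mult_right lim d) auto
  moreover have "(\<Sum>k<m N. w N k * Re ((stieltjes_mat (s N k) X *\<^sub>v x) \<bullet>c x)) =
      (\<Sum>i<n. (\<Sum>k<m N. w N k * (d i / ((1 - s N k) * d i + s N k))) * \<omega> i)" for N
  proof -
    have "(\<Sum>k<m N. w N k * Re ((stieltjes_mat (s N k) X *\<^sub>v x) \<bullet>c x)) =
        (\<Sum>k<m N. \<Sum>i<n. w N k * (d i / ((1 - s N k) * d i + s N k)) * \<omega> i)"
    proof (intro sum.cong refl)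
      fix k assume "k \<in> {..<m N}"
      hence "0 \<le> s N k" "s N k \<le> 1" using W[of N] by (auto simp: unit_weights_def)
      from stieltjes_mat_pos_def[OF X this]
      show "w N k * Re ((stieltjes_mat (s N k) X *\<^sub>v x) \<bullet>c x) = (\<Sum>i<n. w N k * (d i / ((1 - s N k) * d i + s N k)) * \<omega> i)"
        by (simp only: form sum_distrib_left mult.assoc)
    qed
    thus ?thesis by (subst (asm) sum.swap) (simp only: sum_distrib_right)
  qed
  ultimately show ?thesis by (simp only: form)
qed

text \<open>The same nodes and weights approximate \<open>f(A)\<close> through the contour integral
  and \<open>f(Re A)\<close> through the spectral calculus. The bounds therefore hold term by term,
  as the weights are nonnegative, and pass to the limit.\<close>

lemma matrix_fun_re_bounds:
  assumes A: "accretive_mat n A" and x: "x \<in> carrier_vec n"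
    and sec: "\<And>x. x \<in> carrier_vec n \<Longrightarrow> \<bar>Im ((A *\<^sub>v x) \<bullet>c x)\<bar> \<le> \<tau> * Re ((A *\<^sub>v x) \<bullet>c x)" and \<tau>: "\<tau> \<ge> 0"
    and W: "\<And>N :: nat. unit_weights (m N) (s N) (w N)"
    and hol: "analytic_extension f holomorphic_on (- \<real>\<^sub>\<le>\<^sub>0)"
    and ext: "\<And>x. x > 0 \<Longrightarrow> analytic_extension f (of_real x) = of_real (f x)"
    and ul: "\<And>K. compact K \<Longrightarrow> K \<subseteq> - \<real>\<^sub>\<le>\<^sub>0 \<Longrightarrow>
      uniform_limit K (\<lambda>N. stieltjes_sum (m N) (s N) (w N)) (analytic_extension f) sequentially"
  shows "Re ((spectral_fun f (re_mat A) *\<^sub>v x) \<bullet>c x) \<le> Re ((matrix_fun f A *\<^sub>v x) \<bullet>c x)"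
    "Re ((matrix_fun f A *\<^sub>v x) \<bullet>c x) \<le> (1 + \<tau>\<^sup>2) * Re ((spectral_fun f (re_mat A) *\<^sub>v x) \<bullet>c x)"
proof -
  have H: "pos_def_mat n (re_mat A)" using A by (simp add: accretive_mat_def)
  have limA: "(\<lambda>N. \<Sum>k<m N. w N k * Re ((stieltjes_mat (s N k) A *\<^sub>v x) \<bullet>c x)) \<longlonglongrightarrow> Re ((matrix_fun f A *\<^sub>v x) \<bullet>c x)"
    by (rule matrix_fun_form_limit[OF A x W hol ul])
  have limH: "(\<lambda>N. \<Sum>k<m N. w N k * Re ((stieltjes_mat (s N k) (re_mat A) *\<^sub>v x) \<bullet>c x)) \<longlonglongrightarrow> Re ((spectral_fun f (re_mat A) *\<^sub>v x) \<bullet>c x)"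
    by (rule spectral_fun_form_limit[OF H x W ext ul])
  have sw: "0 \<le> s N k" "s N k \<le> 1" "0 \<le> w N k" if "k < m N" for N k
    using W[of N] that by (auto simp: unit_weights_def)
  show "Re ((spectral_fun f (re_mat A) *\<^sub>v x) \<bullet>c x) \<le> Re ((matrix_fun f A *\<^sub>v x) \<bullet>c x)"
  proof (rule LIMSEQ_le[OF limH limA])
    have "(\<Sum>k<m N. w N k * Re ((stieltjes_mat (s N k) (re_mat A) *\<^sub>v x) \<bullet>c x))
      \<le> (\<Sum>k<m N. w N k * Re ((stieltjes_mat (s N k) A *\<^sub>v x) \<bullet>c x))"
      for N
      by (intro sum_mono mult_left_mono stieltjes_mat_re_bounds(1)[OF A _ _ x sec \<tau>]) (auto intro: sw)
    thus "\<exists>K. \<forall>N\<ge>K. (\<Sum>k<m N. w N k * Re ((stieltjes_mat (s N k) (re_mat A) *\<^sub>v x) \<bullet>c x))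
      \<le> (\<Sum>k<m N. w N k * Re ((stieltjes_mat (s N k) A *\<^sub>v x) \<bullet>c x))" by blast
  qed
  show "Re ((matrix_fun f A *\<^sub>v x) \<bullet>c x) \<le> (1 + \<tau>\<^sup>2) * Re ((spectral_fun f (re_mat A) *\<^sub>v x) \<bullet>c x)"
  proof (rule LIMSEQ_le[OF limA tendsto_mult_left[OF limH]], intro exI allI impI)
    fix N
    have "(\<Sum>k<m N. w N k * Re ((stieltjes_mat (s N k) A *\<^sub>v x) \<bullet>c x)) \<le>
       (\<Sum>k<m N. w N k * ((1 + \<tau>\<^sup>2) * Re ((stieltjes_mat (s N k) (re_mat A) *\<^sub>v x) \<bullet>c x)))"
      by (intro sum_mono mult_left_mono stieltjes_mat_re_bounds(2)[OF A _ _ x sec \<tau>]) (auto intro: sw)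
    thus "(\<Sum>k<m N. w N k * Re ((stieltjes_mat (s N k) A *\<^sub>v x) \<bullet>c x)) \<le>
       (1 + \<tau>\<^sup>2) * (\<Sum>k<m N. w N k * Re ((stieltjes_mat (s N k) (re_mat A) *\<^sub>v x) \<bullet>c x))"
      by (simp add: sum_distrib_left mult_ac)
  qed
qed

section \<open>Continuity along a segment\<close>

lemma pos_def_mat_coercive:
  assumes "pos_def_mat n H"
  obtains \<beta> where "\<beta> > 0" "\<And>v. v \<in> carrier_vec n \<Longrightarrow> \<beta> * Re (v \<bullet>c v) \<le> Re ((H *\<^sub>v v) \<bullet>c v)"
proof -
  obtain U d where U: "U \<in> carrier_mat n n" "U * mat_adjoint U = 1\<^sub>m n"
    "H = U * mat_diag n (\<lambda>i. complex_of_real (d i)) * mat_adjoint U" "\<And>i. i < n \<Longrightarrow> d i > 0"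
    using spectral_fun_pos_def[OF assms] by metis
  \<comment> \<open>The smallest eigenvalue capped at 1; the inserted 1 keeps \<open>Min\<close>
    meaningful for \<open>n = 0\<close>.\<close>
  define \<beta> where "\<beta> = Min (insert 1 (d ` {..<n}))"
  have \<beta>: "\<beta> > 0" "\<And>i. i < n \<Longrightarrow> \<beta> \<le> d i" using U(4) by (auto simp: \<beta>_def)
  show thesis
  proof (rule that[OF \<beta>(1)])
    fix v :: "complex vec" assume v: "v \<in> carrier_vec n"
    define y where "y = mat_adjoint U *\<^sub>v v"
    have "U * mat_diag n (\<lambda>_. 1) * mat_adjoint U = 1\<^sub>m n"
      using U(1,2) by (simp add: right_mult_one_mat[OF U(1)])
    hence "v \<bullet>c v = (\<Sum>i<n. 1 * of_real ((cmod (y $ i))\<^sup>2))"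
      using quadratic_form_diagonalized[OF U(1) v, of "\<lambda>_. 1"] v by (simp add: y_def)
    hence "Re (v \<bullet>c v) = (\<Sum>i<n. (cmod (y $ i))\<^sup>2)" by simp
    moreover have "Re ((H *\<^sub>v v) \<bullet>c v) = (\<Sum>i<n. d i * (cmod (y $ i))\<^sup>2)"
      unfolding U(3) quadratic_form_diagonalized[OF U(1) v] by (simp add: y_def)
    ultimately show "\<beta> * Re (v \<bullet>c v) \<le> Re ((H *\<^sub>v v) \<bullet>c v)"
      using \<beta>(2) by (auto simp: sum_distrib_left intro!: sum_mono mult_right_mono)
  qed
qed

text \<open>For \<open>v = E e_l\<close> coercivity reads
  \<open>\<mu> \<bar>v\<bar>^2 <= Re <e_l, v> <= \<bar>v\<bar>\<close>, so column \<open>l\<close>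
  of the inverse has norm at most \<open>1 / \<mu>\<close>.\<close>

lemma coercive_inverse_entry_bound:
  assumes D: "D \<in> carrier_mat n n" and E: "E \<in> carrier_mat n n" and DE: "D * E = 1\<^sub>m n" and \<mu>: "\<mu> > 0"
    and coer: "\<And>v. v \<in> carrier_vec n \<Longrightarrow> \<mu> * Re (v \<bullet>c v) \<le> Re ((D *\<^sub>v v) \<bullet>c v)"
    and kl: "k < n" "l < n"
  shows "cmod (E $$ (k,l)) \<le> 1 / \<mu>"
proof -
  define v where "v = E *\<^sub>v unit_vec n l"
  have v: "v \<in> carrier_vec n" unfolding v_def by (rule mult_mat_vec_carrier[OF E]) simp
  have ent: "v $ i = E $$ (i,l)" if "i < n" for i
    unfolding v_def mat_mult_unit_vec[OF E kl(2)] using that kl E by simp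
  have Dv: "D *\<^sub>v v = unit_vec n l"
    unfolding v_def using D E by (intro mult_left_inverse_cancel_vec[OF DE]) auto
  define S where "S = (\<Sum>i<n. (cmod (v $ i))\<^sup>2)"
  have mem: "(cmod (v $ i))\<^sup>2 \<le> S" if "i < n" for i
    unfolding S_def using that by (intro member_le_sum[of i "{..<n}" "\<lambda>i. (cmod (v $ i))\<^sup>2"]) auto
  have S0: "S \<ge> 0" unfolding S_def by (intro sum_nonneg) auto
  have "\<mu> * S \<le> Re ((D *\<^sub>v v) \<bullet>c v)" using coer[OF v] by (simp add: cscalar_prod_self[OF v] S_def)
  also have "(D *\<^sub>v v) \<bullet>c v = cnj (v $ l)"
    unfolding Dv using cscalar_prod_commute[OF v unit_vec_carrier, of l] cscalar_prod_unit_vec[OF v kl(2)] by simp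
  also have "Re (cnj (v $ l)) \<le> cmod (v $ l)" using complex_Re_le_cmod[of "v $ l"] by simp
  finally have 1: "\<mu> * S \<le> cmod (v $ l)" .
  also have "cmod (v $ l) \<le> sqrt S" using mem[OF kl(2)] by (simp add: real_le_rsqrt)
  finally have "\<mu> * sqrt S * sqrt S \<le> 1 * sqrt S" using S0 by (simp add: mult.assoc)
  hence "\<mu> * sqrt S \<le> 1"
    using S0 by (cases "S = 0") (auto dest: mult_right_le_imp_le)
  moreover have "cmod (E $$ (k,l)) \<le> sqrt S" using mem[OF kl(1)] by (simp add: ent[OF kl(1)] real_le_rsqrt)
  ultimately show ?thesis using \<mu> by (simp add: field_simps) (meson less_imp_le mult_left_mono order_trans)
qed

lemma mult_mat_index_sum:
  fixes A B :: "'a :: comm_semiring_0 mat"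
  assumes "A \<in> carrier_mat n m" "B \<in> carrier_mat m k" "i < n" "j < k"
  shows "(A * B) $$ (i,j) = (\<Sum>l<m. A $$ (i,l) * B $$ (l,j))"
  using assms by (auto simp: scalar_prod_def atLeast0LessThan)

text \<open>With \<open>E\<close> and \<open>F\<close> the inverses of \<open>D A\<close> and
  \<open>D B\<close>, \<open>f_s(A) - f_s(B) = A E - F B = s F (A - B) E\<close>, because
  \<open>D B * A - B * D A = s (A - B)\<close>. For \<open>\<beta> <= 1\<close> the denominators are
  coercive with constant \<open>(1 - s) \<beta> + s >= \<beta>\<close>, so the bound is uniform in
  \<open>s\<close>.\<close>

lemma stieltjes_mat_lipschitz:
  assumes A: "accretive_mat n A" and B: "accretive_mat n B" and s: "0 \<le> s" "s \<le> 1"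
    and \<beta>: "\<beta> > 0" "\<beta> \<le> 1"
    and cA: "\<And>v. v \<in> carrier_vec n \<Longrightarrow> \<beta> * Re (v \<bullet>c v) \<le> Re ((A *\<^sub>v v) \<bullet>c v)"
    and cB: "\<And>v. v \<in> carrier_vec n \<Longrightarrow> \<beta> * Re (v \<bullet>c v) \<le> Re ((B *\<^sub>v v) \<bullet>c v)"
    and ij: "i < n" "j < n"
  shows "cmod (stieltjes_mat s A $$ (i,j) - stieltjes_mat s B $$ (i,j)) \<le>
    (\<Sum>k<n. \<Sum>l<n. cmod (A $$ (k,l) - B $$ (k,l))) / \<beta>\<^sup>2"
proof -
  define D where "D A = complex_of_real (1 - s) \<cdot>\<^sub>m A + complex_of_real s \<cdot>\<^sub>m 1\<^sub>m n" for A
  have bound: "\<exists>E. D A \<in> carrier_mat n n \<and> E \<in> carrier_mat n n \<and> D A * E = 1\<^sub>m n \<and> E * D A = 1\<^sub>m n \<and>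
      stieltjes_mat s A = A * E \<and> stieltjes_mat s A = E * A \<and> (\<forall>k<n. \<forall>l<n. cmod (E $$ (k,l)) \<le> 1 / \<beta>)"
    if A: "accretive_mat n A" and cA: "\<And>v. v \<in> carrier_vec n \<Longrightarrow> \<beta> * Re (v \<bullet>c v) \<le> Re ((A *\<^sub>v v) \<bullet>c v)" for A
  proof -
    note Ac = accretive_matD(1)[OF A]
    obtain E where E: "D A \<in> carrier_mat n n" "E \<in> carrier_mat n n" "D A * E = 1\<^sub>m n" "E * D A = 1\<^sub>m n"
      "stieltjes_mat s A = A * E" "stieltjes_mat s A = E * A"
      using stieltjes_denominator_mat[OF Ac accretive_mat_spectrum[OF A] s] unfolding D_def by blast
    have "\<beta> * Re (v \<bullet>c v) \<le> Re ((D A *\<^sub>v v) \<bullet>c v)" if v: "v \<in> carrier_vec n" for v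
    proof -
      have Av: "A *\<^sub>v v \<in> carrier_vec n" by (rule mult_mat_vec_carrier[OF Ac v])
      have "D A *\<^sub>v v = of_real (1 - s) \<cdot>\<^sub>v (A *\<^sub>v v) + of_real s \<cdot>\<^sub>v v"
        unfolding D_def using Ac v
        by (subst add_mult_distrib_mat_vec[of _ n n]) (simp_all add: smult_mat_mult_vec[OF Ac v] smult_mat_mult_vec[OF one_carrier_mat v])
      hence "Re ((D A *\<^sub>v v) \<bullet>c v) = (1 - s) * Re ((A *\<^sub>v v) \<bullet>c v) + s * Re (v \<bullet>c v)"
        using Av v by (simp add: cscalar_prod_algebra[where n=n])
      moreover have "(1 - s) * (\<beta> * Re (v \<bullet>c v)) \<le> (1 - s) * Re ((A *\<^sub>v v) \<bullet>c v)"
        using s cA[OF v] by (intro mult_left_mono) auto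
      moreover have "s * (\<beta> * Re (v \<bullet>c v)) \<le> s * Re (v \<bullet>c v)"
        using s \<beta> cscalar_prod_self_nonneg(1)[OF v] by (intro mult_left_mono mult_left_le_one_le) auto
      ultimately show ?thesis by (simp add: algebra_simps)
    qed
    from coercive_inverse_entry_bound[OF E(1-3) \<beta>(1) this] E show ?thesis by blast
  qed
  obtain E where E: "D A \<in> carrier_mat n n" "E \<in> carrier_mat n n" "D A * E = 1\<^sub>m n"
      "stieltjes_mat s A = A * E" "\<And>k l. k < n \<Longrightarrow> l < n \<Longrightarrow> cmod (E $$ (k,l)) \<le> 1 / \<beta>"
    using bound[OF A cA] by blast
  obtain F where F: "D B \<in> carrier_mat n n" "F \<in> carrier_mat n n" "F * D B = 1\<^sub>m n"
      "stieltjes_mat s B = F * B" "\<And>k l. k < n \<Longrightarrow> l < n \<Longrightarrow> cmod (F $$ (k,l)) \<le> 1 / \<beta>"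
    using bound[OF B cB] by blast
  note Ac = accretive_matD(1)[OF A] and Bc = accretive_matD(1)[OF B]
  note dims = carrier_matD[OF Ac] carrier_matD[OF Bc] carrier_matD[OF E(1)] carrier_matD[OF E(2)]
    carrier_matD[OF F(1)] carrier_matD[OF F(2)]
  have "D B * A - B * D A = of_real s \<cdot>\<^sub>m (A - B)"
  proof -
    have DB: "D B * A = of_real (1 - s) \<cdot>\<^sub>m (B * A) + of_real s \<cdot>\<^sub>m A"
      unfolding D_def using dims by (simp add: mat_algebra_dim left_mult_one_mat[OF Ac])
    have DA: "B * D A = of_real (1 - s) \<cdot>\<^sub>m (B * A) + of_real s \<cdot>\<^sub>m B"
      unfolding D_def using dims by (simp add: mat_algebra_dim right_mult_one_mat[OF Bc])
    show ?thesis unfolding DB DA using dims by (intro eq_matI) (auto simp: algebra_simps)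
  qed
  hence key: "of_real s \<cdot>\<^sub>m (F * (A - B) * E) = F * (D B * A - B * D A) * E"
    using dims by (simp add: mult_smult_mat_dim smult_mult_mat_dim)
  have "F * (D B * A - B * D A) * E = F * D B * (A * E) - F * B * (D A * E)"
    using dims by (simp add: mult_minus_mat_dim minus_mult_mat_dim mult_mat_assoc_dim)
  also have "\<dots> = stieltjes_mat s A - stieltjes_mat s B"
    using left_mult_one_mat[OF mult_square_mat_carrier[OF Ac E(2)]] right_mult_one_mat[OF mult_square_mat_carrier[OF F(2) Bc]]
    by (simp add: E F)
  finally have diff: "stieltjes_mat s A - stieltjes_mat s B = of_real s \<cdot>\<^sub>m (F * (A - B) * E)" using key by simp
  have AB: "A - B \<in> carrier_mat n n" by (rule minus_carrier_mat[OF Bc])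
  have FAB: "F * (A - B) \<in> carrier_mat n n" by (rule mult_square_mat_carrier[OF F(2) AB])
  have Sc: "stieltjes_mat s A \<in> carrier_mat n n" "stieltjes_mat s B \<in> carrier_mat n n"
    using stieltjes_mat_carrier[OF A s] stieltjes_mat_carrier[OF B s] by auto
  have "stieltjes_mat s A $$ (i,j) - stieltjes_mat s B $$ (i,j) = (of_real s \<cdot>\<^sub>m (F * (A - B) * E)) $$ (i,j)"
    unfolding diff[symmetric] using Sc ij by simp
  also have "\<dots> = of_real s * (F * (A - B) * E) $$ (i,j)" using dims ij by (subst index_smult_mat(1)) auto
  also have "(F * (A - B) * E) $$ (i,j) = (\<Sum>l<n. (F * (A - B)) $$ (i,l) * E $$ (l,j))"
    by (rule mult_mat_index_sum[OF FAB E(2) ij])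
  also have "\<dots> = (\<Sum>l<n. \<Sum>k<n. F $$ (i,k) * (A $$ (k,l) - B $$ (k,l)) * E $$ (l,j))"
  proof (intro sum.cong refl)
    fix l assume l: "l \<in> {..<n}"
    have "(F * (A - B)) $$ (i,l) = (\<Sum>k<n. F $$ (i,k) * (A $$ (k,l) - B $$ (k,l)))"
      using F(2) AB Ac Bc ij l by (auto simp: scalar_prod_def atLeast0LessThan)
    thus "(F * (A - B)) $$ (i,l) * E $$ (l,j) = (\<Sum>k<n. F $$ (i,k) * (A $$ (k,l) - B $$ (k,l)) * E $$ (l,j))"
      by (simp add: sum_distrib_right)
  qed
  finally have "cmod (stieltjes_mat s A $$ (i,j) - stieltjes_mat s B $$ (i,j)) =
      s * cmod (\<Sum>l<n. \<Sum>k<n. F $$ (i,k) * (A $$ (k,l) - B $$ (k,l)) * E $$ (l,j))"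
    using s by (simp add: norm_mult)
  also have "\<dots> \<le> cmod (\<Sum>l<n. \<Sum>k<n. F $$ (i,k) * (A $$ (k,l) - B $$ (k,l)) * E $$ (l,j))"
    using s by (intro mult_left_le_one_le) auto
  also have "\<dots> \<le> (\<Sum>l<n. \<Sum>k<n. 1 / \<beta> * cmod (A $$ (k,l) - B $$ (k,l)) * (1 / \<beta>))"
  proof -
    have "cmod (F $$ (i,k) * X * E $$ (l,j)) \<le> 1 / \<beta> * cmod X * (1 / \<beta>)" if "k < n" "l < n" for k l X
      unfolding norm_mult by (intro mult_mono E(5) F(5) ij that order_refl) (use \<beta> in auto)
    thus ?thesis by (intro sum_norm_le) auto
  qed
  also have "\<dots> = (\<Sum>l<n. \<Sum>k<n. cmod (A $$ (k,l) - B $$ (k,l)) / \<beta>\<^sup>2)"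
    by (simp add: power2_eq_square)
  also have "\<dots> = (\<Sum>k<n. \<Sum>l<n. cmod (A $$ (k,l) - B $$ (k,l))) / \<beta>\<^sup>2"
    by (subst sum.swap) (simp only: sum_divide_distrib)
  finally show ?thesis .
qed

text \<open>A Lipschitz constant that is uniform in \<open>s\<close> survives convex combinations
  and limits. Its purpose is the continuity, and thus the integrability, of \<open>f\<close> along
  the segment.\<close>

lemma matrix_fun_lipschitz:
  assumes A: "accretive_mat n A" and B: "accretive_mat n B"
    and W: "\<And>N :: nat. unit_weights (m N) (s N) (w N)"
    and hol: "analytic_extension f holomorphic_on (- \<real>\<^sub>\<le>\<^sub>0)"
    and ul: "\<And>K. compact K \<Longrightarrow> K \<subseteq> - \<real>\<^sub>\<le>\<^sub>0 \<Longrightarrow>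
      uniform_limit K (\<lambda>N. stieltjes_sum (m N) (s N) (w N)) (analytic_extension f) sequentially"
    and \<beta>: "\<beta> > 0" "\<beta> \<le> 1"
    and cA: "\<And>v. v \<in> carrier_vec n \<Longrightarrow> \<beta> * Re (v \<bullet>c v) \<le> Re ((A *\<^sub>v v) \<bullet>c v)"
    and cB: "\<And>v. v \<in> carrier_vec n \<Longrightarrow> \<beta> * Re (v \<bullet>c v) \<le> Re ((B *\<^sub>v v) \<bullet>c v)"
    and ij: "i < n" "j < n"
  shows "cmod (matrix_fun f A $$ (i,j) - matrix_fun f B $$ (i,j)) \<le>
    (\<Sum>k<n. \<Sum>l<n. cmod (A $$ (k,l) - B $$ (k,l))) / \<beta>\<^sup>2"
proof -
  define C where "C = (\<Sum>k<n. \<Sum>l<n. cmod (A $$ (k,l) - B $$ (k,l))) / \<beta>\<^sup>2"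
  have limA: "(\<lambda>N. \<Sum>k<m N. of_real (w N k) * stieltjes_mat (s N k) A $$ (i,j)) \<longlonglongrightarrow> matrix_fun f A $$ (i,j)"
    by (rule matrix_fun_approximation[OF accretive_matD(1)[OF A] accretive_mat_spectrum[OF A] ij W hol ul])
  have limB: "(\<lambda>N. \<Sum>k<m N. of_real (w N k) * stieltjes_mat (s N k) B $$ (i,j)) \<longlonglongrightarrow> matrix_fun f B $$ (i,j)"
    by (rule matrix_fun_approximation[OF accretive_matD(1)[OF B] accretive_mat_spectrum[OF B] ij W hol ul])
  have "cmod (matrix_fun f A $$ (i,j) - matrix_fun f B $$ (i,j)) \<le> C"
  proof (rule LIMSEQ_le_const2[OF tendsto_norm[OF tendsto_diff[OF limA limB]]])
    have "cmod ((\<Sum>k<m N. of_real (w N k) * stieltjes_mat (s N k) A $$ (i,j)) -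
        (\<Sum>k<m N. of_real (w N k) * stieltjes_mat (s N k) B $$ (i,j))) \<le> C" for N
    proof -
      have "cmod ((\<Sum>k<m N. of_real (w N k) * stieltjes_mat (s N k) A $$ (i,j)) -
          (\<Sum>k<m N. of_real (w N k) * stieltjes_mat (s N k) B $$ (i,j))) =
          cmod (\<Sum>k<m N. of_real (w N k) * (stieltjes_mat (s N k) A $$ (i,j) - stieltjes_mat (s N k) B $$ (i,j)))"
        by (simp add: sum_subtractf algebra_simps)
      also have "\<dots> \<le> (\<Sum>k<m N. w N k * C)"
      proof (rule sum_norm_le)
        fix k assume "k \<in> {..<m N}"
        hence k: "0 \<le> s N k" "s N k \<le> 1" "0 \<le> w N k" using W[of N] by (auto simp: unit_weights_def)
        show "cmod (of_real (w N k) * (stieltjes_mat (s N k) A $$ (i,j) - stieltjes_mat (s N k) B $$ (i,j))) \<le> w N k * C"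
          using mult_left_mono[OF stieltjes_mat_lipschitz[OF A B k(1,2) \<beta> cA cB ij] k(3)] k(3)
          by (simp add: norm_mult C_def)
      qed
      also have "\<dots> = C" using W[of N] by (simp add: unit_weights_def flip: sum_distrib_right)
      finally show ?thesis .
    qed
    thus "\<exists>K. \<forall>N\<ge>K. cmod ((\<Sum>k<m N. of_real (w N k) * stieltjes_mat (s N k) A $$ (i,j)) -
        (\<Sum>k<m N. of_real (w N k) * stieltjes_mat (s N k) B $$ (i,j))) \<le> C" by blast
  qed
  thus ?thesis by (simp only: C_def)
qed

section \<open>The segment between two matrices\<close>

definition segment_mat :: "complex mat \<Rightarrow> complex mat \<Rightarrow> real \<Rightarrow> complex mat" where
  "segment_mat A B t = complex_of_real (1 - t) \<cdot>\<^sub>m A + complex_of_real t \<cdot>\<^sub>m B"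

lemma segment_mat_carrier:
  "A \<in> carrier_mat n n \<Longrightarrow> B \<in> carrier_mat n n \<Longrightarrow> segment_mat A B t \<in> carrier_mat n n"
  by (simp add: segment_mat_def)

lemma segment_mat_form:
  assumes A: "A \<in> carrier_mat n n" and B: "B \<in> carrier_mat n n" and x: "x \<in> carrier_vec n"
  shows "(segment_mat A B t *\<^sub>v x) \<bullet>c x = of_real (1 - t) * ((A *\<^sub>v x) \<bullet>c x) + of_real t * ((B *\<^sub>v x) \<bullet>c x)"
proof -
  have "segment_mat A B t *\<^sub>v x = of_real (1 - t) \<cdot>\<^sub>v (A *\<^sub>v x) + of_real t \<cdot>\<^sub>v (B *\<^sub>v x)"
    unfolding segment_mat_def using A B x
    by (subst add_mult_distrib_mat_vec[of _ n n]) (simp_all add: smult_mat_mult_vec[OF A x] smult_mat_mult_vec[OF B x])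
  thus ?thesis using mult_mat_vec_carrier[OF A x] mult_mat_vec_carrier[OF B x] x
    by (simp add: cscalar_prod_algebra[where n=n])
qed

lemma segment_mat_half:
  assumes "A \<in> carrier_mat n n" "B \<in> carrier_mat n n"
  shows "segment_mat A B (1/2) = (1/2) \<cdot>\<^sub>m (A + B)"
  using assms by (intro eq_matI) (auto simp: segment_mat_def field_simps)

lemma segment_mat_segment_mat:
  assumes "A \<in> carrier_mat n n" "B \<in> carrier_mat n n"
  shows "segment_mat (segment_mat A B t) (segment_mat A B (1 - t)) (1/2) = segment_mat A B (1/2)"
  using assms by (intro eq_matI) (auto simp: segment_mat_def field_simps)

lemma re_mat_segment_mat:
  assumes A: "A \<in> carrier_mat n n" and B: "B \<in> carrier_mat n n"
  shows "re_mat (segment_mat A B t) = segment_mat (re_mat A) (re_mat B) t"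
  using assms by (intro eq_matI) (auto simp: segment_mat_def re_mat_def field_simps)

lemma accretive_segment_mat:
  assumes A: "accretive_mat n A" and B: "accretive_mat n B" and t: "0 \<le> t" "t \<le> 1"
  shows "accretive_mat n (segment_mat A B t)"
proof (rule accretive_matI)
  note Ac = accretive_matD(1)[OF A] and Bc = accretive_matD(1)[OF B]
  show "segment_mat A B t \<in> carrier_mat n n" by (rule segment_mat_carrier[OF Ac Bc])
  fix x :: "complex vec" assume x: "x \<in> carrier_vec n" "x \<noteq> 0\<^sub>v n"
  have p: "Re ((A *\<^sub>v x) \<bullet>c x) > 0" "Re ((B *\<^sub>v x) \<bullet>c x) > 0"
    by (rule accretive_matD(2)[OF A x], rule accretive_matD(2)[OF B x])
  have "0 < (1 - t) * Re ((A *\<^sub>v x) \<bullet>c x) + t * Re ((B *\<^sub>v x) \<bullet>c x)"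
  proof (cases "t = 1")
    case False
    thus ?thesis using p t by (intro add_pos_nonneg mult_pos_pos mult_nonneg_nonneg) auto
  qed (use p in simp)
  thus "Re ((segment_mat A B t *\<^sub>v x) \<bullet>c x) > 0" by (simp add: segment_mat_form[OF Ac Bc x(1)])
qed

section \<open>The Hermite-Hadamard inequality\<close>

lemma loewner_leI:
  assumes A: "A \<in> carrier_mat n n" "hermitian_mat A" and B: "B \<in> carrier_mat n n" "hermitian_mat B"
    and le: "\<And>x. x \<in> carrier_vec n \<Longrightarrow> Re ((A *\<^sub>v x) \<bullet>c x) \<le> Re ((B *\<^sub>v x) \<bullet>c x)"
  shows "loewner_le n A B"
  unfolding loewner_le_def pos_semidef_mat_def
proof (intro conjI ballI)
  show "B - A \<in> carrier_mat n n" by (rule minus_carrier_mat[OF A(1)])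
  show "hermitian_mat (B - A)"
    using A B mat_adjoint_minus[OF B(1) A(1)] by (simp add: hermitian_mat_def)
  fix x :: "complex vec" assume x: "x \<in> carrier_vec n"
  have "((B - A) *\<^sub>v x) \<bullet>c x = (B *\<^sub>v x) \<bullet>c x - (A *\<^sub>v x) \<bullet>c x"
    unfolding minus_mult_distrib_mat_vec[OF B(1) A(1) x]
    by (rule cscalar_prod_left_minus[OF mult_mat_vec_carrier[OF B(1) x] mult_mat_vec_carrier[OF A(1) x] x])
  thus "0 \<le> Re (((B - A) *\<^sub>v x) \<bullet>c x)" using le[OF x] by simp
qed (fact A B)+

lemma mat_integral_hermitian:
  assumes G: "\<And>t. t \<in> S \<Longrightarrow> G t \<in> carrier_mat n n \<and> hermitian_mat (G t)"
  shows "mat_integral n S G \<in> carrier_mat n n" "hermitian_mat (mat_integral n S G)"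
proof -
  show "mat_integral n S G \<in> carrier_mat n n" by (simp add: mat_integral_def)
  have "cnj (integral S (\<lambda>t. G t $$ (j,i))) = integral S (\<lambda>t. G t $$ (i,j))" if "i < n" "j < n" for i j
    unfolding integral_cnj using G hermitian_mat_index[of _ n j i] that by (intro integral_cong) auto
  thus "hermitian_mat (mat_integral n S G)"
    unfolding hermitian_mat_def by (intro eq_matI) (auto simp: mat_integral_def)
qed

text \<open>Continuity makes the entries integrable, so \<open>integral\<close> is the true value
  and not its default 0; the form and \<open>Re\<close> are then linear images of the
  entries.\<close>

lemma mat_integral_form:
  assumes G: "\<And>t. t \<in> {0..1} \<Longrightarrow> G t \<in> carrier_mat n n"
    and cont: "\<And>i j. i < n \<Longrightarrow> j < n \<Longrightarrow> continuous_on {0..1} (\<lambda>t. G t $$ (i,j))"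
    and x: "x \<in> carrier_vec n"
  shows "((\<lambda>t. Re ((G t *\<^sub>v x) \<bullet>c x)) has_integral Re ((mat_integral n {0..1} G *\<^sub>v x) \<bullet>c x)) {0..1}"
proof -
  have "((\<lambda>t. G t $$ (i,j)) has_integral mat_integral n {0..1} G $$ (i,j)) {0..1}" if "i < n" "j < n" for i j
    using integrable_integral[OF integrable_continuous_interval[OF cont[OF that]]] that
    by (simp add: mat_integral_def)
  hence "((\<lambda>t. \<Sum>i<n. \<Sum>j<n. G t $$ (i,j) * (x $ j * cnj (x $ i))) has_integral
      (\<Sum>i<n. \<Sum>j<n. mat_integral n {0..1} G $$ (i,j) * (x $ j * cnj (x $ i)))) {0..1}"
    by (intro has_integral_sum has_integral_mult_left) auto
  also have "(\<Sum>i<n. \<Sum>j<n. mat_integral n {0..1} G $$ (i,j) * (x $ j * cnj (x $ i))) = (mat_integral n {0..1} G *\<^sub>v x) \<bullet>c x"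
    by (rule quadratic_form_entries[symmetric, OF _ x]) (simp add: mat_integral_def)
  finally have "((\<lambda>t. \<Sum>i<n. \<Sum>j<n. G t $$ (i,j) * (x $ j * cnj (x $ i))) has_integral
      (mat_integral n {0..1} G *\<^sub>v x) \<bullet>c x) {0..1}" .
  from has_integral_linear[OF this bounded_linear_Re]
  have "((\<lambda>t. Re (\<Sum>i<n. \<Sum>j<n. G t $$ (i,j) * (x $ j * cnj (x $ i)))) has_integral
      Re ((mat_integral n {0..1} G *\<^sub>v x) \<bullet>c x)) {0..1}" by (simp only: comp_def)
  thus ?thesis
    by (rule has_integral_eq[rotated]) (simp only: quadratic_form_entries[OF G x])
qed

lemma spectral_fun_segment_concave:
  assumes conc: "matrix_concave f" and X: "pos_def_mat n X" and Y: "pos_def_mat n Y"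
    and t: "0 \<le> t" "t \<le> 1" and x: "x \<in> carrier_vec n"
  shows "(1 - t) * Re ((spectral_fun f X *\<^sub>v x) \<bullet>c x) + t * Re ((spectral_fun f Y *\<^sub>v x) \<bullet>c x)
    \<le> Re ((spectral_fun f (segment_mat X Y t) *\<^sub>v x) \<bullet>c x)"
proof -
  have "loewner_le n (segment_mat (spectral_fun f X) (spectral_fun f Y) t) (spectral_fun f (segment_mat X Y t))"
    using conc X Y t unfolding matrix_concave_def segment_mat_def by blast
  from loewner_leD[OF this x] show ?thesis
    using segment_mat_form[OF spectral_fun_carrier[OF pos_def_matD(1,2)[OF X]] spectral_fun_carrier[OF pos_def_matD(1,2)[OF Y]] x]
    by simp
qed

theorem theorem2p5:
  fixes f :: "real \<Rightarrow> real" and A B :: "complex mat" and n :: nat and \<alpha> :: real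
  assumes f_pos: "\<And>x. x > 0 \<Longrightarrow> f x > 0"
    and f_concave: "matrix_concave f"
    and f_one: "f 1 = 1"
    and A_accretive: "accretive_mat n A"
    and B_accretive: "accretive_mat n B"
    and alpha_ge: "0 \<le> \<alpha>" and alpha_less: "\<alpha> < pi / 2"
    and A_sector: "numerical_range n A \<subseteq> sector \<alpha>"
    and B_sector: "numerical_range n B \<subseteq> sector \<alpha>"
  shows "loewner_le n
           (re_mat ((1/2) \<cdot>\<^sub>m (matrix_fun f A + matrix_fun f B)))
           (complex_of_real ((1 / cos \<alpha>) ^ 2) \<cdot>\<^sub>m
              mat_integral n {0..1} (\<lambda>t. re_mat (matrix_fun f
                (complex_of_real (1 - t) \<cdot>\<^sub>m A + complex_of_real t \<cdot>\<^sub>m B))))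
       \<and> loewner_le n
           (complex_of_real ((1 / cos \<alpha>) ^ 2) \<cdot>\<^sub>m
              mat_integral n {0..1} (\<lambda>t. re_mat (matrix_fun f
                (complex_of_real (1 - t) \<cdot>\<^sub>m A + complex_of_real t \<cdot>\<^sub>m B))))
           (complex_of_real ((1 / cos \<alpha>) ^ 4) \<cdot>\<^sub>m
              re_mat (matrix_fun f ((1/2) \<cdot>\<^sub>m (A + B))))"
proof -
  note Ac = accretive_matD(1)[OF A_accretive] and Bc = accretive_matD(1)[OF B_accretive]
  define \<tau> where "\<tau> = tan \<alpha>"
  define c where "c = (1 / cos \<alpha>) ^ 2"
  have cos: "cos \<alpha> > 0" using alpha_ge alpha_less by (intro cos_gt_zero_pi) auto
  have \<tau>: "\<tau> \<ge> 0"
    unfolding \<tau>_def tan_def using cos alpha_ge alpha_less by (intro divide_nonneg_pos sin_ge_zero) auto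
  \<comment> \<open>The constant \<open>1 + tan^2\<close> of the comparison is \<open>sec^2\<close>,
    the factor in the claim.\<close>
  have c: "c = 1 + \<tau>\<^sup>2" "c \<ge> 0" "(1 / cos \<alpha>) ^ 4 = c * c"
    using cos tan_sec[of \<alpha>]
    by (simp_all add: c_def \<tau>_def inverse_eq_divide power_divide power2_eq_square power4_eq_xxxx)
  show ?thesis
  proof (rule analytic_extension_approximation[OF less_imp_le[OF f_pos] f_concave f_one])
    fix m :: "nat \<Rightarrow> nat" and s w :: "nat \<Rightarrow> nat \<Rightarrow> real"
    assume W: "\<And>N. unit_weights (m N) (s N) (w N)"
      and hol: "analytic_extension f holomorphic_on (- \<real>\<^sub>\<le>\<^sub>0)"
      and ext: "\<And>x. x > 0 \<Longrightarrow> analytic_extension f (of_real x) = of_real (f x)"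
      and ul: "\<And>K. compact K \<Longrightarrow> K \<subseteq> - \<real>\<^sub>\<le>\<^sub>0 \<Longrightarrow>
        uniform_limit K (\<lambda>N. stieltjes_sum (m N) (s N) (w N)) (analytic_extension f) sequentially"
    define X where "X = segment_mat A B"
    have Xc: "X t \<in> carrier_mat n n" for t unfolding X_def by (rule segment_mat_carrier[OF Ac Bc])
    have X: "accretive_mat n (X t)" if "0 \<le> t" "t \<le> 1" for t
      unfolding X_def by (rule accretive_segment_mat[OF A_accretive B_accretive that])
    have H: "pos_def_mat n (re_mat (X t))" if "0 \<le> t" "t \<le> 1" for t
      using X[OF that] by (simp add: accretive_mat_def)
    have sec: "\<bar>Im ((X t *\<^sub>v x) \<bullet>c x)\<bar> \<le> \<tau> * Re ((X t *\<^sub>v x) \<bullet>c x)"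
      if t: "0 \<le> t" "t \<le> 1" and x: "x \<in> carrier_vec n" for t x
    proof -
      define a b where "a = (A *\<^sub>v x) \<bullet>c x" and "b = (B *\<^sub>v x) \<bullet>c x"
      have ab: "\<bar>Im a\<bar> \<le> \<tau> * Re a" "\<bar>Im b\<bar> \<le> \<tau> * Re b"
        unfolding a_def b_def \<tau>_def
        by (rule numerical_range_sector[OF Ac A_sector x], rule numerical_range_sector[OF Bc B_sector x])
      have "\<bar>(1 - t) * Im a + t * Im b\<bar> \<le> \<bar>(1 - t) * Im a\<bar> + \<bar>t * Im b\<bar>" by (rule abs_triangle_ineq)
      also have "\<dots> = (1 - t) * \<bar>Im a\<bar> + t * \<bar>Im b\<bar>" using t by (simp add: abs_mult)
      also have "\<dots> \<le> (1 - t) * (\<tau> * Re a) + t * (\<tau> * Re b)"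
        using ab t by (intro add_mono mult_left_mono) auto
      finally show ?thesis unfolding X_def segment_mat_form[OF Ac Bc x] a_def[symmetric] b_def[symmetric]
        by (simp add: algebra_simps)
    qed
    \<comment> \<open>\<open>\<phi>\<close> inherits concavity in \<open>t\<close>, since real parts
      move along a segment of positive definite matrices. \<open>\<psi>\<close> is the quantity in
      the claim; it is reached from \<open>\<phi>\<close> through
      \<open>\<phi> <= \<psi> <= c \<phi>\<close>.\<close>
    define \<phi> where "\<phi> x t = Re ((spectral_fun f (re_mat (X t)) *\<^sub>v x) \<bullet>c x)" for x t
    define \<psi> where "\<psi> x t = Re ((matrix_fun f (X t) *\<^sub>v x) \<bullet>c x)" for x t
    have \<phi>\<psi>: "\<phi> x t \<le> \<psi> x t" and \<psi>\<phi>: "\<psi> x t \<le> c * \<phi> x t"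
      if "0 \<le> t" "t \<le> 1" "x \<in> carrier_vec n" for x t
      unfolding \<phi>_def \<psi>_def c(1)
      by (rule matrix_fun_re_bounds[OF X[OF that(1,2)] that(3) sec[OF that(1,2)] \<tau> W hol ext ul]; assumption)+
    have \<phi>conc: "(1 - t) * \<phi> x 0 + t * \<phi> x 1 \<le> \<phi> x t" if "0 \<le> t" "t \<le> 1" "x \<in> carrier_vec n" for x t
    proof -
      have "segment_mat (re_mat (X 0)) (re_mat (X 1)) t = re_mat (X t)"
        unfolding re_mat_segment_mat[OF Xc Xc, symmetric] unfolding X_def
        by (rule arg_cong[of _ _ re_mat], rule eq_matI) (use Ac Bc in \<open>auto simp: segment_mat_def\<close>)
      thus ?thesis unfolding \<phi>_def
        using spectral_fun_segment_concave[OF f_concave H[of 0] H[of 1] that] by simp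
    qed
    have \<phi>mid: "\<phi> x t + \<phi> x (1 - t) \<le> 2 * \<phi> x (1/2)" if t: "0 \<le> t" "t \<le> 1" "x \<in> carrier_vec n" for x t
    proof -
      have "segment_mat (re_mat (X t)) (re_mat (X (1 - t))) (1/2) = re_mat (X (1/2))"
        unfolding re_mat_segment_mat[OF Xc Xc, symmetric] by (simp only: X_def segment_mat_segment_mat[OF Ac Bc])
      thus ?thesis unfolding \<phi>_def
        using spectral_fun_segment_concave[OF f_concave H[of t] H[of "1 - t"] _ _ t(3), of "1/2"] t by simp
    qed
    define G where "G t = re_mat (matrix_fun f (X t))" for t
    have Mc: "matrix_fun f (X t) \<in> carrier_mat n n" for t by (rule matrix_fun_carrier[OF Xc])
    have Gc: "G t \<in> carrier_mat n n" "hermitian_mat (G t)" for t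
      unfolding G_def by (rule re_mat_carrier[OF Mc])+
    have G\<psi>: "Re ((G t *\<^sub>v x) \<bullet>c x) = \<psi> x t" if "x \<in> carrier_vec n" for t x
      unfolding G_def \<psi>_def re_mat_quadratic_form[OF Mc that] by simp
    have contM: "continuous_on {0..1} (\<lambda>t. matrix_fun f (X t) $$ (i,j))" if ij: "i < n" "j < n" for i j
    proof -
      obtain a where a: "a > 0" "\<And>v. v \<in> carrier_vec n \<Longrightarrow> a * Re (v \<bullet>c v) \<le> Re ((re_mat A *\<^sub>v v) \<bullet>c v)"
        using pos_def_mat_coercive A_accretive unfolding accretive_mat_def by metis
      obtain b where b: "b > 0" "\<And>v. v \<in> carrier_vec n \<Longrightarrow> b * Re (v \<bullet>c v) \<le> Re ((re_mat B *\<^sub>v v) \<bullet>c v)"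
        using pos_def_mat_coercive B_accretive unfolding accretive_mat_def by metis
      define \<beta> where "\<beta> = min 1 (min a b)"
      have \<beta>: "\<beta> > 0" "\<beta> \<le> 1" "\<beta> \<le> a" "\<beta> \<le> b" using a(1) b(1) by (auto simp: \<beta>_def)
      have coer: "\<beta> * Re (v \<bullet>c v) \<le> Re ((X t *\<^sub>v v) \<bullet>c v)" if t: "0 \<le> t" "t \<le> 1" and v: "v \<in> carrier_vec n" for t v
      proof -
        have vv: "Re (v \<bullet>c v) \<ge> 0" by (rule cscalar_prod_self_nonneg(1)[OF v])
        have "\<beta> * Re (v \<bullet>c v) \<le> Re ((A *\<^sub>v v) \<bullet>c v)"
          using a(2)[OF v] mult_right_mono[OF \<beta>(3) vv] by (simp add: re_mat_quadratic_form[OF Ac v])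
        moreover have "\<beta> * Re (v \<bullet>c v) \<le> Re ((B *\<^sub>v v) \<bullet>c v)"
          using b(2)[OF v] mult_right_mono[OF \<beta>(4) vv] by (simp add: re_mat_quadratic_form[OF Bc v])
        ultimately have "(1 - t) * (\<beta> * Re (v \<bullet>c v)) + t * (\<beta> * Re (v \<bullet>c v)) \<le>
            (1 - t) * Re ((A *\<^sub>v v) \<bullet>c v) + t * Re ((B *\<^sub>v v) \<bullet>c v)"
          using t by (intro add_mono mult_left_mono) auto
        thus ?thesis unfolding X_def segment_mat_form[OF Ac Bc v] by (simp add: algebra_simps)
      qed
      define C where "C = (\<Sum>k<n. \<Sum>l<n. cmod (A $$ (k,l) - B $$ (k,l)))"
      have "(C / \<beta>\<^sup>2)-lipschitz_on {0..1} (\<lambda>t. matrix_fun f (X t) $$ (i,j))"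
      proof (rule lipschitz_onI)
        show "0 \<le> C / \<beta>\<^sup>2" unfolding C_def by (intro divide_nonneg_nonneg sum_nonneg) auto
        fix t u :: real assume tu: "t \<in> {0..1}" "u \<in> {0..1}"
        have "cmod (matrix_fun f (X t) $$ (i,j) - matrix_fun f (X u) $$ (i,j)) \<le>
            (\<Sum>k<n. \<Sum>l<n. cmod (X t $$ (k,l) - X u $$ (k,l))) / \<beta>\<^sup>2"
          by (rule matrix_fun_lipschitz[OF X X W hol ul \<beta>(1,2) coer coer ij]) (use tu in auto)
        also have "(\<Sum>k<n. \<Sum>l<n. cmod (X t $$ (k,l) - X u $$ (k,l))) = (\<Sum>k<n. \<Sum>l<n. \<bar>t - u\<bar> * cmod (A $$ (k,l) - B $$ (k,l)))"
        proof (intro sum.cong refl)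
          fix k l assume "k \<in> {..<n}" "l \<in> {..<n}"
          hence "X t $$ (k,l) - X u $$ (k,l) = of_real (u - t) * (A $$ (k,l) - B $$ (k,l))"
            using Ac Bc by (simp add: X_def segment_mat_def algebra_simps)
          thus "cmod (X t $$ (k,l) - X u $$ (k,l)) = \<bar>t - u\<bar> * cmod (A $$ (k,l) - B $$ (k,l))"
            by (simp only: norm_mult norm_of_real abs_minus_commute)
        qed
        also have "\<dots> = \<bar>t - u\<bar> * C" by (simp add: C_def sum_distrib_left)
        finally show "dist (matrix_fun f (X t) $$ (i,j)) (matrix_fun f (X u) $$ (i,j)) \<le> C / \<beta>\<^sup>2 * dist t u"
          by (simp add: dist_norm mult.commute)
      qed
      thus ?thesis by (rule lipschitz_on_continuous_on)
    qed
    have contG: "continuous_on {0..1} (\<lambda>t. G t $$ (i,j))" if ij: "i < n" "j < n" for i j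
    proof -
      have "G t $$ (i,j) = (1/2) * (matrix_fun f (X t) $$ (i,j) + cnj (matrix_fun f (X t) $$ (j,i)))" for t
        using Mc[of t] ij by (simp add: G_def re_mat_def)
      thus ?thesis using contM[OF ij] contM[OF ij(2,1)] by (simp only:) (intro continuous_intros)
    qed
    define I where "I = mat_integral n {0..1} G"
    have I: "I \<in> carrier_mat n n" "hermitian_mat I"
      unfolding I_def using mat_integral_hermitian[of "{0..1}" G n] Gc by auto
    have int: "(\<psi> x has_integral Re ((I *\<^sub>v x) \<bullet>c x)) {0..1}" if "x \<in> carrier_vec n" for x
      using mat_integral_form[OF Gc(1) contG that] unfolding I_def G\<psi>[OF that] .
    have low: "(\<phi> x 0 + \<phi> x 1) / 2 \<le> Re ((I *\<^sub>v x) \<bullet>c x)" if x: "x \<in> carrier_vec n" for x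
    proof -
      \<comment> \<open>The chord of \<open>\<phi>\<close> lies below \<open>\<phi>\<close> and
        hence below \<open>\<psi>\<close>; it integrates to the mean of the end values.\<close>
      have "((\<lambda>t. \<phi> x 0 + (\<phi> x 1 - \<phi> x 0) * t) has_integral \<phi> x 0 + (\<phi> x 1 - \<phi> x 0) * (1/2)) {0..1}"
        using has_integral_add[OF has_integral_const_real[of "\<phi> x 0" 0 1]
            has_integral_mult_right[OF ident_has_integral[of 0 1], of "\<phi> x 1 - \<phi> x 0"]] by simp
      from has_integral_le[OF this int[OF x]] have "\<phi> x 0 + (\<phi> x 1 - \<phi> x 0) * (1/2) \<le> Re ((I *\<^sub>v x) \<bullet>c x)"
        using order_trans[OF \<phi>conc \<phi>\<psi>, of _ x] x by (force simp: algebra_simps)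
      thus ?thesis by (simp add: field_simps)
    qed
    have high: "Re ((I *\<^sub>v x) \<bullet>c x) \<le> c * \<phi> x (1/2)" if x: "x \<in> carrier_vec n" for x
    proof -
      have img: "(\<lambda>t. 1 - t) ` {0..1} = {0..1::real}"
      proof
        show "{0..1} \<subseteq> (\<lambda>t. 1 - t) ` {0..1::real}"
        proof
          fix t :: real assume "t \<in> {0..1}"
          thus "t \<in> (\<lambda>t. 1 - t) ` {0..1}" by (intro image_eqI[of _ _ "1 - t"]) auto
        qed
      qed auto
      \<comment> \<open>Reflection keeps the integral, so the integrand may be averaged over
        \<open>t\<close> and \<open>1 - t\<close>, whose midpoint is always 1/2.\<close>
      have "((\<lambda>t. \<psi> x (1 - t)) has_integral Re ((I *\<^sub>v x) \<bullet>c x)) {0..1}"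
        using has_integral_affinity01[of "\<psi> x" _ "-1" 1] int[OF x] by (simp add: img)
      from has_integral_add[OF int[OF x] this]
      have "((\<lambda>t. \<psi> x t + \<psi> x (1 - t)) has_integral 2 * Re ((I *\<^sub>v x) \<bullet>c x)) {0..1}" by simp
      moreover have "((\<lambda>t. 2 * (c * \<phi> x (1/2))) has_integral 2 * (c * \<phi> x (1/2))) {0..1::real}"
        using has_integral_const_real[of "2 * (c * \<phi> x (1/2))" 0 1] by simp
      ultimately have "2 * Re ((I *\<^sub>v x) \<bullet>c x) \<le> 2 * (c * \<phi> x (1/2))"
      proof (rule has_integral_le)
        fix t :: real assume "t \<in> {0..1}"
        hence t: "0 \<le> t" "t \<le> 1" "0 \<le> 1 - t" "1 - t \<le> 1" by auto
        have "\<psi> x t + \<psi> x (1 - t) \<le> c * (\<phi> x t + \<phi> x (1 - t))"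
          using \<psi>\<phi>[OF t(1,2) x] \<psi>\<phi>[OF t(3,4) x] by (simp add: algebra_simps)
        also have "\<dots> \<le> c * (2 * \<phi> x (1/2))" using \<phi>mid[OF t(1,2) x] c(2) by (rule mult_left_mono)
        finally show "\<psi> x t + \<psi> x (1 - t) \<le> 2 * (c * \<phi> x (1/2))" by simp
      qed
      thus ?thesis by simp
    qed
    have smult: "complex_of_real r \<cdot>\<^sub>m M \<in> carrier_mat n n" "hermitian_mat (complex_of_real r \<cdot>\<^sub>m M)"
      if "M \<in> carrier_mat n n" "hermitian_mat M" for r M
      using that by (auto simp: hermitian_mat_def mat_adjoint_smult)
    have smult_form: "Re (((complex_of_real r \<cdot>\<^sub>m M) *\<^sub>v x) \<bullet>c x) = r * Re ((M *\<^sub>v x) \<bullet>c x)"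
      if "M \<in> carrier_mat n n" "x \<in> carrier_vec n" for r M x
      unfolding smult_mat_mult_vec[OF that] using mult_mat_vec_carrier[OF that] that(2)
      by (simp add: cscalar_prod_left_smult[where n=n])
    have endpoints: "X 0 = A" "X 1 = B" "X (1/2) = (1/2) \<cdot>\<^sub>m (A + B)"
      unfolding X_def using Ac Bc by (auto intro!: eq_matI simp: segment_mat_def field_simps)
    define M where "M = (1/2) \<cdot>\<^sub>m (matrix_fun f A + matrix_fun f B)"
    have Mseg: "M = segment_mat (matrix_fun f (X 0)) (matrix_fun f (X 1)) (1/2)"
      unfolding M_def endpoints(1,2) by (rule segment_mat_half[OF matrix_fun_carrier[OF Ac] matrix_fun_carrier[OF Bc], symmetric])
    have Mcar: "M \<in> carrier_mat n n" unfolding Mseg by (rule segment_mat_carrier[OF Mc Mc])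
    have Mform: "Re ((re_mat M *\<^sub>v x) \<bullet>c x) = (\<psi> x 0 + \<psi> x 1) / 2" if x: "x \<in> carrier_vec n" for x
    proof -
      have "Re ((re_mat M *\<^sub>v x) \<bullet>c x) = Re ((M *\<^sub>v x) \<bullet>c x)"
        by (simp add: re_mat_quadratic_form[OF Mcar x])
      also have "\<dots> = (\<psi> x 0 + \<psi> x 1) / 2"
        unfolding Mseg segment_mat_form[OF Mc Mc x] \<psi>_def by simp
      finally show ?thesis .
    qed
    \<comment> \<open>The factor \<open>c\<close> is spent at the two end points, where
      \<open>\<psi> <= c \<phi>\<close>; the integral is then bounded from below at no cost.\<close>
    have 1: "loewner_le n (re_mat M) (complex_of_real c \<cdot>\<^sub>m I)"
    proof (rule loewner_leI[OF re_mat_carrier[OF Mcar] smult[OF I]])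
      fix x :: "complex vec" assume x: "x \<in> carrier_vec n"
      have "(\<psi> x 0 + \<psi> x 1) / 2 \<le> c * ((\<phi> x 0 + \<phi> x 1) / 2)"
        using \<psi>\<phi>[of 0 x] \<psi>\<phi>[of 1 x] x by (simp add: field_simps)
      also have "\<dots> \<le> c * Re ((I *\<^sub>v x) \<bullet>c x)" using low[OF x] c(2) by (rule mult_left_mono)
      finally show "Re ((re_mat M *\<^sub>v x) \<bullet>c x) \<le> Re (((complex_of_real c \<cdot>\<^sub>m I) *\<^sub>v x) \<bullet>c x)"
        unfolding Mform[OF x] smult_form[OF I(1) x] .
    qed
    \<comment> \<open>Here one factor \<open>c\<close> is spent under the integral and the return
      from \<open>\<phi>\<close> to \<open>\<psi>\<close> at the midpoint is free; the other
      \<open>c\<close> is carried on both sides.\<close>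
    have 2: "loewner_le n (complex_of_real c \<cdot>\<^sub>m I) (complex_of_real (c * c) \<cdot>\<^sub>m G (1/2))"
    proof (rule loewner_leI[OF smult[OF I] smult[OF Gc]])
      fix x :: "complex vec" assume x: "x \<in> carrier_vec n"
      have "Re ((I *\<^sub>v x) \<bullet>c x) \<le> c * \<psi> x (1/2)"
        using high[OF x] mult_left_mono[OF \<phi>\<psi>[of "1/2" x] c(2)] x by simp
      hence "c * Re ((I *\<^sub>v x) \<bullet>c x) \<le> c * (c * \<psi> x (1/2))" using c(2) by (rule mult_left_mono)
      thus "Re (((complex_of_real c \<cdot>\<^sub>m I) *\<^sub>v x) \<bullet>c x) \<le> Re (((complex_of_real (c * c) \<cdot>\<^sub>m G (1/2)) *\<^sub>v x) \<bullet>c x)"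
        unfolding smult_form[OF I(1) x] smult_form[OF Gc(1) x] G\<psi>[OF x] by (simp only: mult.assoc)
    qed
    have GX: "G = (\<lambda>t. re_mat (matrix_fun f (complex_of_real (1 - t) \<cdot>\<^sub>m A + complex_of_real t \<cdot>\<^sub>m B)))"
      by (rule HOL.ext) (simp add: G_def X_def segment_mat_def)
    have Ghalf: "G (1/2) = re_mat (matrix_fun f ((1/2) \<cdot>\<^sub>m (A + B)))" by (simp only: G_def endpoints(3))
    show ?thesis
      using 1 2 unfolding Ghalf unfolding I_def GX M_def c(3)[symmetric] unfolding c_def by (rule conjI)
  qed
qed

end
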